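(* Let $\mathrm{cr}_P(K_n)$ denote the crossing number of the complete graph $K_n$ in the real projective plane $P$, and let $c_P := \lim_{n\to\infty} \mathrm{cr}_P(K_n)/n^4$ be the projective plane constant. Then \[ c_P < \frac{1}{8\pi^2}. \]
   Context: $K_n$ is the complete graph on $n$ vertices and $P$ is the real projective plane. A drawing of a graph $G$ in a surface $\Sigma$ represents the vertices of $G$ by distinct points of $\Sigma$ and each edge by a simple arc in $\Sigma$ joining the points representing its two ends and containing no other vertex point; as usual, any two edges meet in finitely many points, and no three edges share a common interior point. A crossing is a common interior point of two edges, at which the edges cross transversally. The crossing number $\mathrm{cr}_P(G)$ is the minimum number of crossings over all drawings of $G$ in $P$. The sequence $\{\mathrm{cr}_P(K_n)/n^4\}_{n\ge 1}$ converges, so the limit $c_P=\lim_{n\to\infty}\mathrm{cr}_P(K_n)/n^4$ exists; it is called the projective plane constant. *)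

theory Defs
  imports "HOL-Analysis.Analysis"
begin

definition antipodal_pair :: "real ^ 3 \<Rightarrow> (real ^ 3) set" where
  "antipodal_pair x = {x, - x}"

text \<open>The real projective plane: the 2-sphere with antipodal points identified, carrying the
  quotient topology (see \<open>quotient_map_projective_plane\<close> below).\<close>

definition projective_plane :: "(real ^ 3) set topology" where
  "projective_plane = topology (\<lambda>U. U \<subseteq> antipodal_pair ` sphere 0 1 \<and>
     openin (top_of_set (sphere 0 1)) {x \<in> sphere 0 1. antipodal_pair x \<in> U})"

lemma openin_projective_plane:
  "openin projective_plane U \<longleftrightarrow> U \<subseteq> antipodal_pair ` sphere 0 1 \<and>
     openin (top_of_set (sphere 0 1)) {x \<in> sphere 0 1. antipodal_pair x \<in> U}"
proof -
  let ?P = "\<lambda>U. {x \<in> sphere 0 1. antipodal_pair x \<in> U}"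
  have inter: "?P (S \<inter> T) = ?P S \<inter> ?P T" for S T by auto
  have union: "?P (\<Union>K) = \<Union>(?P ` K)" for K by auto
  have "istopology (\<lambda>U. U \<subseteq> antipodal_pair ` sphere 0 1 \<and>
     openin (top_of_set (sphere 0 1)) (?P U))"
    unfolding istopology_def inter union by blast
  then show ?thesis
    by (simp add: projective_plane_def topology_inverse')
qed

lemma topspace_projective_plane: "topspace projective_plane = antipodal_pair ` sphere 0 1"
proof -
  have "{x \<in> sphere 0 1. antipodal_pair x \<in> antipodal_pair ` sphere 0 1} = sphere 0 1"
    by auto
  then have "openin projective_plane (antipodal_pair ` sphere 0 1)"
    by (simp add: openin_projective_plane)
  then show ?thesis
    by (metis openin_projective_plane openin_subset openin_topspace subset_antisym)
qed

lemma quotient_map_projective_plane: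
  "quotient_map (top_of_set (sphere 0 1)) projective_plane antipodal_pair"
  unfolding quotient_map_def by (simp add: openin_projective_plane topspace_projective_plane)

definition simple_arc_in :: "'p topology \<Rightarrow> (real \<Rightarrow> 'p) \<Rightarrow> bool" where
  "simple_arc_in X g \<longleftrightarrow> pathin X g \<and> inj_on g {0..1}"

text \<open>Transversality is meant topologically: some chart around \<open>p\<close> carries the two point sets to
  the two coordinate axes.  This excludes tangential touchings.\<close>

definition cross_transversally_at :: "'p topology \<Rightarrow> 'p set \<Rightarrow> 'p set \<Rightarrow> 'p \<Rightarrow> bool" where
  "cross_transversally_at X A B p \<longleftrightarrow>
     (\<exists>U h. openin X U \<and> p \<in> U \<and>
        homeomorphic_map (subtopology X U) (euclidean :: (real \<times> real) topology) h \<and>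
        h p = (0, 0) \<and>
        h ` (A \<inter> U) = UNIV \<times> {0} \<and>
        h ` (B \<inter> U) = {0} \<times> UNIV)"

text \<open>A simple graph is given by its vertex set \<open>V\<close> and its set \<open>E\<close> of edges, each edge being the
  two-element set of its ends.  In a drawing, \<open>\<phi>\<close> places the vertices and \<open>\<gamma> e\<close> parametrises the
  arc of the edge \<open>e\<close>.  Every common interior point of two edges must be a transversal crossing;
  edges with a common end may cross as well.\<close>

definition edge_interior :: "('v set \<Rightarrow> real \<Rightarrow> 'p) \<Rightarrow> 'v set \<Rightarrow> 'p set" where
  "edge_interior \<gamma> e = \<gamma> e ` {0<..<1}"

definition is_drawing ::
    "'p topology \<Rightarrow> 'v set \<Rightarrow> 'v set set \<Rightarrow> ('v \<Rightarrow> 'p) \<Rightarrow> ('v set \<Rightarrow> real \<Rightarrow> 'p) \<Rightarrow> bool" where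
  "is_drawing X V E \<phi> \<gamma> \<longleftrightarrow>
     \<phi> ` V \<subseteq> topspace X \<and> inj_on \<phi> V \<and>
     (\<forall>e\<in>E. simple_arc_in X (\<gamma> e) \<and> {\<gamma> e 0, \<gamma> e 1} = \<phi> ` e \<and>
        edge_interior \<gamma> e \<inter> \<phi> ` V = {}) \<and>
     (\<forall>e\<in>E. \<forall>f\<in>E. e \<noteq> f \<longrightarrow>
        finite (\<gamma> e ` {0..1} \<inter> \<gamma> f ` {0..1}) \<and>
        (\<forall>p \<in> edge_interior \<gamma> e \<inter> edge_interior \<gamma> f.
           cross_transversally_at X (\<gamma> e ` {0..1}) (\<gamma> f ` {0..1}) p)) \<and>
     (\<forall>e\<in>E. \<forall>f\<in>E. \<forall>g\<in>E. e \<noteq> f \<and> e \<noteq> g \<and> f \<noteq> g \<longrightarrow>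
        edge_interior \<gamma> e \<inter> edge_interior \<gamma> f \<inter> edge_interior \<gamma> g = {})"

text \<open>As no three edges of a drawing share an interior point, every crossing point belongs to
  exactly one pair of edges, so counting points counts crossings.\<close>

definition crossings :: "'v set set \<Rightarrow> ('v set \<Rightarrow> real \<Rightarrow> 'p) \<Rightarrow> 'p set" where
  "crossings E \<gamma> =
     {p. \<exists>e\<in>E. \<exists>f\<in>E. e \<noteq> f \<and> p \<in> edge_interior \<gamma> e \<inter> edge_interior \<gamma> f}"

text \<open>\<open>Inf\<close> on the natural numbers is the minimum of a nonempty set.  Every finite graph has a
  drawing in every connected surface, so the junk value \<open>Inf {} = 0\<close> does not arise there.\<close>

definition crossing_number :: "'p topology \<Rightarrow> 'v set \<Rightarrow> 'v set set \<Rightarrow> nat" where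
  "crossing_number X V E = Inf {card (crossings E \<gamma>) | \<phi> \<gamma>. is_drawing X V E \<phi> \<gamma>}"

definition cr_P_complete :: "nat \<Rightarrow> nat" where
  "cr_P_complete n = crossing_number projective_plane {..<n} {e. e \<subseteq> {..<n} \<and> card e = 2}"

definition projective_plane_constant :: real where
  "projective_plane_constant = lim (\<lambda>n. real (cr_P_complete n) / real n ^ 4)"

end

theory Submission
  imports Defs "HOL-Real_Asymp.Real_Asymp"
begin

text \<open>Deleting vertices from an optimal drawing shows that \<open>cr (K_n) / (n choose 4)\<close> is nondecreasing, once
  one knows that in an optimal drawing adjacent edges do not cross: otherwise exchanging the initial
  segments of two such edges and cutting a corner removes a crossing.  Hence the limit exists, and it
  is bounded by \<open>c\<close> as soon as \<open>K_n\<close> has drawings with at most \<open>c n^4\<close> crossings for infinitely many \<open>n\<close>.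

  All drawings used for the upper bound consist of points in general position in the projective
  plane joined by projective segments, so that crossings are read off from signs of determinants.
  If every point has a direction that splits the edges at it evenly, replacing each point by two
  points close together in that direction turns a drawing of \<open>K_m\<close> with \<open>t\<close> crossings into a drawing of
  \<open>K_2m\<close> with at most \<open>16 t + m (m - 2)^2 + m (m - 1) / 2\<close> crossings, and this can be iterated.  Starting from
  a drawing of \<open>K_18\<close> with 684 crossings, found by computer search, one obtains the limit
  \<open>1323 / 18^4 = 0.01260... < 0.01266... = 1 / (8 pi^2)\<close>.\<close>

section \<open>Transversal crossings and arcs\<close>

text \<open>The value 1 / (8 pi^2) is what random points give. Two lines of the projective plane, of
  length pi, meet once; the shorter segment between two uniform random points has mean length 1; so
  two disjoint edges cross with probability 1 / pi^2, and there are about n^4 / 8 pairs of them. The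
  18 points, also joined by shorter segments, beat this average. In the doubling, the cubic term
  comes from edges that leave the two twins of a point on the same side. An even split makes such
  pairs as few as possible, and it can be restored after each doubling because a twin can be put on
  the smaller side. The quadratic term allows one crossing for any two pairs of twins. Doubling
  controls only the signs of determinants of three points. These decide collinearity and crossings
  but not triple points, which are removed at the end by a perturbation that keeps all signs. In the
  uncrossing, the obstacle is a common first crossing of the two edges: a plain exchange would turn
  it into a touching, which a drawing does not allow, and this is why a corner has to be cut
  there.\<close>

definition plane_chart :: "'p topology \<Rightarrow> 'p set \<Rightarrow> ('p \<Rightarrow> real \<times> real) \<Rightarrow> (real \<times> real \<Rightarrow> 'p) \<Rightarrow> bool" where
  "plane_chart X U h j \<longleftrightarrow> openin X U \<and> homeomorphic_maps (subtopology X U) euclidean h j"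

lemma plane_chartD:
  assumes "plane_chart X U h j"
  shows "openin X U" "\<And>z. j z \<in> U" "\<And>z. h (j z) = z" "\<And>u. u \<in> U \<Longrightarrow> j (h u) = u"
    "continuous_map euclidean X j" "continuous_map (subtopology X U) euclidean h"
proof -
  have U: "openin X U" and hm: "homeomorphic_maps (subtopology X U) euclidean h j"
    using assms by (auto simp: plane_chart_def)
  have tU: "topspace (subtopology X U) = U"
    by (rule topspace_subtopology_subset[OF openin_subset[OF U]])
  show "openin X U" by fact
  show "h (j z) = z" for z using hm by (cases z) (simp add: homeomorphic_maps_def)
  show "\<And>u. u \<in> U \<Longrightarrow> j (h u) = u" using hm tU by (simp add: homeomorphic_maps_def)
  show "continuous_map (subtopology X U) euclidean h" using hm by (simp add: homeomorphic_maps_def)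
  have c: "continuous_map euclidean (subtopology X U) j" using hm by (simp add: homeomorphic_maps_def)
  then show "continuous_map euclidean X j" by (simp add: continuous_map_in_subtopology)
  show "j z \<in> U" for z
    using continuous_map_image_subset_topspace[OF c] tU by auto
qed

text \<open>With the inverse \<open>j\<close> of the chart, both sets are read off from membership
  of \<open>j (x, y)\<close>; later arguments use this form and do not handle images under
  \<open>h\<close>.\<close>

lemma cross_transversally_at_iff:
  "cross_transversally_at X A B p \<longleftrightarrow>
     (\<exists>U h j. plane_chart X U h j \<and> p = j (0, 0) \<and>
        (\<forall>x y. j (x, y) \<in> A \<longleftrightarrow> y = 0) \<and> (\<forall>x y. j (x, y) \<in> B \<longleftrightarrow> x = 0))"
proof
  assume "cross_transversally_at X A B p"
  then obtain U h where U: "openin X U" "p \<in> U"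
    "homeomorphic_map (subtopology X U) (euclidean :: (real \<times> real) topology) h"
    "h p = (0, 0)" and A: "h ` (A \<inter> U) = UNIV \<times> {0}" and B: "h ` (B \<inter> U) = {0} \<times> UNIV"
    unfolding cross_transversally_at_def by blast
  then obtain j where "homeomorphic_maps (subtopology X U) (euclidean :: (real \<times> real) topology) h j"
    using homeomorphic_map_maps by blast
  then have ch: "plane_chart X U h j" using U by (simp add: plane_chart_def)
  note c = plane_chartD[OF ch]
  have "j z \<in> S \<longleftrightarrow> z \<in> h ` (S \<inter> U)" for z S
    using c(2-4) by (metis IntD1 IntD2 IntI image_iff)
  then have "j (x, y) \<in> A \<longleftrightarrow> y = 0" "j (x, y) \<in> B \<longleftrightarrow> x = 0" for x y
    by (auto simp: A B)
  moreover have "p = j (0, 0)" using c(4)[OF U(2)] U(4) by simp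
  ultimately show "\<exists>U h j. plane_chart X U h j \<and> p = j (0, 0) \<and>
        (\<forall>x y. j (x, y) \<in> A \<longleftrightarrow> y = 0) \<and> (\<forall>x y. j (x, y) \<in> B \<longleftrightarrow> x = 0)"
    using ch by blast
next
  assume "\<exists>U h j. plane_chart X U h j \<and> p = j (0, 0) \<and>
        (\<forall>x y. j (x, y) \<in> A \<longleftrightarrow> y = 0) \<and> (\<forall>x y. j (x, y) \<in> B \<longleftrightarrow> x = 0)"
  then obtain U h j where ch: "plane_chart X U h j" and p: "p = j (0, 0)"
    and A: "\<And>x y. j (x, y) \<in> A \<longleftrightarrow> y = 0" and B: "\<And>x y. j (x, y) \<in> B \<longleftrightarrow> x = 0" by blast
  note c = plane_chartD[OF ch]
  have "homeomorphic_map (subtopology X U) (euclidean :: (real \<times> real) topology) h"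
    using ch homeomorphic_map_maps unfolding plane_chart_def by blast
  moreover have im: "h ` (S \<inter> U) = {z. j z \<in> S}" for S
  proof
    show "h ` (S \<inter> U) \<subseteq> {z. j z \<in> S}" using c(4) by auto
    show "{z. j z \<in> S} \<subseteq> h ` (S \<inter> U)"
    proof
      fix z assume "z \<in> {z. j z \<in> S}"
      then have "j z \<in> S \<inter> U" using c(2) by auto
      then show "z \<in> h ` (S \<inter> U)" using c(3)[of z] by (metis image_eqI)
    qed
  qed
  moreover have "h ` (A \<inter> U) = UNIV \<times> {0}" "h ` (B \<inter> U) = {0} \<times> UNIV"
    unfolding im by (auto simp: A B)
  ultimately show "cross_transversally_at X A B p"
    unfolding cross_transversally_at_def using c p by (intro exI[of _ U] exI[of _ h]) auto
qed

lemma open_square_inside: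
  fixes S :: "(real \<times> real) set"
  assumes "open S" "(0, 0) \<in> S"
  obtains \<epsilon> where "\<epsilon> > 0" "{-\<epsilon>..\<epsilon>} \<times> {-\<epsilon>..\<epsilon>} \<subseteq> S"
proof -
  obtain A B where AB: "open A" "open B" "0 \<in> A" "0 \<in> B" "A \<times> B \<subseteq> S"
    using assms by (rule open_prod_elim) auto
  obtain e where e: "e > 0" "cball 0 e \<subseteq> A \<inter> B"
    by (metis AB(1-4) IntI open_Int open_contains_cball)
  have "{-e..e} \<subseteq> cball 0 e" by (auto simp: dist_real_def)
  then have "{-e..e} \<times> {-e..e} \<subseteq> S" using e AB by blast
  then show ?thesis using that e by blast
qed

text \<open>A transversal crossing asks for a chart onto the whole plane, so a chart cut down to a
  small square has to be stretched again. The stretching works in each coordinate separately and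
  maps each axis to itself.\<close>

lemma homeomorphic_maps_square_plane:
  fixes \<epsilon> :: real
  assumes "\<epsilon> > 0"
  shows "homeomorphic_maps (top_of_set ({-\<epsilon><..<\<epsilon>} \<times> {-\<epsilon><..<\<epsilon>})) (euclidean :: (real \<times> real) topology)
    (\<lambda>(x, y). (x / (\<epsilon> - \<bar>x\<bar>), y / (\<epsilon> - \<bar>y\<bar>))) (\<lambda>(x, y). (\<epsilon> * x / (1 + \<bar>x\<bar>), \<epsilon> * y / (1 + \<bar>y\<bar>)))"
proof -
  have 1: "\<bar>\<epsilon> * x / (1 + \<bar>x\<bar>)\<bar> < \<epsilon>" for x :: real
    using assms by (simp add: abs_mult field_simps)
  have 2: "- \<epsilon> < \<epsilon> * x / (1 + \<bar>x\<bar>)" "\<epsilon> * x / (1 + \<bar>x\<bar>) < \<epsilon>" for x :: real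
    using 1[of x] by (metis abs_less_iff minus_less_iff)+
  have 3: "\<epsilon> * (x / (\<epsilon> - \<bar>x\<bar>)) / (1 + \<bar>x / (\<epsilon> - \<bar>x\<bar>)\<bar>) = x" if "- \<epsilon> < x" "x < \<epsilon>" for x
  proof -
    have "\<epsilon> - \<bar>x\<bar> > 0" using that by auto
    then show ?thesis using assms by (simp add: abs_divide field_simps)
  qed
  have 4: "(\<epsilon> * x / (1 + \<bar>x\<bar>)) / (\<epsilon> - \<bar>\<epsilon> * x / (1 + \<bar>x\<bar>)\<bar>) = x" for x :: real
  proof -
    have p: "1 + \<bar>x\<bar> > 0" by auto
    have "\<epsilon> - \<bar>\<epsilon> * x / (1 + \<bar>x\<bar>)\<bar> = \<epsilon> / (1 + \<bar>x\<bar>)"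
      using assms p by (simp add: abs_mult abs_divide field_simps)
    then show ?thesis using assms p by simp
  qed
  have "continuous_on ({- \<epsilon><..<\<epsilon>} \<times> {- \<epsilon><..<\<epsilon>}) (\<lambda>z. (fst z / (\<epsilon> - \<bar>fst z\<bar>), snd z / (\<epsilon> - \<bar>snd z\<bar>)))"
    by (intro continuous_on_Pair continuous_on_divide continuous_on_diff continuous_on_const
        continuous_on_rabs continuous_on_fst continuous_on_snd continuous_on_id) force+
  moreover have "continuous_on UNIV (\<lambda>z :: real \<times> real. (\<epsilon> * fst z / (1 + \<bar>fst z\<bar>), \<epsilon> * snd z / (1 + \<bar>snd z\<bar>)))"
    by (intro continuous_on_Pair continuous_on_divide continuous_on_add continuous_on_mult continuous_on_const
        continuous_on_rabs continuous_on_fst continuous_on_snd continuous_on_id) force+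
  ultimately show ?thesis
    using 2 3 4
    by (simp del: times_divide_eq_right times_divide_eq_left divide_divide_eq_left abs_divide
        add: homeomorphic_maps_def continuous_map_in_subtopology case_prod_unfold Pi_iff)
qed

text \<open>A crossing depends only on the two sets near \<open>p\<close>: the chart is cut down to
  a square inside \<open>W\<close> and stretched to the plane. In this way rerouted edges inherit
  transversality from the edges with which they agree locally, and segments inherit it from their
  lines.\<close>

lemma cross_transversally_at_local:
  assumes cr: "cross_transversally_at X A B p" and W: "openin X W" "p \<in> W"
    and A: "A \<inter> W = A' \<inter> W" and B: "B \<inter> W = B' \<inter> W"
  shows "cross_transversally_at X A' B' p"
proof -
  obtain U h j where ch: "plane_chart X U h j" and p: "p = j (0, 0)"
    and jA: "\<And>x y. j (x, y) \<in> A \<longleftrightarrow> y = 0" and jB: "\<And>x y. j (x, y) \<in> B \<longleftrightarrow> x = 0"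
    using cr unfolding cross_transversally_at_iff by blast
  note c = plane_chartD[OF ch]
  have "open {z. j z \<in> W}"
    using openin_continuous_map_preimage[OF c(5) W(1)] by simp
  then obtain \<epsilon> where \<epsilon>: "\<epsilon> > 0" and sub: "{-\<epsilon>..\<epsilon>} \<times> {-\<epsilon>..\<epsilon>} \<subseteq> {z. j z \<in> W}"
    using open_square_inside[of "{z. j z \<in> W}"] W(2) p by auto
  define Q where "Q = {-\<epsilon><..<\<epsilon>} \<times> {-\<epsilon><..<\<epsilon>}"
  have QW: "j z \<in> W" if "z \<in> Q" for z
  proof -
    have "z \<in> {-\<epsilon>..\<epsilon>} \<times> {-\<epsilon>..\<epsilon>}" using that by (auto simp: Q_def)
    then show ?thesis using sub by blast
  qed
  define U' where "U' = {u \<in> U. h u \<in> Q}"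
  have tU: "topspace (subtopology X U) = U"
    by (rule topspace_subtopology_subset[OF openin_subset[OF c(1)]])
  have "open Q" unfolding Q_def by (intro open_Times) auto
  then have "openin (subtopology X U) U'"
    using openin_continuous_map_preimage[OF c(6), of Q] unfolding U'_def tU by simp
  then have oU': "openin X U'"
    using c(1) openin_open_subtopology by blast
  have "homeomorphic_maps (subtopology (subtopology X U) U') (subtopology euclidean Q) h j"
  proof (rule homeomorphic_maps_subtopologies)
    show "homeomorphic_maps (subtopology X U) euclidean h j" using ch by (simp add: plane_chart_def)
    show "h ` (topspace (subtopology X U) \<inter> U') = topspace euclidean \<inter> Q"
    proof -
      have "z \<in> h ` (U \<inter> U')" if "z \<in> Q" for z
      proof
        show "z = h (j z)" using c(3) by simp
        show "j z \<in> U \<inter> U'" using that c(2,3) by (simp add: U'_def)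
      qed
      moreover have "h ` (U \<inter> U') \<subseteq> Q" by (auto simp: U'_def)
      ultimately show ?thesis unfolding tU topspace_euclidean by blast
    qed
  qed
  moreover have "subtopology (subtopology X U) U' = subtopology X U'"
    unfolding subtopology_subtopology by (rule arg_cong[where f = "subtopology X"]) (auto simp: U'_def)
  ultimately have "homeomorphic_maps (subtopology X U') (top_of_set Q) h j" by simp
  then obtain h' where "homeomorphic_maps (subtopology X U') euclidean h'
      (j \<circ> (\<lambda>(x, y). (\<epsilon> * x / (1 + \<bar>x\<bar>), \<epsilon> * y / (1 + \<bar>y\<bar>))))"
    using homeomorphic_maps_compose[OF conjI[OF _ homeomorphic_maps_square_plane[OF \<epsilon>, folded Q_def]]] by blast
  then have ch': "plane_chart X U' h' (j \<circ> (\<lambda>(x, y). (\<epsilon> * x / (1 + \<bar>x\<bar>), \<epsilon> * y / (1 + \<bar>y\<bar>))))"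
    (is "plane_chart _ _ _ ?j") using oU' by (simp add: plane_chart_def)
  have inW: "?j z \<in> W" for z
  proof -
    obtain x y where z: "z = (x, y)" by fastforce
    have 1: "\<bar>\<epsilon> * x / (1 + \<bar>x\<bar>)\<bar> < \<epsilon>" for x :: real
      using \<epsilon> by (simp add: abs_mult field_simps)
    have "(\<epsilon> * x / (1 + \<bar>x\<bar>), \<epsilon> * y / (1 + \<bar>y\<bar>)) \<in> Q"
      using 1[of x] 1[of y] unfolding Q_def abs_less_iff by (auto simp: minus_less_iff)
    then show ?thesis using QW z by simp
  qed
  have "?j (x, y) \<in> A' \<longleftrightarrow> y = 0" for x y
  proof -
    have "?j (x, y) \<in> A' \<longleftrightarrow> ?j (x, y) \<in> A" using inW[of "(x, y)"] A by blast
    also have "\<dots> \<longleftrightarrow> y = 0" using \<epsilon> by (simp add: jA add_nonneg_eq_0_iff)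
    finally show ?thesis .
  qed
  moreover have "?j (x, y) \<in> B' \<longleftrightarrow> x = 0" for x y
  proof -
    have "?j (x, y) \<in> B' \<longleftrightarrow> ?j (x, y) \<in> B" using inW[of "(x, y)"] B by blast
    also have "\<dots> \<longleftrightarrow> x = 0" using \<epsilon> by (simp add: jB add_nonneg_eq_0_iff)
    finally show ?thesis .
  qed
  moreover have "p = ?j (0, 0)" using p by simp
  ultimately show ?thesis
    unfolding cross_transversally_at_iff using ch' by blast
qed

section \<open>Arcs as point sets with two ends: cutting, reversing, joining\<close>

definition arc_between :: "'p topology \<Rightarrow> 'p set \<Rightarrow> 'p \<Rightarrow> 'p \<Rightarrow> bool" where
  "arc_between X A a b \<longleftrightarrow> (\<exists>g. simple_arc_in X g \<and> g ` {0..1} = A \<and> g 0 = a \<and> g 1 = b)"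

lemma pathin_compose:
  assumes "pathin X g" "continuous_on {0..1} f" "f \<in> {0..1} \<rightarrow> {0..1}"
  shows "pathin X (\<lambda>t. g (f t))"
proof -
  have "continuous_map (top_of_set {0..1}) (top_of_set {0..1}) f"
    using assms by (simp add: continuous_map_in_subtopology)
  then have "continuous_map (top_of_set {0..1}) X (g \<circ> f)"
    using assms(1) continuous_map_compose unfolding pathin_def by blast
  then show ?thesis by (simp add: pathin_def o_def)
qed

lemma arc_between_sub:
  assumes g: "simple_arc_in X g" and st: "0 \<le> s" "s < t" "t \<le> 1"
  shows "arc_between X (g ` {s..t}) (g s) (g t)"
proof -
  define f where "f = (\<lambda>x. s + (t - s) * x)"
  have fi: "f ` {0..1} = {s..t}"
  proof
    show "f ` {0..1} \<subseteq> {s..t}"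
    proof
      fix y assume "y \<in> f ` {0..1}"
      then obtain x where x: "0 \<le> x" "x \<le> 1" "y = s + (t - s) * x" by (auto simp: f_def)
      have "0 \<le> (t - s) * x" "(t - s) * x \<le> (t - s) * 1"
        using st x by (auto intro: mult_left_mono simp del: mult_1_right)
      then show "y \<in> {s..t}" using x by auto
    qed
    show "{s..t} \<subseteq> f ` {0..1}"
    proof
      fix y assume y: "y \<in> {s..t}"
      show "y \<in> f ` {0..1}"
      proof
        show "y = f ((y - s) / (t - s))" using st by (simp add: f_def)
        show "(y - s) / (t - s) \<in> {0..1}" using st y by simp
      qed
    qed
  qed
  have inj: "inj_on f {0..1}" using st by (auto simp: inj_on_def f_def)
  have "simple_arc_in X (\<lambda>x. g (f x))"
    unfolding simple_arc_in_def
  proof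
    show "pathin X (\<lambda>x. g (f x))"
    proof (rule pathin_compose)
      show "pathin X g" using g by (simp add: simple_arc_in_def)
      show "continuous_on {0..1} f" unfolding f_def by (intro continuous_intros)
      have "f ` {0..1} \<subseteq> {0..1}" unfolding fi using st by auto
      then show "f \<in> {0..1} \<rightarrow> {0..1}" by (simp add: image_subset_iff_funcset)
    qed
    have "inj_on g (f ` {0..1})"
      using g st unfolding fi simple_arc_in_def by (meson atLeastatMost_subset_iff inj_on_subset)
    then show "inj_on (\<lambda>x. g (f x)) {0..1}"
      using comp_inj_on[OF inj] by (simp add: o_def)
  qed
  moreover have "(\<lambda>x. g (f x)) ` {0..1} = g ` {s..t}"
    unfolding fi[symmetric] by (simp add: image_image)
  moreover have "g (f 0) = g s" "g (f 1) = g t" by (auto simp: f_def)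
  ultimately show ?thesis unfolding arc_between_def by (intro exI[of _ "\<lambda>x. g (f x)"]) auto
qed

lemma arc_between_reverse:
  assumes "arc_between X A a b"
  shows "arc_between X A b a"
proof -
  obtain g where g: "simple_arc_in X g" "g ` {0..1} = A" "g 0 = a" "g 1 = b"
    using assms by (auto simp: arc_between_def)
  have fi: "(\<lambda>t. 1 - t) ` {0..1} = {0..1 :: real}" by (simp add: image_diff_atLeastAtMost)
  have "simple_arc_in X (\<lambda>t. g (1 - t))"
    unfolding simple_arc_in_def
  proof
    show "pathin X (\<lambda>t. g (1 - t))"
      using g(1) by (intro pathin_compose[where f = "\<lambda>t. 1 - t"] continuous_intros) (auto simp: simple_arc_in_def)
    show "inj_on (\<lambda>t. g (1 - t)) {0..1}"
    proof (rule inj_onI)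
      fix s t :: real assume "s \<in> {0..1}" "t \<in> {0..1}" "g (1 - s) = g (1 - t)"
      then have "1 - s = 1 - t"
        using g(1) unfolding simple_arc_in_def by (intro inj_onD[of g "{0..1}"]) auto
      then show "s = t" by simp
    qed
  qed
  moreover have "(\<lambda>t. g (1 - t)) ` {0..1} = A"
    using g(2) fi by (metis image_image)
  ultimately show ?thesis unfolding arc_between_def using g by (intro exI[of _ "\<lambda>t. g (1 - t)"]) auto
qed

lemma arc_between_join:
  assumes "arc_between X A a b" "arc_between X B b c" "A \<inter> B = {b}"
  shows "arc_between X (A \<union> B) a c"
proof -
  obtain g where g: "pathin X g" "inj_on g {0..1}" "g ` {0..1} = A" "g 0 = a" "g 1 = b"
    using assms(1) by (auto simp: arc_between_def simple_arc_in_def)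
  obtain h where h: "pathin X h" "inj_on h {0..1}" "h ` {0..1} = B" "h 0 = b" "h 1 = c"
    using assms(2) by (auto simp: arc_between_def simple_arc_in_def)
  define k where "k = (\<lambda>t :: real. if t \<le> 1/2 then g (2 * t) else h (2 * t - 1))"
  have "continuous_map (top_of_set {0..1}) X k"
    unfolding k_def
  proof (rule continuous_map_cases_le)
    have "continuous_map (top_of_set {0..1/2}) X (g \<circ> (\<lambda>t. 2 * t))"
      by (rule continuous_map_compose[OF _ g(1)[unfolded pathin_def]])
         (auto simp: continuous_map_in_subtopology intro!: continuous_intros)
    moreover have "subtopology (top_of_set {0..1}) {x \<in> topspace (top_of_set {0..1}). x \<le> 1/2} = top_of_set {0..1/2 :: real}"
      unfolding subtopology_subtopology by (rule arg_cong[where f = top_of_set]) auto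
    ultimately show "continuous_map (subtopology (top_of_set {0..1}) {x \<in> topspace (top_of_set {0..1}). x \<le> 1/2}) X (\<lambda>x. g (2 * x))"
      by (simp add: o_def)
    have "continuous_map (top_of_set {1/2..1}) X (h \<circ> (\<lambda>t. 2 * t - 1))"
      by (rule continuous_map_compose[OF _ h(1)[unfolded pathin_def]])
         (auto simp: continuous_map_in_subtopology intro!: continuous_intros)
    moreover have "subtopology (top_of_set {0..1}) {x \<in> topspace (top_of_set {0..1}). 1/2 \<le> x} = top_of_set {1/2..1 :: real}"
      unfolding subtopology_subtopology by (rule arg_cong[where f = top_of_set]) auto
    ultimately show "continuous_map (subtopology (top_of_set {0..1}) {x \<in> topspace (top_of_set {0..1}). 1/2 \<le> x}) X (\<lambda>x. h (2 * x - 1))"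
      by (simp add: o_def)
    show "g (2 * x) = h (2 * x - 1)" if "x = 1 / 2" for x
      unfolding that by (simp add: g h)
  qed auto
  moreover have "inj_on k {0..1}"
  proof -
    have cross: False if "s \<in> {0..1}" "t \<in> {0..1}" "s \<le> 1/2" "\<not> t \<le> 1/2" "g (2 * s) = h (2 * t - 1)" for s t :: real
    proof -
      have "2 * s \<in> {0..1}" "2 * t - 1 \<in> {0..1}" using that by auto
      then have "g (2 * s) \<in> A" "h (2 * t - 1) \<in> B" using g(3) h(3) by blast+
      then have "h (2 * t - 1) = h 0" using assms(3) that h(4) by auto
      then have "2 * t - 1 = 0" using h(2) that by (auto dest!: inj_onD)
      then show False using that by auto
    qed
    show ?thesis
    proof (rule inj_onI)
      fix s t :: real assume st: "s \<in> {0..1}" "t \<in> {0..1}" "k s = k t"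
      consider "s \<le> 1/2" "t \<le> 1/2" | "\<not> s \<le> 1/2" "\<not> t \<le> 1/2" | "s \<le> 1/2" "\<not> t \<le> 1/2" | "\<not> s \<le> 1/2" "t \<le> 1/2"
        by blast
      then show "s = t"
      proof cases
        case 1 then have "2 * s = 2 * t" using st by (intro inj_onD[OF g(2)]) (auto simp: k_def)
        then show ?thesis by simp
      next
        case 2 then have "2 * s - 1 = 2 * t - 1" using st by (intro inj_onD[OF h(2)]) (auto simp: k_def)
        then show ?thesis by simp
      next
        case 3 then show ?thesis using cross[of s t] st by (simp add: k_def)
      next
        case 4 then show ?thesis using cross[of t s] st by (simp add: k_def)
      qed
    qed
  qed
  moreover have "k ` {0..1} = A \<union> B"
  proof
    show "k ` {0..1} \<subseteq> A \<union> B" unfolding g(3)[symmetric] h(3)[symmetric] k_def by auto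
    have "g t \<in> k ` {0..1}" if "t \<in> {0..1}" for t
      using that by (intro image_eqI[of _ _ "t / 2"]) (auto simp: k_def)
    moreover have "h t \<in> k ` {0..1}" if "t \<in> {0..1}" for t
    proof (cases "t = 0")
      case True then show ?thesis using g h by (intro image_eqI[of _ _ "1 / 2"]) (auto simp: k_def)
    next
      case False then show ?thesis using that by (intro image_eqI[of _ _ "(t + 1) / 2"]) (auto simp: k_def field_simps)
    qed
    ultimately show "A \<union> B \<subseteq> k ` {0..1}" unfolding g(3)[symmetric] h(3)[symmetric] by blast
  qed
  moreover have "k 0 = a" "k 1 = c" by (auto simp: k_def g h)
  ultimately show ?thesis
    unfolding arc_between_def simple_arc_in_def pathin_def by (intro exI[of _ k]) auto
qed

lemma simple_arc_in_closedin:
  assumes "Hausdorff_space X" "pathin X g" "{s..t} \<subseteq> {0..1}"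
  shows "closedin X (g ` {s..t})"
proof -
  have "compactin (top_of_set {0..1}) {s..t}"
    using assms(3) by (simp add: compactin_subtopology)
  then have "compactin X (g ` {s..t})"
    using assms(2) image_compactin unfolding pathin_def by blast
  then show ?thesis using assms(1) compactin_imp_closedin by blast
qed

lemma arc_between_closedin:
  assumes "Hausdorff_space X" "arc_between X A a b"
  shows "closedin X A"
  using assms simple_arc_in_closedin[of X _ 0 1] unfolding arc_between_def simple_arc_in_def by auto

lemma arc_between_chart_segment:
  assumes ch: "plane_chart X U h j" and "a \<noteq> b"
  shows "arc_between X (j ` closed_segment a b) (j a) (j b)"
proof -
  note c = plane_chartD[OF ch]
  have injj: "inj j" using c(3) by (metis injI)
  have "simple_arc_in X (\<lambda>t. j (linepath a b t))"
    unfolding simple_arc_in_def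
  proof
    have "continuous_map (top_of_set {0..1}) euclidean (linepath a b)"
      by (simp add: continuous_on_linepath)
    then have "continuous_map (top_of_set {0..1}) X (j \<circ> linepath a b)"
      using c(5) continuous_map_compose by blast
    then show "pathin X (\<lambda>t. j (linepath a b t))" by (simp add: pathin_def o_def)
    have "inj_on (linepath a b) {0..1}" using arc_linepath[OF assms(2)] by (simp add: arc_def)
    then show "inj_on (\<lambda>t. j (linepath a b t)) {0..1}"
      using comp_inj_on[of "linepath a b" _ j] injj by (simp add: o_def inj_on_subset)
  qed
  moreover have "(\<lambda>t. j (linepath a b t)) ` {0..1} = j ` closed_segment a b"
    by (simp flip: linepath_image_01 add: image_image)
  ultimately show ?thesis
    unfolding arc_between_def by (intro exI[of _ "\<lambda>t. j (linepath a b t)"]) (auto simp: linepath_def)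
qed

section \<open>Uncrossing adjacent edges\<close>

lemma is_drawingD:
  assumes "is_drawing X V E \<phi> \<gamma>"
  shows "\<phi> ` V \<subseteq> topspace X" "inj_on \<phi> V"
    "e \<in> E \<Longrightarrow> simple_arc_in X (\<gamma> e)"
    "e \<in> E \<Longrightarrow> {\<gamma> e 0, \<gamma> e 1} = \<phi> ` e"
    "e \<in> E \<Longrightarrow> edge_interior \<gamma> e \<inter> \<phi> ` V = {}"
    "e \<in> E \<Longrightarrow> f \<in> E \<Longrightarrow> e \<noteq> f \<Longrightarrow> finite (\<gamma> e ` {0..1} \<inter> \<gamma> f ` {0..1})"
    "e \<in> E \<Longrightarrow> f \<in> E \<Longrightarrow> e \<noteq> f \<Longrightarrow> p \<in> edge_interior \<gamma> e \<Longrightarrow> p \<in> edge_interior \<gamma> f \<Longrightarrow>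
       cross_transversally_at X (\<gamma> e ` {0..1}) (\<gamma> f ` {0..1}) p"
    "e \<in> E \<Longrightarrow> f \<in> E \<Longrightarrow> g \<in> E \<Longrightarrow> e \<noteq> f \<Longrightarrow> e \<noteq> g \<Longrightarrow> f \<noteq> g \<Longrightarrow>
       edge_interior \<gamma> e \<inter> edge_interior \<gamma> f \<inter> edge_interior \<gamma> g = {}"
  using assms by (simp_all add: is_drawing_def)

lemma arc_between_ends: "arc_between X A a b \<Longrightarrow> a \<in> A \<and> b \<in> A"
  unfolding arc_between_def by force

text \<open>An edge contains no vertices but its ends, so crossings become statements about point
  sets, independent of the parametrization.\<close>

lemma edge_interior_eq:
  assumes "is_drawing X V E \<phi> \<gamma>" "e \<in> E" "e \<subseteq> V"
  shows "edge_interior \<gamma> e = \<gamma> e ` {0..1} - \<phi> ` V"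
proof -
  have arc: "inj_on (\<gamma> e) {0..1}" and ends: "{\<gamma> e 0, \<gamma> e 1} = \<phi> ` e"
    and int: "edge_interior \<gamma> e \<inter> \<phi> ` V = {}"
    using is_drawingD(3-5)[OF assms(1,2)] by (auto simp: simple_arc_in_def)
  have "{0..1} = {0<..<1} \<union> {0, 1 :: real}" by auto
  then have "\<gamma> e ` {0..1} = edge_interior \<gamma> e \<union> \<phi> ` e"
    unfolding edge_interior_def ends[symmetric] by auto
  then show ?thesis using int assms(3) by blast
qed

lemma is_drawing_closedin_edge:
  assumes "Hausdorff_space X" "is_drawing X V E \<phi> \<gamma>" "e \<in> E"
  shows "closedin X (\<gamma> e ` {0..1})"
  using assms(1) simple_arc_in_closedin[of X "\<gamma> e" 0 1] is_drawingD(3)[OF assms(2,3)]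
  by (simp add: simple_arc_in_def)

text \<open>The bookkeeping common to all exchanges. Away from the vertices and from the freshly
  drawn set \<open>Z\<close>, each new arc agrees locally with one of the old edges; where the two
  new arcs meet, they agree with \<open>e\<close> and \<open>f\<close> respectively; and
  \<open>Z\<close> avoids the vertices and all other edges. Hence every new crossing is an old one
  and still transversal, while \<open>q\<close> disappears because it does not lie on both new
  arcs.\<close>

lemma reroute_adjacent_edges:
  assumes D: "is_drawing X V E \<phi> \<gamma>" and EV: "\<And>k. k \<in> E \<Longrightarrow> k \<subseteq> V"
    and ef: "e \<in> E" "f \<in> E" "e \<noteq> f" "e = {u, v}" "f = {u, w}"
    and A': "arc_between X A' (\<phi> u) (\<phi> v)" and B': "arc_between X B' (\<phi> u) (\<phi> w)"
    and Z: "Z \<inter> \<phi> ` V = {}" "\<And>k. k \<in> E \<Longrightarrow> k \<noteq> e \<Longrightarrow> k \<noteq> f \<Longrightarrow> Z \<inter> \<gamma> k ` {0..1} = {}"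
    and sub: "A' \<subseteq> \<gamma> e ` {0..1} \<union> \<gamma> f ` {0..1} \<union> Z" "B' \<subseteq> \<gamma> e ` {0..1} \<union> \<gamma> f ` {0..1} \<union> Z"
    and vw: "\<phi> w \<notin> A'" "\<phi> v \<notin> B'"
    and locA: "\<And>r. r \<in> A' \<Longrightarrow> r \<notin> \<phi> ` V \<Longrightarrow> r \<notin> Z \<Longrightarrow> \<exists>W. openin X W \<and> r \<in> W \<and>
        (A' \<inter> W = \<gamma> e ` {0..1} \<inter> W \<or> A' \<inter> W = \<gamma> f ` {0..1} \<inter> W)"
    and locB: "\<And>r. r \<in> B' \<Longrightarrow> r \<notin> \<phi> ` V \<Longrightarrow> r \<notin> Z \<Longrightarrow> \<exists>W. openin X W \<and> r \<in> W \<and>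
        (B' \<inter> W = \<gamma> e ` {0..1} \<inter> W \<or> B' \<inter> W = \<gamma> f ` {0..1} \<inter> W)"
    and locAB: "\<And>r. r \<in> A' \<Longrightarrow> r \<in> B' \<Longrightarrow> r \<notin> \<phi> ` V \<Longrightarrow> r \<in> \<gamma> e ` {0..1} \<and> r \<in> \<gamma> f ` {0..1} \<and>
        (\<exists>W. openin X W \<and> r \<in> W \<and> A' \<inter> W = \<gamma> e ` {0..1} \<inter> W \<and> B' \<inter> W = \<gamma> f ` {0..1} \<inter> W)"
    and q: "q \<in> edge_interior \<gamma> e" "q \<in> edge_interior \<gamma> f" "\<not> (q \<in> A' \<and> q \<in> B')"
  shows "\<exists>\<gamma>'. is_drawing X V E \<phi> \<gamma>' \<and> crossings E \<gamma>' \<subset> crossings E \<gamma>"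
proof -
  define T where "T k = \<gamma> k ` {0..1}" for k
  have int: "edge_interior \<gamma> k = T k - \<phi> ` V" if "k \<in> E" for k
    using edge_interior_eq[OF D that EV[OF that]] by (simp add: T_def)
  have arcT: "simple_arc_in X (\<gamma> k)" "{\<gamma> k 0, \<gamma> k 1} = \<phi> ` k" if "k \<in> E" for k
    using is_drawingD(3,4)[OF D that] by auto
  note topV = is_drawingD(1)[OF D] and injV = is_drawingD(2)[OF D]
  have finT: "finite (T k \<inter> T l)" if "k \<in> E" "l \<in> E" "k \<noteq> l" for k l
    using is_drawingD(6)[OF D that] by (simp add: T_def)
  have crT: "cross_transversally_at X (T k) (T l) r"
    if "k \<in> E" "l \<in> E" "k \<noteq> l" "r \<in> T k" "r \<in> T l" "r \<notin> \<phi> ` V" for k l r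
  proof -
    have "r \<in> edge_interior \<gamma> k" "r \<in> edge_interior \<gamma> l" using that int by blast+
    then show ?thesis using is_drawingD(7)[OF D that(1-3)] by (simp add: T_def)
  qed
  have no3: False if "k \<in> E" "l \<in> E" "m \<in> E" "k \<noteq> l" "k \<noteq> m" "l \<noteq> m"
    "r \<in> T k" "r \<in> T l" "r \<in> T m" "r \<notin> \<phi> ` V" for k l m r
  proof -
    have "r \<in> edge_interior \<gamma> k \<inter> edge_interior \<gamma> l \<inter> edge_interior \<gamma> m" using that int by blast
    then show ?thesis using is_drawingD(8)[OF D that(1-6)] by blast
  qed
  note [simp] = T_def[symmetric]
  note sub = sub[simplified] and locA = locA[simplified] and locB = locB[simplified]
    and locAB = locAB[simplified] and Z = Z[simplified]
  obtain a where a: "simple_arc_in X a" "a ` {0..1} = A'" "a 0 = \<phi> u" "a 1 = \<phi> v"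
    using A' by (auto simp: arc_between_def)
  obtain b where b: "simple_arc_in X b" "b ` {0..1} = B'" "b 0 = \<phi> u" "b 1 = \<phi> w"
    using B' by (auto simp: arc_between_def)
  define \<gamma>' where "\<gamma>' = \<gamma>(e := a, f := b)"
  define S where "S k = (if k = e then A' else if k = f then B' else T k)" for k
  have S: "\<gamma>' k ` {0..1} = S k" for k
    using ef(3) a(2) b(2) by (simp add: \<gamma>'_def S_def)
  have uvw: "u \<in> V" "v \<in> V" "w \<in> V" using EV[OF ef(1)] EV[OF ef(2)] ef by auto
  have vtx: "T k \<inter> \<phi> ` V = \<phi> ` k" if "k \<in> E" for k
  proof -
    have "edge_interior \<gamma> k \<inter> \<phi> ` V = {}" by (rule is_drawingD(5)[OF D that])
    moreover have "{0..1} = {0<..<1} \<union> {0, 1 :: real}" by auto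
    then have "T k = edge_interior \<gamma> k \<union> \<phi> ` k"
      unfolding T_def edge_interior_def arcT(2)[OF that, symmetric] by auto
    ultimately show ?thesis using EV[OF that] by blast
  qed
  have vA': "A' \<inter> \<phi> ` V = {\<phi> u, \<phi> v}"
  proof
    have "A' \<inter> \<phi> ` V \<subseteq> \<phi> ` e \<union> \<phi> ` f" using sub(1) vtx[OF ef(1)] vtx[OF ef(2)] Z(1) by blast
    then show "A' \<inter> \<phi> ` V \<subseteq> {\<phi> u, \<phi> v}" using vw(1) ef by auto
    show "{\<phi> u, \<phi> v} \<subseteq> A' \<inter> \<phi> ` V" using arc_between_ends[OF A'] uvw by auto
  qed
  have vB': "B' \<inter> \<phi> ` V = {\<phi> u, \<phi> w}"
  proof
    have "B' \<inter> \<phi> ` V \<subseteq> \<phi> ` e \<union> \<phi> ` f" using sub(2) vtx[OF ef(1)] vtx[OF ef(2)] Z(1) by blast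
    then show "B' \<inter> \<phi> ` V \<subseteq> {\<phi> u, \<phi> w}" using vw(2) ef by auto
    show "{\<phi> u, \<phi> w} \<subseteq> B' \<inter> \<phi> ` V" using arc_between_ends[OF B'] uvw by auto
  qed
  have int': "edge_interior \<gamma>' k = S k - \<phi> ` V" if k: "k \<in> E" for k
  proof -
    have gen: "g ` {0<..<1} = g ` {0..1} - \<phi> ` V"
      if "inj_on g {0..1}" "g ` {0..1} \<inter> \<phi> ` V = {g 0, g 1}" for g :: "real \<Rightarrow> 'a"
    proof -
      have "g ` {0..1} - {g 0, g 1} = g ` ({0..1} - {0, 1})"
        using that(1) by (subst inj_on_image_set_diff[OF that(1)]) auto
      moreover have "{0..1} - {0, 1} = {0<..<1 :: real}" by auto
      moreover have "g ` {0..1} - \<phi> ` V = g ` {0..1} - (g ` {0..1} \<inter> \<phi> ` V)" by blast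
      ultimately show ?thesis using that(2) by simp
    qed
    consider "k = e" | "k = f" | "k \<noteq> e" "k \<noteq> f" by blast
    then show ?thesis
    proof cases
      case 1
      then show ?thesis using gen[of a] a vA' ef(3) by (simp add: edge_interior_def \<gamma>'_def S_def simple_arc_in_def)
    next
      case 2
      then show ?thesis using gen[of b] b vB' ef(3) by (simp add: edge_interior_def \<gamma>'_def S_def simple_arc_in_def)
    next
      case 3
      then show ?thesis using int[OF k] by (simp add: edge_interior_def \<gamma>'_def S_def)
    qed
  qed
  have mixed: "finite (S k \<inter> T l) \<and> (\<forall>r \<in> S k \<inter> T l - \<phi> ` V. (r \<in> T e \<or> r \<in> T f) \<and>
      cross_transversally_at X (S k) (T l) r \<and> cross_transversally_at X (T l) (S k) r)"
    if l: "l \<in> E" "l \<noteq> e" "l \<noteq> f" and k: "k = e \<or> k = f" for k l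
  proof -
    have subk: "S k \<subseteq> T e \<union> T f \<union> Z" using sub k by (auto simp: S_def)
    have lock: "\<exists>W. openin X W \<and> r \<in> W \<and> (S k \<inter> W = T e \<inter> W \<or> S k \<inter> W = T f \<inter> W)"
      if "r \<in> S k" "r \<notin> \<phi> ` V" "r \<notin> Z" for r
      using k that locA[of r] locB[of r] by (auto simp: S_def split: if_splits)
    have "S k \<inter> T l \<subseteq> (T e \<inter> T l) \<union> (T f \<inter> T l)" using subk Z(2)[OF l] by blast
    then have "finite (S k \<inter> T l)"
      using finT[OF ef(1) l(1)] finT[OF ef(2) l(1)] l by (metis finite_UnI finite_subset)
    moreover have "(r \<in> T e \<or> r \<in> T f) \<and> cross_transversally_at X (S k) (T l) r \<and> cross_transversally_at X (T l) (S k) r"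
      if r: "r \<in> S k" "r \<in> T l" "r \<notin> \<phi> ` V" for r
    proof -
      have rZ: "r \<notin> Z" using Z(2)[OF l] r by blast
      then obtain W where W: "openin X W" "r \<in> W" "S k \<inter> W = T e \<inter> W \<or> S k \<inter> W = T f \<inter> W"
        using lock r by blast
      then obtain m where m: "m \<in> E" "m \<noteq> l" "S k \<inter> W = T m \<inter> W" "m = e \<or> m = f"
        using ef(1,2) l by metis
      then have "r \<in> T m" using r W by blast
      then have "cross_transversally_at X (T m) (T l) r" "cross_transversally_at X (T l) (T m) r"
        using crT m l r by metis+
      then show ?thesis
        using cross_transversally_at_local[OF _ W(1,2), of "T m" "T l" "S k" "T l"]
          cross_transversally_at_local[OF _ W(1,2), of "T l" "T m" "T l" "S k"] m \<open>r \<in> T m\<close> by auto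
    qed
    ultimately show ?thesis by blast
  qed
  have both: "finite (A' \<inter> B') \<and> (\<forall>r \<in> A' \<inter> B' - \<phi> ` V.
      cross_transversally_at X A' B' r \<and> cross_transversally_at X B' A' r)"
  proof -
    have "A' \<inter> B' \<subseteq> {\<phi> u, \<phi> v} \<union> (T e \<inter> T f)" using vA' locAB by blast
    then have "finite (A' \<inter> B')" using finT[OF ef(1-3)] by (meson finite.emptyI finite.insertI finite_UnI finite_subset)
    moreover have "cross_transversally_at X A' B' r \<and> cross_transversally_at X B' A' r"
      if r: "r \<in> A'" "r \<in> B'" "r \<notin> \<phi> ` V" for r
    proof -
      obtain W where W: "openin X W" "r \<in> W" "A' \<inter> W = T e \<inter> W" "B' \<inter> W = T f \<inter> W"
        and rT: "r \<in> T e" "r \<in> T f"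
        using locAB[OF r] by blast
      have "cross_transversally_at X (T e) (T f) r" "cross_transversally_at X (T f) (T e) r"
        using crT ef(1-3) rT r(3) by metis+
      then show ?thesis
        using cross_transversally_at_local[OF _ W(1,2)] W(3,4) by metis
    qed
    ultimately show ?thesis by blast
  qed
  have pair: "finite (S k \<inter> S l) \<and> (\<forall>r \<in> S k \<inter> S l - \<phi> ` V. cross_transversally_at X (S k) (S l) r)"
    if kl: "k \<in> E" "l \<in> E" "k \<noteq> l" for k l
  proof -
    have Sef: "S e = A'" "S f = B'" using ef(3) by (auto simp: S_def)
    have So: "S m = T m" if "m \<noteq> e" "m \<noteq> f" for m using that by (simp add: S_def)
    consider "k = e" "l = f" | "k = f" "l = e" | "k = e \<or> k = f" "l \<noteq> e" "l \<noteq> f"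
      | "k \<noteq> e" "k \<noteq> f" "l = e \<or> l = f" | "k \<noteq> e" "k \<noteq> f" "l \<noteq> e" "l \<noteq> f"
      using kl(3) by blast
    then show ?thesis
    proof cases
      case 1 then show ?thesis using both Sef by simp
    next
      case 2 then show ?thesis using both Sef by (simp add: Int_commute)
    next
      case 3 then show ?thesis using mixed[of l k] kl So[of l] by auto
    next
      case 4 then show ?thesis using mixed[of k l] kl So[of k] by (auto simp: Int_commute)
    next
      case 5 then show ?thesis using finT[OF kl] crT[OF kl] So by auto
    qed
  qed
  have old: "r \<in> T e \<or> r \<in> T f" if "r \<in> S k" "r \<in> T l" "r \<notin> \<phi> ` V" "l \<in> E" "l \<noteq> e" "l \<noteq> f" "k = e \<or> k = f" for r k l
    using mixed[of l k] that by blast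
  have oldef: "r \<in> T e \<and> r \<in> T f" if "r \<in> S e" "r \<in> S f" "r \<notin> \<phi> ` V" for r
    using locAB[of r] that ef(3) by (simp add: S_def)
  have So: "S m = T m" if "m \<noteq> e" "m \<noteq> f" for m using that by (simp add: S_def)
  \<comment> \<open>A common point of a new arc and an untouched edge lies on \<open>e\<close> or
    \<open>f\<close>, and a common point of both new arcs lies on both, so three edges through
    \<open>r\<close> would already share this point in the old drawing.\<close>
  have triple: False if "k \<in> E" "l \<in> E" "m \<in> E" "k \<noteq> l" "k \<noteq> m" "l \<noteq> m"
    "r \<in> S k" "r \<in> S l" "r \<in> S m" "r \<notin> \<phi> ` V" for k l m r
  proof -
    have one: False if "l \<in> E" "m \<in> E" "l \<noteq> m" "k = e \<or> k = f" "l \<noteq> e" "l \<noteq> f" "m \<noteq> e" "m \<noteq> f"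
      "r \<in> S k" "r \<in> T l" "r \<in> T m" for k l m
      using old[of r k l] no3[of e l m r] no3[of f l m r] that \<open>r \<notin> \<phi> ` V\<close> ef(1,2) by blast
    have two: False if "m \<in> E" "m \<noteq> e" "m \<noteq> f" "r \<in> S e" "r \<in> S f" "r \<in> T m" for m
      using oldef[of r] no3[of e f m r] that \<open>r \<notin> \<phi> ` V\<close> ef(1-3) by blast
    show False
    proof (cases "k = e \<or> k = f"; cases "l = e \<or> l = f"; cases "m = e \<or> m = f")
    qed (use that one[of l m k] one[of k m l] one[of k l m] two[of k] two[of l] two[of m] no3[of k l m r] So in metis)+
  qed
  have draw: "is_drawing X V E \<phi> \<gamma>'"
    unfolding is_drawing_def
  proof (intro conjI ballI impI)
    fix k assume k: "k \<in> E"
    show "simple_arc_in X (\<gamma>' k)" using arcT(1)[OF k] a(1) b(1) by (simp add: \<gamma>'_def)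
    show "{\<gamma>' k 0, \<gamma>' k 1} = \<phi> ` k" using arcT(2)[OF k] a b ef by (auto simp: \<gamma>'_def)
    show "edge_interior \<gamma>' k \<inter> \<phi> ` V = {}" using int'[OF k] by blast
    fix l assume l: "l \<in> E"
    {
      assume "k \<noteq> l"
      show "finite (\<gamma>' k ` {0..1} \<inter> \<gamma>' l ` {0..1})" using pair[OF k l \<open>k \<noteq> l\<close>] unfolding S by blast
    next
      fix p assume "k \<noteq> l" "p \<in> edge_interior \<gamma>' k \<inter> edge_interior \<gamma>' l"
      then show "cross_transversally_at X (\<gamma>' k ` {0..1}) (\<gamma>' l ` {0..1}) p"
        using pair[OF k l \<open>k \<noteq> l\<close>] int'[OF k] int'[OF l] unfolding S by blast
    next
      fix m assume "m \<in> E" "k \<noteq> l \<and> k \<noteq> m \<and> l \<noteq> m"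
      then show "edge_interior \<gamma>' k \<inter> edge_interior \<gamma>' l \<inter> edge_interior \<gamma>' m = {}"
        using triple[OF k l \<open>m \<in> E\<close>] int' k l by blast
    }
  qed (use injV topV in auto)
  have "crossings E \<gamma>' \<subseteq> crossings E \<gamma>"
  proof
    fix r assume "r \<in> crossings E \<gamma>'"
    then obtain k l where kl: "k \<in> E" "l \<in> E" "k \<noteq> l" "r \<in> S k" "r \<in> S l" "r \<notin> \<phi> ` V"
      unfolding crossings_def using int' by blast
    have "\<exists>k\<in>E. \<exists>l\<in>E. k \<noteq> l \<and> r \<in> T k \<and> r \<in> T l"
    proof (cases "k = e \<or> k = f"; cases "l = e \<or> l = f")
      assume "k = e \<or> k = f" "l = e \<or> l = f"
      then show ?thesis using kl oldef[of r] ef(1-3) by metis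
    next
      assume "k = e \<or> k = f" "\<not> (l = e \<or> l = f)"
      then show ?thesis using kl old[of r k l] ef(1-3) So[of l] by metis
    next
      assume "\<not> (k = e \<or> k = f)" "l = e \<or> l = f"
      then show ?thesis using kl old[of r l k] ef(1-3) So[of k] by metis
    next
      assume "\<not> (k = e \<or> k = f)" "\<not> (l = e \<or> l = f)"
      then show ?thesis using kl So[of k] So[of l] by metis
    qed
    then show "r \<in> crossings E \<gamma>" unfolding crossings_def using int kl(6) by blast
  qed
  moreover have "q \<in> crossings E \<gamma>" using q ef(1-3) unfolding crossings_def by blast
  moreover have "q \<notin> crossings E \<gamma>'"
  proof
    assume "q \<in> crossings E \<gamma>'"
    then obtain k l where kl: "k \<in> E" "l \<in> E" "k \<noteq> l" "q \<in> S k" "q \<in> S l" "q \<notin> \<phi> ` V"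
      unfolding crossings_def using int' by blast
    have qT: "q \<in> T e" "q \<in> T f" using q int ef by blast+
    \<comment> \<open>No third old edge passes through \<open>q\<close>, so only the two new arcs
      could cross there.\<close>
    have "m = e \<or> m = f" if "m \<in> E" "q \<in> S m" for m
      using no3[of e f m q] that ef(1-3) qT kl(6) So[of m] by blast
    then have "q \<in> S e \<and> q \<in> S f" using kl by metis
    then show False using q(3) ef(3) by (simp add: S_def)
  qed
  ultimately show ?thesis using draw by blast
qed

text \<open>The new arc runs along \<open>h\<close> up to the parameter \<open>a\<close>, over a
  connection \<open>D\<close>, and along \<open>g\<close> from the parameter \<open>b\<close> on.
  \<open>D\<close> may be a single point, so that an exchange at a common point and a cut corner are
  treated alike. Since \<open>h\<close> avoids \<open>g\<close> strictly between its start and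
  \<open>a\<close>, the pieces meet only where they are joined. Away from \<open>D\<close> and the
  two ends, removing the other pieces, which are closed, leaves a neighbourhood in which the arc
  agrees with \<open>h\<close> or with \<open>g\<close>.\<close>

lemma splice_arc:
  assumes H: "Hausdorff_space X" and g: "simple_arc_in X g" and h: "simple_arc_in X h" and gh: "g 0 = h 0"
    and ab: "0 < a" "a < 1" "0 < b" "b < 1"
    and hA: "\<And>t. 0 < t \<Longrightarrow> t < a \<Longrightarrow> h t \<notin> g ` {0..1}"
    and D: "D = {h a} \<and> h a = g b \<or> arc_between X D (h a) (g b)"
    and DA: "D \<inter> g ` {0..1} = {g b}" and DB: "D \<inter> h ` {0..1} = {h a}"
  shows "arc_between X (h ` {0..a} \<union> D \<union> g ` {b..1}) (h 0) (g 1)"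
    and "\<And>r. r \<in> h ` {0..a} \<union> D \<union> g ` {b..1} \<Longrightarrow> r \<noteq> h 0 \<Longrightarrow> r \<noteq> g 1 \<Longrightarrow> r \<notin> D \<Longrightarrow>
      \<exists>W. openin X W \<and> r \<in> W \<and> ((h ` {0..a} \<union> D \<union> g ` {b..1}) \<inter> W = g ` {0..1} \<inter> W \<or>
        (h ` {0..a} \<union> D \<union> g ` {b..1}) \<inter> W = h ` {0..1} \<inter> W)"
proof -
  have injg: "inj_on g {0..1}" and injh: "inj_on h {0..1}" and pg: "pathin X g" and ph: "pathin X h"
    using g h by (auto simp: simple_arc_in_def)
  have eqg: "g s = g t \<longleftrightarrow> s = t" if "s \<in> {0..1}" "t \<in> {0..1}" for s t
    using injg that by (auto dest: inj_onD)
  have eqh: "h s = h t \<longleftrightarrow> s = t" if "s \<in> {0..1}" "t \<in> {0..1}" for s t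
    using injh that by (auto dest: inj_onD)
  have hga: "s = b" if "h a = g s" "s \<in> {0..1}" for s
  proof -
    have "h a \<in> D \<inter> g ` {0..1}" using DB that by auto
    then have "h a = g b" using DA by auto
    then show ?thesis using that eqg[of s b] ab by auto
  qed
  have meet: "t = 0 \<and> s = 0 \<or> t = a \<and> s = b" if "h t = g s" "t \<in> {0..a}" "s \<in> {0..1}" for s t
  proof -
    consider "t = 0" | "0 < t" "t < a" | "t = a" using \<open>t \<in> {0..a}\<close> by fastforce
    then show ?thesis
    proof cases
      case 1 then have "g s = g 0" using that gh by simp
      then show ?thesis using 1 eqg[of s 0] that by auto
    next
      case 2 then show ?thesis using hA[of t] that by auto
    next
      case 3 then show ?thesis using hga that by auto
    qed
  qed
  have sub: "{0..a} \<subseteq> {0..1}" "{b..1} \<subseteq> {0..1}" "{0..b} \<subseteq> {0..1}" "{a..1} \<subseteq> {0..1}" using ab by auto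
  have i1: "h ` {0..a} \<inter> D = {h a}" using DB sub ab by force
  have i2: "(h ` {0..a} \<union> D) \<inter> g ` {b..1} = {g b}"
  proof -
    have "h ` {0..a} \<inter> g ` {b..1} \<subseteq> {g b}"
    proof
      fix r assume "r \<in> h ` {0..a} \<inter> g ` {b..1}"
      then obtain t s where "r = h t" "r = g s" "t \<in> {0..a}" "s \<in> {b..1}" by blast
      then show "r \<in> {g b}" using meet[of t s] ab by auto
    qed
    moreover have "D \<inter> g ` {b..1} = {g b}" using DA sub(2) ab by force
    ultimately show ?thesis by blast
  qed
  have ha: "arc_between X (h ` {0..a}) (h 0) (h a)" using arc_between_sub[OF h, of 0 a] ab by auto
  have gb: "arc_between X (g ` {b..1}) (g b) (g 1)" using arc_between_sub[OF g, of b 1] ab by auto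
  have "arc_between X (h ` {0..a} \<union> D) (h 0) (g b)"
    using D
  proof
    assume d: "D = {h a} \<and> h a = g b"
    then have "h ` {0..a} \<union> D = h ` {0..a}" using ab by (metis atLeastAtMost_iff image_eqI insert_absorb insert_is_Un less_imp_le order_refl sup_commute)
    then show ?thesis using ha d by simp
  next
    assume "arc_between X D (h a) (g b)"
    then show ?thesis using arc_between_join[OF ha _ i1] by blast
  qed
  then show "arc_between X (h ` {0..a} \<union> D \<union> g ` {b..1}) (h 0) (g 1)"
    using arc_between_join[OF _ gb i2] by blast
  have clD: "closedin X D"
    using D
  proof
    assume d: "D = {h a} \<and> h a = g b"
    have "h a \<in> topspace X" using path_image_subset_topspace[OF ph] ab by (auto simp: Pi_iff)
    then show ?thesis using d H by (simp add: closedin_Hausdorff_singleton)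
  next
    assume "arc_between X D (h a) (g b)"
    then show ?thesis using arc_between_closedin[OF H] by blast
  qed
  have cl: "closedin X (k ` {s..t})" if "k = g \<or> k = h" "{s..t} \<subseteq> {0..1}" for k s t
    using that simple_arc_in_closedin[OF H] pg ph by blast
  have top: "k t \<in> topspace X" if "k = g \<or> k = h" "t \<in> {0..1}" for k t
    using that path_image_subset_topspace[OF ph] path_image_subset_topspace[OF pg] by (auto simp: Pi_iff)
  show "\<exists>W. openin X W \<and> r \<in> W \<and> ((h ` {0..a} \<union> D \<union> g ` {b..1}) \<inter> W = g ` {0..1} \<inter> W \<or>
        (h ` {0..a} \<union> D \<union> g ` {b..1}) \<inter> W = h ` {0..1} \<inter> W)"
    if r: "r \<in> h ` {0..a} \<union> D \<union> g ` {b..1}" "r \<noteq> h 0" "r \<noteq> g 1" "r \<notin> D" for r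
  proof -
    consider t where "r = h t" "t \<in> {0..a}" | s where "r = g s" "s \<in> {b..1}" using r by blast
    then show ?thesis
    proof cases
      case 1
      define W where "W = topspace X - (g ` {0..1} \<union> D \<union> h ` {a..1})"
      have "openin X W" unfolding W_def using cl sub clD by (intro openin_diff openin_topspace closedin_Un) auto
      moreover have "r \<in> W"
      proof -
        have ta: "t \<noteq> a" "t \<noteq> 0" using r 1 DB by auto
        then have "r \<notin> g ` {0..1}" using hA[of t] 1 by auto
        moreover have "r \<notin> h ` {a..1}"
        proof
          assume "r \<in> h ` {a..1}"
          then obtain t' where "h t = h t'" "t' \<in> {a..1}" using 1 by auto
          then show False using eqh[of t t'] 1 ta ab by auto
        qed
        moreover have "r \<in> topspace X" using top[of h t] 1 ab by auto
        ultimately show ?thesis using r(4) by (simp add: W_def)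
      qed
      moreover have "(h ` {0..a} \<union> D \<union> g ` {b..1}) \<inter> W = h ` {0..1} \<inter> W"
      proof -
        have "h ` {0..1} = h ` {0..a} \<union> h ` {a..1}" using ab by (simp flip: image_Un add: ivl_disj_un)
        then show ?thesis using sub unfolding W_def by blast
      qed
      ultimately show ?thesis by blast
    next
      case 2
      define W where "W = topspace X - (h ` {0..a} \<union> D \<union> g ` {0..b})"
      have "openin X W" unfolding W_def using cl sub clD by (intro openin_diff openin_topspace closedin_Un) auto
      moreover have "r \<in> W"
      proof -
        have sb: "s \<noteq> b" using r 2 DA by auto
        have "r \<notin> h ` {0..a}"
        proof
          assume "r \<in> h ` {0..a}"
          then obtain t where "h t = g s" "t \<in> {0..a}" using 2 by auto
          then show False using meet[of t s] 2 sb ab by auto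
        qed
        moreover have "r \<notin> g ` {0..b}"
        proof
          assume "r \<in> g ` {0..b}"
          then obtain t' where "g s = g t'" "t' \<in> {0..b}" using 2 by auto
          then show False using eqg[of s t'] 2 sb ab by auto
        qed
        moreover have "r \<in> topspace X" using top[of g s] 2 ab by auto
        ultimately show ?thesis using r(4) by (simp add: W_def)
      qed
      moreover have "(h ` {0..a} \<union> D \<union> g ` {b..1}) \<inter> W = g ` {0..1} \<inter> W"
      proof -
        have "g ` {0..1} = g ` {0..b} \<union> g ` {b..1}" using ab by (simp flip: image_Un add: ivl_disj_un)
        then show ?thesis using sub unfolding W_def by blast
      qed
      ultimately show ?thesis by blast
    qed
  qed
qed

text \<open>Because of \<open>a < d\<close> and \<open>c < b\<close>, the initial piece of an edge
  used by one new arc stops before the tail used by the other begins. So apart from the common start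
  the new arcs can meet only where both run along tails; there the first is locally \<open>g\<close>
  and the second locally \<open>h\<close>.\<close>

lemma splice_arcs_meet:
  assumes H: "Hausdorff_space X" and g: "simple_arc_in X g" and h: "simple_arc_in X h" and gh: "g 0 = h 0"
    and abcd: "0 < a" "a < d" "d < 1" "0 < c" "c < b" "b < 1"
    and hA: "\<And>t. 0 < t \<Longrightarrow> t < a \<Longrightarrow> h t \<notin> g ` {0..1}"
    and gB: "\<And>t. 0 < t \<Longrightarrow> t < c \<Longrightarrow> g t \<notin> h ` {0..1}"
    and clD: "closedin X D" "closedin X D'"
    and DA: "D \<inter> g ` {0..1} = {g b}" and DB: "D \<inter> h ` {0..1} = {h a}"
    and DA': "D' \<inter> g ` {0..1} = {g c}" and DB': "D' \<inter> h ` {0..1} = {h d}" and DD: "D \<inter> D' = {}"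
    and r: "r \<in> h ` {0..a} \<union> D \<union> g ` {b..1}" "r \<in> g ` {0..c} \<union> D' \<union> h ` {d..1}" "r \<noteq> h 0"
  shows "r \<in> g ` {b..1} \<and> r \<in> h ` {d..1} \<and>
      (\<exists>W. openin X W \<and> r \<in> W \<and> (h ` {0..a} \<union> D \<union> g ` {b..1}) \<inter> W = g ` {0..1} \<inter> W \<and>
         (g ` {0..c} \<union> D' \<union> h ` {d..1}) \<inter> W = h ` {0..1} \<inter> W)"
proof -
  have injg: "inj_on g {0..1}" and injh: "inj_on h {0..1}" and pg: "pathin X g" and ph: "pathin X h"
    using g h by (auto simp: simple_arc_in_def)
  have eqg: "g s = g t \<longleftrightarrow> s = t" if "s \<in> {0..1}" "t \<in> {0..1}" for s t
    using injg that by (auto dest: inj_onD)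
  have eqh: "h s = h t \<longleftrightarrow> s = t" if "s \<in> {0..1}" "t \<in> {0..1}" for s t
    using injh that by (auto dest: inj_onD)
  have img: "g s \<in> g ` I \<longleftrightarrow> s \<in> I" if "s \<in> {0..1}" "I \<subseteq> {0..1}" for s I
    by (rule inj_on_image_mem_iff[OF injg that])
  have imh: "h s \<in> h ` I \<longleftrightarrow> s \<in> I" if "s \<in> {0..1}" "I \<subseteq> {0..1}" for s I
    by (rule inj_on_image_mem_iff[OF injh that])
  have hga: "s = b" if "h a = g s" "s \<in> {0..1}" for s
  proof -
    have "h a \<in> D \<inter> g ` {0..1}" using DB that by auto
    then have "h a = g b" using DA by auto
    then show ?thesis using that eqg[of s b] abcd by auto
  qed
  have ghc: "t = d" if "g c = h t" "t \<in> {0..1}" for t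
  proof -
    have "g c \<in> D' \<inter> h ` {0..1}" using DA' that by auto
    then have "g c = h d" using DB' by auto
    then show ?thesis using that eqh[of t d] abcd by auto
  qed
  have meet: "t = 0 \<and> s = 0 \<or> t = a \<and> s = b" if "h t = g s" "t \<in> {0..a}" "s \<in> {0..1}" for s t
  proof -
    consider "t = 0" | "0 < t" "t < a" | "t = a" using \<open>t \<in> {0..a}\<close> by fastforce
    then show ?thesis
    proof cases
      case 1 then have "g s = g 0" using that gh by simp
      then show ?thesis using 1 eqg[of s 0] that by auto
    next
      case 2 then show ?thesis using hA[of t] that by auto
    next
      case 3 then show ?thesis using hga that by auto
    qed
  qed
  have sub: "{0..a} \<subseteq> {0..1}" "{b..1} \<subseteq> {0..1}" "{0..b} \<subseteq> {0..1}" "{0..c} \<subseteq> {0..1}"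
    "{d..1} \<subseteq> {0..1}" "{0..d} \<subseteq> {0..1}" using abcd by auto
  have g2: "r \<in> g ` {b..1}"
  proof (rule ccontr)
    assume n: "r \<notin> g ` {b..1}"
    then consider t where "r = h t" "t \<in> {0..a}" | "r \<in> D" using r(1) by blast
    then show False
    proof cases
      case 1
      have "r \<notin> h ` {d..1}" using imh[of t "{d..1}"] 1 abcd by auto
      moreover have "r \<notin> D'" using DB' eqh[of t d] 1 abcd by auto
      ultimately obtain s where "r = g s" "s \<in> {0..c}" using r(2) by blast
      then show False using meet[of t s] 1 r(3) abcd by auto
    next
      case 2
      have "r \<notin> g ` {0..1}"
        proof
          assume "r \<in> g ` {0..1}"
          then have "r = g b" using DA 2 by blast
          then show False using n abcd by auto
        qed
      moreover have "r \<notin> D'" using 2 DD by blast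
      ultimately have "r \<in> h ` {d..1}" using r(2) sub by blast
      then have "r = h a" "r \<in> h ` {d..1}" using DB 2 sub by blast+
      then show False using imh[of a "{d..1}"] abcd by auto
    qed
  qed
  then obtain s where s: "r = g s" "s \<in> {b..1}" by blast
  have h2: "r \<in> h ` {d..1}"
  proof (rule ccontr)
    assume "r \<notin> h ` {d..1}"
    then have "r \<in> g ` {0..c} \<or> r \<in> D'" using r(2) by blast
    moreover have "r \<notin> g ` {0..c}" using img[of s "{0..c}"] s abcd by auto
    moreover have "r \<notin> D'" using DA' eqg[of s c] s abcd by auto
    ultimately show False by blast
  qed
  then obtain t where t: "r = h t" "t \<in> {d..1}" by blast
  have cl: "closedin X (k ` {s..t})" if "k = g \<or> k = h" "{s..t} \<subseteq> {0..1}" for k s t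
    using that simple_arc_in_closedin[OF H] pg ph by blast
  define W where "W = topspace X - (g ` {0..b} \<union> h ` {0..d} \<union> D \<union> D')"
  have "openin X W" unfolding W_def using cl sub clD by (intro openin_diff openin_topspace closedin_Un) auto
  moreover have "r \<in> W"
  proof -
    have "r \<notin> D" using DB eqh[of t a] t abcd by auto
    moreover have rD': "r \<notin> D'" using DA' eqg[of s c] s abcd by auto
    moreover have "s \<noteq> b" using \<open>r \<notin> D\<close> DA s by auto
    then have "r \<notin> g ` {0..b}" using img[of s "{0..b}"] s abcd by auto
    moreover have "t \<noteq> d" using rD' DB' t by auto
    then have "r \<notin> h ` {0..d}" using imh[of t "{0..d}"] t abcd by auto
    moreover have "r \<in> topspace X"
      using path_image_subset_topspace[OF pg] s abcd by (auto simp: Pi_iff)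
    ultimately show ?thesis by (simp add: W_def)
  qed
  moreover have "(h ` {0..a} \<union> D \<union> g ` {b..1}) \<inter> W = g ` {0..1} \<inter> W"
  proof -
    have "g ` {0..1} = g ` {0..b} \<union> g ` {b..1}" using abcd by (simp flip: image_Un add: ivl_disj_un)
    moreover have "h ` {0..a} \<subseteq> h ` {0..d}" using abcd by auto
    ultimately show ?thesis unfolding W_def by blast
  qed
  moreover have "(g ` {0..c} \<union> D' \<union> h ` {d..1}) \<inter> W = h ` {0..1} \<inter> W"
  proof -
    have "h ` {0..1} = h ` {0..d} \<union> h ` {d..1}" using abcd by (simp flip: image_Un add: ivl_disj_un)
    moreover have "g ` {0..c} \<subseteq> g ` {0..b}" using abcd by auto
    ultimately show ?thesis unfolding W_def by blast
  qed
  ultimately show ?thesis using g2 h2 by blast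
qed

text \<open>If an axis of the chart lies on the arc, the parameter of the arc along the axis is
  continuous and injective, hence monotone; the sign \<open>s\<close> reverses the axis when it
  decreases. This tells on which half of the axis the arc arrives at the crossing and on which it
  leaves.\<close>

lemma chart_axis_parameter:
  assumes H: "Hausdorff_space X" and g: "simple_arc_in X g" and ch: "plane_chart X U k j"
    and i: "continuous_on UNIV i" "inj i" and A: "\<And>x. j (i x) \<in> g ` {0..1}"
  obtains \<psi> :: "real \<Rightarrow> real" and s where "s = 1 \<or> s = -1" "strict_mono \<psi>" "\<And>x. 0 < \<psi> x" "\<And>x. \<psi> x < 1"
    "\<And>x. g (\<psi> x) = j (i (s * x))"
proof -
  note c = plane_chartD[OF ch]
  have injg: "inj_on g {0..1}" and pg: "pathin X g" using g by (auto simp: simple_arc_in_def)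
  have injj: "inj j" using c(3) by (metis injI)
  define \<theta> where "\<theta> x = the_inv_into {0..1} g (j (i x))" for x
  have \<theta>: "\<theta> x \<in> {0..1}" "g (\<theta> x) = j (i x)" for x
  proof -
    show "\<theta> x \<in> {0..1}" unfolding \<theta>_def using A by (intro the_inv_into_into[OF injg]) auto
    show "g (\<theta> x) = j (i x)" unfolding \<theta>_def using A by (intro f_the_inv_into_f[OF injg]) auto
  qed
  have "inj \<theta>"
  proof (rule injI)
    fix x y assume "\<theta> x = \<theta> y"
    then have "j (i x) = j (i y)" using \<theta>(2) by metis
    then show "x = y" using injj i(2) by (auto dest: injD)
  qed
  have cji: "continuous_map euclidean X (\<lambda>x. j (i x))"
    using continuous_map_compose[of euclidean euclidean i X j] c(5) i(1) by (simp add: o_def)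
  \<comment> \<open>\<open>g\<close> maps compact parameter sets to closed sets of the Hausdorff
    space, so preimages of closed sets under \<open>\<theta>\<close> are closed.\<close>
  have "continuous_on UNIV \<theta>"
    unfolding continuous_on_closed_vimage[OF closed_UNIV]
  proof (intro allI impI)
    fix B :: "real set" assume "closed B"
    then have "compact (B \<inter> {0..1})" by (simp add: closed_Int_compact)
    then have "compactin (top_of_set {0..1}) (B \<inter> {0..1})" by (simp add: compactin_subtopology)
    then have "closedin X (g ` (B \<inter> {0..1}))"
      using image_compactin pg compactin_imp_closedin[OF H] unfolding pathin_def by blast
    then have "closedin euclidean {x \<in> topspace euclidean. j (i x) \<in> g ` (B \<inter> {0..1})}"
      using closedin_continuous_map_preimage[OF cji] by blast
    moreover have "{x \<in> topspace euclidean. j (i x) \<in> g ` (B \<inter> {0..1})} = \<theta> -` B \<inter> UNIV"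
    proof -
      have "j (i x) \<in> g ` (B \<inter> {0..1}) \<longleftrightarrow> \<theta> x \<in> B" for x
      proof
        assume "j (i x) \<in> g ` (B \<inter> {0..1})"
        then obtain t where "t \<in> B" "t \<in> {0..1}" "g t = g (\<theta> x)" using \<theta>(2) by auto
        then show "\<theta> x \<in> B" using inj_onD[OF injg] \<theta>(1) by metis
      next
        assume "\<theta> x \<in> B"
        then show "j (i x) \<in> g ` (B \<inter> {0..1})" using \<theta>[of x] by (metis IntI image_eqI)
      qed
      then show ?thesis by auto
    qed
    ultimately show "closed (\<theta> -` B \<inter> UNIV)" by simp
  qed
  then have "strict_mono_on UNIV \<theta> \<or> strict_antimono_on UNIV \<theta>"
    using injective_eq_monotone_map[of UNIV \<theta>] \<open>inj \<theta>\<close> by simp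
  then obtain s where s: "s = 1 \<or> s = -1" "strict_mono (\<lambda>x. \<theta> (s * x))"
  proof
    assume "strict_mono_on UNIV \<theta>"
    then show thesis using that[of 1] by simp
  next
    assume "strict_antimono_on UNIV \<theta>"
    then show thesis using that[of "-1"] by (auto simp: monotone_on_def strict_mono_def)
  qed
  \<comment> \<open>The axis is unbounded, so further parameters in the unit interval are taken on
    either side of \<open>x\<close>; this excludes the values 0 and 1.\<close>
  have pos: "0 < \<theta> (s * x)" "\<theta> (s * x) < 1" for x
    using s(2)[THEN strict_monoD, of "x - 1" x] s(2)[THEN strict_monoD, of x "x + 1"]
      \<theta>(1)[of "s * (x - 1)"] \<theta>(1)[of "s * (x + 1)"] by auto
  show thesis using that[of s "\<lambda>x. \<theta> (s * x)"] s pos \<theta>(2) by auto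
qed

lemma is_drawing_vertices_on_edge:
  assumes "is_drawing X V E \<phi> \<gamma>" "e \<in> E" "e \<subseteq> V"
  shows "\<gamma> e ` {0..1} \<inter> \<phi> ` V = \<phi> ` e"
proof -
  have "edge_interior \<gamma> e \<inter> \<phi> ` V = {}" by (rule is_drawingD(5)[OF assms(1,2)])
  moreover have "{0..1} = {0<..<1} \<union> {0, 1 :: real}" by auto
  then have "\<gamma> e ` {0..1} = edge_interior \<gamma> e \<union> \<phi> ` e"
    unfolding edge_interior_def is_drawingD(4)[OF assms(1,2), symmetric] by auto
  ultimately show ?thesis using assms(3) by blast
qed

lemma is_drawing_arc_between:
  assumes "is_drawing X V E \<phi> \<gamma>" "e \<in> E" "e = {u, v}"
  shows "arc_between X (\<gamma> e ` {0..1}) (\<phi> u) (\<phi> v)"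
proof -
  have arc: "arc_between X (\<gamma> e ` {0..1}) (\<gamma> e 0) (\<gamma> e 1)"
    using is_drawingD(3)[OF assms(1,2)] unfolding arc_between_def by blast
  have "{\<gamma> e 0, \<gamma> e 1} = {\<phi> u, \<phi> v}" using is_drawingD(4)[OF assms(1,2)] assms(3) by simp
  then have "\<gamma> e 0 = \<phi> u \<and> \<gamma> e 1 = \<phi> v \<or> \<gamma> e 0 = \<phi> v \<and> \<gamma> e 1 = \<phi> u" by (simp add: doubleton_eq_iff)
  then show ?thesis using arc arc_between_reverse[OF arc] by auto
qed

text \<open>Starting from \<open>u\<close>, let \<open>h\<close> first meet \<open>e\<close> at the
  parameter \<open>\<tau>\<close> and \<open>g\<close> first meet \<open>f\<close> at
  \<open>\<sigma>\<close>. If these points differ, each edge takes over the initial piece of the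
  other up to its first meeting point, and \<open>h \<tau>\<close> no longer lies on the arc drawn
  for \<open>f\<close>. If they coincide, both new arcs also avoid the common point by a short
  diagonal inside a chart.\<close>

lemma uncross_adjacent_edges:
  assumes H: "Hausdorff_space X" and D: "is_drawing X V E \<phi> \<gamma>" and EV: "\<And>k. k \<in> E \<Longrightarrow> k \<subseteq> V" and finE: "finite E" "finite V"
    and ef: "e \<in> E" "f \<in> E" "e \<noteq> f" "e = {u, v}" "f = {u, w}"
    and q0: "q0 \<in> edge_interior \<gamma> e" "q0 \<in> edge_interior \<gamma> f"
  shows "\<exists>\<gamma>'. is_drawing X V E \<phi> \<gamma>' \<and> crossings E \<gamma>' \<subset> crossings E \<gamma>"
proof -
  define A where "A = \<gamma> e ` {0..1}"
  define B where "B = \<gamma> f ` {0..1}"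
  obtain g where g: "simple_arc_in X g" "g ` {0..1} = A" "g 0 = \<phi> u" "g 1 = \<phi> v"
    using is_drawing_arc_between[OF D ef(1,4)] by (auto simp: arc_between_def A_def)
  obtain h where h: "simple_arc_in X h" "h ` {0..1} = B" "h 0 = \<phi> u" "h 1 = \<phi> w"
    using is_drawing_arc_between[OF D ef(2,5)] by (auto simp: arc_between_def B_def)
  have injg: "inj_on g {0..1}" and injh: "inj_on h {0..1}" and pg: "pathin X g" and ph: "pathin X h"
    using g h by (auto simp: simple_arc_in_def)
  have img: "g s \<in> g ` I \<longleftrightarrow> s \<in> I" if "s \<in> {0..1}" "I \<subseteq> {0..1}" for s I
    by (rule inj_on_image_mem_iff[OF injg that])
  have imh: "h s \<in> h ` I \<longleftrightarrow> s \<in> I" if "s \<in> {0..1}" "I \<subseteq> {0..1}" for s I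
    by (rule inj_on_image_mem_iff[OF injh that])
  have eqg: "g s = g t \<longleftrightarrow> s = t" if "s \<in> {0..1}" "t \<in> {0..1}" for s t
    using injg that by (auto dest: inj_onD)
  have eqh: "h s = h t \<longleftrightarrow> s = t" if "s \<in> {0..1}" "t \<in> {0..1}" for s t
    using injh that by (auto dest: inj_onD)
  have uvw: "u \<in> V" "v \<in> V" "w \<in> V" using EV[OF ef(1)] EV[OF ef(2)] ef by auto
  have vw: "v \<noteq> w" "v \<noteq> u" "w \<noteq> u"
    using ef eqg[of 0 1] eqh[of 0 1] g h by auto
  have inj\<phi>: "\<phi> x = \<phi> y \<longleftrightarrow> x = y" if "x \<in> V" "y \<in> V" for x y
    using is_drawingD(2)[OF D] that by (auto dest: inj_onD)
  have vA: "A \<inter> \<phi> ` V = {\<phi> u, \<phi> v}" and vB: "B \<inter> \<phi> ` V = {\<phi> u, \<phi> w}"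
    using is_drawing_vertices_on_edge[OF D ef(1) EV[OF ef(1)]]
      is_drawing_vertices_on_edge[OF D ef(2) EV[OF ef(2)]] ef by (auto simp: A_def B_def)
  have wA: "\<phi> w \<notin> A" using vA uvw vw inj\<phi> by auto
  have vnB: "\<phi> v \<notin> B" using vB uvw vw inj\<phi> by auto
  have intA: "edge_interior \<gamma> e = A - \<phi> ` V" and intB: "edge_interior \<gamma> f = B - \<phi> ` V"
    using edge_interior_eq[OF D] ef(1,2) EV by (auto simp: A_def B_def)
  have novg: "g t \<notin> \<phi> ` V" if "0 < t" "t < 1" for t
  proof
    assume "g t \<in> \<phi> ` V"
    then have "g t \<in> A \<inter> \<phi> ` V" using g(2) that by auto
    then have "g t = g 0 \<or> g t = g 1" using vA g by auto
    then show False using eqg[of t 0] eqg[of t 1] that by auto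
  qed
  have novh: "h t \<notin> \<phi> ` V" if "0 < t" "t < 1" for t
  proof
    assume "h t \<in> \<phi> ` V"
    then have "h t \<in> B \<inter> \<phi> ` V" using h(2) that by auto
    then have "h t = h 0 \<or> h t = h 1" using vB h by auto
    then show False using eqh[of t 0] eqh[of t 1] that by auto
  qed
  have other: "r \<notin> \<gamma> k ` {0..1}" if "k \<in> E" "k \<noteq> e" "k \<noteq> f" "r \<in> A" "r \<in> B" "r \<notin> \<phi> ` V" for k r
  proof
    assume "r \<in> \<gamma> k ` {0..1}"
    then have "r \<in> edge_interior \<gamma> k" using edge_interior_eq[OF D that(1) EV[OF that(1)]] that(6) by blast
    moreover have "r \<in> edge_interior \<gamma> e" "r \<in> edge_interior \<gamma> f" using that intA intB by auto
    ultimately show False using is_drawingD(8)[OF D ef(1,2) that(1) ef(3)] that(2,3) by blast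
  qed
  \<comment> \<open>Both cases end alike. The parameters and the connections \<open>D1\<close>,
    \<open>D2\<close> are those of the two spliced arcs; \<open>t0\<close> is the parameter on
    \<open>h\<close> of the crossing that disappears, and \<open>t0 < d\<close> keeps it off the
    tail of \<open>h\<close>.\<close>
  have finish: ?thesis
    if abcd: "0 < a" "a < d" "d < 1" "0 < c" "c < b" "b < 1"
    and hA: "\<And>t. 0 < t \<Longrightarrow> t < a \<Longrightarrow> h t \<notin> A"
    and gB: "\<And>t. 0 < t \<Longrightarrow> t < c \<Longrightarrow> g t \<notin> B"
    and D1: "D1 = {h a} \<and> h a = g b \<or> arc_between X D1 (h a) (g b)"
    and D2: "D2 = {g c} \<and> g c = h d \<or> arc_between X D2 (g c) (h d)"
    and DA: "D1 \<inter> A = {g b}" and DB: "D1 \<inter> B = {h a}"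
    and DA': "D2 \<inter> A = {g c}" and DB': "D2 \<inter> B = {h d}" and DD: "D1 \<inter> D2 = {}"
    and Z: "(D1 \<union> D2) \<inter> \<phi> ` V = {}" "\<And>k. k \<in> E \<Longrightarrow> k \<noteq> e \<Longrightarrow> k \<noteq> f \<Longrightarrow> (D1 \<union> D2) \<inter> \<gamma> k ` {0..1} = {}"
    and t0: "0 < t0" "t0 < d" "h t0 \<in> A"
    for a b c d D1 D2 t0
  proof -
    define A' where "A' = h ` {0..a} \<union> D1 \<union> g ` {b..1}"
    define B' where "B' = g ` {0..c} \<union> D2 \<union> h ` {d..1}"
    have cl: "closedin X S" if "S = {p} \<and> p \<in> topspace X \<or> arc_between X S p p'" for S p p'
      using that arc_between_closedin[OF H] closedin_Hausdorff_singleton[OF H] by blast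
    have top: "h a \<in> topspace X" "g c \<in> topspace X"
      using path_image_subset_topspace[OF ph] path_image_subset_topspace[OF pg] abcd by (auto simp: Pi_iff)
    have clD: "closedin X D1" "closedin X D2" using cl D1 D2 top by metis+
    have gh: "g 0 = h 0" using g h by simp
    have SA: "arc_between X A' (h 0) (g 1)" and
      SA2: "\<And>r. r \<in> A' \<Longrightarrow> r \<noteq> h 0 \<Longrightarrow> r \<noteq> g 1 \<Longrightarrow> r \<notin> D1 \<Longrightarrow>
      \<exists>W. openin X W \<and> r \<in> W \<and> (A' \<inter> W = A \<inter> W \<or> A' \<inter> W = B \<inter> W)"
      using splice_arc[OF H g(1) h(1) gh, of a b D1] abcd hA D1 DA DB unfolding A'_def g(2) h(2) by auto
    have SB: "arc_between X B' (g 0) (h 1)" and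
      SB2: "\<And>r. r \<in> B' \<Longrightarrow> r \<noteq> g 0 \<Longrightarrow> r \<noteq> h 1 \<Longrightarrow> r \<notin> D2 \<Longrightarrow>
      \<exists>W. openin X W \<and> r \<in> W \<and> (B' \<inter> W = B \<inter> W \<or> B' \<inter> W = A \<inter> W)"
      using splice_arc[OF H h(1) g(1) gh[symmetric], of c d D2] abcd gB D2 DA' DB' unfolding B'_def g(2) h(2) by auto
    have meet: "r \<in> g ` {b..1} \<and> r \<in> h ` {d..1} \<and>
      (\<exists>W. openin X W \<and> r \<in> W \<and> A' \<inter> W = A \<inter> W \<and> B' \<inter> W = B \<inter> W)"
      if "r \<in> A'" "r \<in> B'" "r \<noteq> h 0" for r
      by (rule splice_arcs_meet[OF H g(1) h(1) gh abcd, where D = D1 and D' = D2, unfolded g(2) h(2),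
            OF hA gB clD DA DB DA' DB' DD that[unfolded A'_def B'_def], folded A'_def B'_def])
    have incl: "g ` {b..1} \<subseteq> A" "g ` {0..c} \<subseteq> A" "h ` {d..1} \<subseteq> B" "h ` {0..a} \<subseteq> B"
      unfolding g(2)[symmetric] h(2)[symmetric] using abcd by (auto intro!: image_mono)
    have V: "\<phi> u \<in> \<phi> ` V" "\<phi> v \<in> \<phi> ` V" "\<phi> w \<in> \<phi> ` V" using uvw by auto
    have novtx: "r \<noteq> h 0" "r \<noteq> g 0" "r \<noteq> g 1" "r \<noteq> h 1" if "r \<notin> \<phi> ` V" for r
      using that g h V by auto
    show ?thesis
    proof (rule reroute_adjacent_edges[OF D EV ef, of A' B' "D1 \<union> D2" "h t0"])
      show "arc_between X A' (\<phi> u) (\<phi> v)" using SA g h by simp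
      show "arc_between X B' (\<phi> u) (\<phi> w)" using SB g h by simp
      show "(D1 \<union> D2) \<inter> \<phi> ` V = {}" by (rule Z(1))
      show "(D1 \<union> D2) \<inter> \<gamma> k ` {0..1} = {}" if "k \<in> E" "k \<noteq> e" "k \<noteq> f" for k using Z(2) that by blast
      show "A' \<subseteq> \<gamma> e ` {0..1} \<union> \<gamma> f ` {0..1} \<union> (D1 \<union> D2)" "B' \<subseteq> \<gamma> e ` {0..1} \<union> \<gamma> f ` {0..1} \<union> (D1 \<union> D2)"
        using incl unfolding A'_def B'_def A_def B_def by blast+
      show "\<phi> w \<notin> A'"
        using imh[of 1 "{0..a}"] abcd wA incl Z(1) V(3) h(4) unfolding A'_def by auto
      show "\<phi> v \<notin> B'"
        using img[of 1 "{0..c}"] abcd vnB incl Z(1) V(2) g(4) unfolding B'_def by auto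
      show "\<exists>W. openin X W \<and> r \<in> W \<and> (A' \<inter> W = \<gamma> e ` {0..1} \<inter> W \<or> A' \<inter> W = \<gamma> f ` {0..1} \<inter> W)"
        if "r \<in> A'" "r \<notin> \<phi> ` V" "r \<notin> D1 \<union> D2" for r
        using SA2[of r] novtx[OF that(2)] that(1,3) unfolding A_def B_def by blast
      show "\<exists>W. openin X W \<and> r \<in> W \<and> (B' \<inter> W = \<gamma> e ` {0..1} \<inter> W \<or> B' \<inter> W = \<gamma> f ` {0..1} \<inter> W)"
        if "r \<in> B'" "r \<notin> \<phi> ` V" "r \<notin> D1 \<union> D2" for r
        using SB2[of r] novtx[OF that(2)] that(1,3) unfolding A_def B_def by blast
      show "r \<in> \<gamma> e ` {0..1} \<and> r \<in> \<gamma> f ` {0..1} \<and>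
        (\<exists>W. openin X W \<and> r \<in> W \<and> A' \<inter> W = \<gamma> e ` {0..1} \<inter> W \<and> B' \<inter> W = \<gamma> f ` {0..1} \<inter> W)"
        if "r \<in> A'" "r \<in> B'" "r \<notin> \<phi> ` V" for r
        using meet[OF that(1,2)] novtx[OF that(3)] incl(1,3) unfolding A_def B_def by (metis subsetD)
      have nov: "h t0 \<notin> \<phi> ` V" using novh t0 abcd by auto
      have "h t0 \<in> B" using h(2) t0 abcd by auto
      then show "h t0 \<in> edge_interior \<gamma> e" "h t0 \<in> edge_interior \<gamma> f" using nov t0 intA intB by auto
      show "\<not> (h t0 \<in> A' \<and> h t0 \<in> B')"
        using meet[of "h t0"] novtx[OF nov] imh[of t0 "{d..1}"] t0 abcd by auto
    qed
  qed
  \<comment> \<open>Finiteness of the common points is what makes a first meeting point along each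
    edge exist.\<close>
  have finAB: "finite (A \<inter> B)" using is_drawingD(6)[OF D ef(1-3)] by (simp add: A_def B_def)
  define Th where "Th = {t \<in> {0<..<1}. h t \<in> A}"
  define Tg where "Tg = {t \<in> {0<..<1}. g t \<in> B}"
  have "finite Th"
  proof (rule finite_imageD)
    show "finite (h ` Th)" by (rule finite_subset[OF _ finAB]) (auto simp: Th_def h(2)[symmetric])
    show "inj_on h Th" by (rule inj_on_subset[OF injh]) (auto simp: Th_def)
  qed
  have "finite Tg"
  proof (rule finite_imageD)
    show "finite (g ` Tg)" by (rule finite_subset[OF _ finAB]) (auto simp: Tg_def g(2)[symmetric])
    show "inj_on g Tg" by (rule inj_on_subset[OF injg]) (auto simp: Tg_def)
  qed
  have hTg: "\<exists>s \<in> Tg. h t = g s" if "t \<in> Th" for t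
  proof -
    have t: "0 < t" "t < 1" "h t \<in> A" using that by (auto simp: Th_def)
    then obtain s where s: "s \<in> {0..1}" "h t = g s" using g(2) by auto
    have "s \<noteq> 0" "s \<noteq> 1" using novh[OF t(1,2)] s g uvw by auto
    moreover have "h t \<in> B" using t h(2) by auto
    ultimately have "s \<in> Tg" using s by (simp add: Tg_def less_le)
    then show ?thesis using s(2) by blast
  qed
  have gTh: "\<exists>s \<in> Th. g t = h s" if "t \<in> Tg" for t
  proof -
    have t: "0 < t" "t < 1" "g t \<in> B" using that by (auto simp: Tg_def)
    then obtain s where s: "s \<in> {0..1}" "g t = h s" using h(2) by auto
    have "s \<noteq> 0" "s \<noteq> 1" using novg[OF t(1,2)] s h uvw by auto
    moreover have "g t \<in> A" using t g(2) by auto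
    ultimately have "s \<in> Th" using s by (simp add: Th_def less_le)
    then show ?thesis using s(2) by blast
  qed
  have "Th \<noteq> {}"
  proof -
    have "q0 \<in> A" "q0 \<in> B" "q0 \<notin> \<phi> ` V" using q0 intA intB by auto
    then obtain t where t: "t \<in> {0..1}" "q0 = h t" using h(2) by auto
    then have "t \<noteq> 0" "t \<noteq> 1" using \<open>q0 \<notin> \<phi> ` V\<close> h uvw by auto
    then have "t \<in> Th" using t \<open>q0 \<in> A\<close> by (simp add: Th_def less_le)
    then show ?thesis by blast
  qed
  then have "Tg \<noteq> {}" using hTg by auto
  define \<tau> where "\<tau> = Min Th"
  define \<sigma> where "\<sigma> = Min Tg"
  have \<tau>: "\<tau> \<in> Th" "\<And>t. t \<in> Th \<Longrightarrow> \<tau> \<le> t"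
    using \<open>finite Th\<close> \<open>Th \<noteq> {}\<close> by (auto simp: \<tau>_def)
  have \<sigma>: "\<sigma> \<in> Tg" "\<And>t. t \<in> Tg \<Longrightarrow> \<sigma> \<le> t"
    using \<open>finite Tg\<close> \<open>Tg \<noteq> {}\<close> by (auto simp: \<sigma>_def)
  have hfree: "h t \<notin> A" if "0 < t" "t < \<tau>" for t
  proof
    assume "h t \<in> A"
    then have "t \<in> Th" using that \<tau>(1) by (auto simp: Th_def)
    then show False using \<tau>(2)[of t] that by auto
  qed
  have gfree: "g t \<notin> B" if "0 < t" "t < \<sigma>" for t
  proof
    assume "g t \<in> B"
    then have "t \<in> Tg" using that \<sigma>(1) by (auto simp: Tg_def)
    then show False using \<sigma>(2)[of t] that by auto
  qed
  obtain \<sigma>' where \<sigma>': "\<sigma>' \<in> Tg" "h \<tau> = g \<sigma>'" using hTg[OF \<tau>(1)] by blast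
  obtain \<tau>' where \<tau>': "\<tau>' \<in> Th" "g \<sigma> = h \<tau>'" using gTh[OF \<sigma>(1)] by blast
  have rng: "0 < \<tau>" "\<tau> < 1" "0 < \<sigma>" "\<sigma> < 1" "0 < \<sigma>'" "\<sigma>' < 1" "0 < \<tau>'" "\<tau>' < 1"
    and hmem: "h \<tau> \<in> A" "h \<tau>' \<in> A" "g \<sigma> \<in> B" "g \<sigma>' \<in> B"
    using \<tau>(1) \<sigma>(1) \<sigma>'(1) \<tau>'(1) by (auto simp: Th_def Tg_def)
  have hmem2: "h \<tau> \<in> B" "h \<tau>' \<in> B" "g \<sigma> \<in> A" "g \<sigma>' \<in> A"
    using rng unfolding g(2)[symmetric] h(2)[symmetric] by auto
  show ?thesis
  proof (cases "\<sigma>' = \<sigma>")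
    \<comment> \<open>The first meeting points differ, so \<open>g\<close> passes
      \<open>g \<sigma>\<close> strictly before \<open>g \<sigma>'\<close> and \<open>h\<close>
      passes \<open>h \<tau>\<close> strictly before \<open>h \<tau>'\<close>. The exchange takes
      place at the points themselves, with one-point connections.\<close>
    case False
    then have lt: "\<sigma> < \<sigma>'" using \<sigma>(2)[OF \<sigma>'(1)] by simp
    have ne: "h \<tau> \<noteq> g \<sigma>" using False \<sigma>'(2) eqg[of \<sigma>' \<sigma>] rng by auto
    then have lt': "\<tau> < \<tau>'" using \<tau>(2)[OF \<tau>'(1)] \<tau>'(2) by (cases "\<tau> = \<tau>'") auto
    show ?thesis
    proof (rule finish[of \<tau> \<tau>' \<sigma> \<sigma>' "{h \<tau>}" "{g \<sigma>}" \<tau>])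
      show "({h \<tau>} \<union> {g \<sigma>}) \<inter> \<gamma> k ` {0..1} = {}" if "k \<in> E" "k \<noteq> e" "k \<noteq> f" for k
        using other[OF that, of "h \<tau>"] other[OF that, of "g \<sigma>"] hmem hmem2 novh[of \<tau>] novg[of \<sigma>] rng by auto
    qed (use rng lt lt' hfree gfree ne \<sigma>'(2) \<tau>'(2) hmem hmem2 novh[of \<tau>] novg[of \<sigma>] in auto)
  next
    \<comment> \<open>Both edges reach the same point first. It is a transversal crossing, so a
      chart is available in which the edges are the axes.\<close>
    case True
    then have q: "h \<tau> = g \<sigma>" using \<sigma>'(2) by simp
    have "h \<tau> \<in> edge_interior \<gamma> e" "h \<tau> \<in> edge_interior \<gamma> f"
      using intA intB hmem hmem2 novh[of \<tau>] rng by auto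
    then have "cross_transversally_at X A B (h \<tau>)"
      using is_drawingD(7)[OF D ef(1-3)] by (simp add: A_def B_def)
    then obtain U k j where ch: "plane_chart X U k j" and j0: "h \<tau> = j (0, 0)"
      and jA: "\<And>x y. j (x, y) \<in> A \<longleftrightarrow> y = 0" and jB: "\<And>x y. j (x, y) \<in> B \<longleftrightarrow> x = 0"
      unfolding cross_transversally_at_iff by blast
    note c = plane_chartD[OF ch]
    have injj: "j z = j z' \<longleftrightarrow> z = z'" for z z' using c(3) by metis
    obtain \<psi> s where s: "s = 1 \<or> s = -1" and \<psi>: "strict_mono \<psi>" "\<And>x. 0 < \<psi> x" "\<And>x. \<psi> x < 1"
      "\<And>x. g (\<psi> x) = j (s * x, 0)"
      by (rule chart_axis_parameter[OF H g(1) ch, of "\<lambda>x. (x, 0)"])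
         (auto simp: g(2) jA inj_def intro!: continuous_intros)
    obtain \<rho> t where t: "t = 1 \<or> t = -1" and \<rho>: "strict_mono \<rho>" "\<And>x. 0 < \<rho> x" "\<And>x. \<rho> x < 1"
      "\<And>x. h (\<rho> x) = j (0, t * x)"
      by (rule chart_axis_parameter[OF H h(1) ch, of "\<lambda>x. (0, x)"])
         (auto simp: h(2) jB inj_def intro!: continuous_intros)
    have \<psi>0: "\<psi> 0 = \<sigma>" using \<psi>(2,3)[of 0] \<psi>(4)[of 0] eqg[of "\<psi> 0" \<sigma>] q j0 rng by auto
    have \<rho>0: "\<rho> 0 = \<tau>" using \<rho>(2,3)[of 0] \<rho>(4)[of 0] eqh[of "\<rho> 0" \<tau>] q j0 rng by auto
    \<comment> \<open>All that the corners have to avoid: a closed set that misses the crossing,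
      hence also a small square around it.\<close>
    define C where "C = \<phi> ` V \<union> (\<Union>k \<in> E - {e, f}. \<gamma> k ` {0..1})"
    have clC: "closedin X C"
    proof -
      have "closedin X (\<phi> ` V)"
        using is_drawingD(1)[OF D] finE(2) H by (intro closedin_Hausdorff_finite) auto
      moreover have "closedin X (\<Union>k \<in> E - {e, f}. \<gamma> k ` {0..1})"
        using finE(1) is_drawing_closedin_edge[OF H D] by (intro closedin_Union) auto
      ultimately show ?thesis unfolding C_def by (rule closedin_Un)
    qed
    have "h \<tau> \<notin> C" using other[of _ "h \<tau>"] hmem hmem2 novh[of \<tau>] rng by (auto simp: C_def)
    have "open {z. j z \<in> topspace X - C}"
      using openin_continuous_map_preimage[OF c(5) openin_diff[OF openin_topspace clC]] by simp
    moreover have "(0, 0) \<in> {z. j z \<in> topspace X - C}"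
      using \<open>h \<tau> \<notin> C\<close> j0 c(2)[of "(0,0)"] openin_subset[OF c(1)] by auto
    ultimately obtain \<epsilon> where \<epsilon>: "\<epsilon> > 0" and box: "{-\<epsilon>..\<epsilon>} \<times> {-\<epsilon>..\<epsilon>} \<subseteq> {z. j z \<in> topspace X - C}"
      using open_square_inside by blast
    \<comment> \<open>\<open>h\<close> arrives through \<open>(0, - (t * \<epsilon>))\<close> and
      \<open>g\<close> leaves through \<open>(s * \<epsilon>, 0)\<close>, so \<open>D1\<close> is
      the diagonal between these points. \<open>D2\<close> lies in the opposite quadrant, from the
      arriving \<open>g\<close> to the leaving \<open>h\<close>. Each diagonal meets the axes only
      in its ends.\<close>
    define D1 where "D1 = j ` closed_segment (0, - (t * \<epsilon>)) (s * \<epsilon>, 0)"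
    define D2 where "D2 = j ` closed_segment (- (s * \<epsilon>), 0) (0, t * \<epsilon>)"
    have seg1: "closed_segment (0, - (t * \<epsilon>)) (s * \<epsilon>, 0) = {(\<theta> * (s * \<epsilon>), - ((1 - \<theta>) * (t * \<epsilon>))) |\<theta>. 0 \<le> \<theta> \<and> \<theta> \<le> 1}"
      and seg2: "closed_segment (- (s * \<epsilon>), 0) (0, t * \<epsilon>) = {(- ((1 - \<theta>) * (s * \<epsilon>)), \<theta> * (t * \<epsilon>)) |\<theta>. 0 \<le> \<theta> \<and> \<theta> \<le> 1}"
      by (auto simp: closed_segment_def)
    have st: "s \<noteq> 0" "t \<noteq> 0" "s * \<epsilon> \<noteq> 0" "t * \<epsilon> \<noteq> 0" using s t \<epsilon> by auto
    have bound: "\<bar>\<theta> * (x * \<epsilon>)\<bar> \<le> \<epsilon>" if "0 \<le> \<theta>" "\<theta> \<le> 1" "x = 1 \<or> x = -1" for \<theta> x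
      using that \<epsilon> by (auto simp: abs_mult mult_left_le_one_le)
    have inbox: "(D1 \<union> D2) \<inter> C = {}"
    proof -
      have "closed_segment (0, - (t * \<epsilon>)) (s * \<epsilon>, 0) \<subseteq> {-\<epsilon>..\<epsilon>} \<times> {-\<epsilon>..\<epsilon>}"
        unfolding seg1
      proof safe
        fix \<theta> :: real assume "0 \<le> \<theta>" "\<theta> \<le> 1"
        then show "\<theta> * (s * \<epsilon>) \<in> {-\<epsilon>..\<epsilon>}" "- ((1 - \<theta>) * (t * \<epsilon>)) \<in> {-\<epsilon>..\<epsilon>}"
          using bound[of \<theta> s] bound[of "1 - \<theta>" t] s t by (auto simp: abs_le_iff)
      qed
      moreover have "closed_segment (- (s * \<epsilon>), 0) (0, t * \<epsilon>) \<subseteq> {-\<epsilon>..\<epsilon>} \<times> {-\<epsilon>..\<epsilon>}"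
        unfolding seg2
      proof safe
        fix \<theta> :: real assume "0 \<le> \<theta>" "\<theta> \<le> 1"
        then show "\<theta> * (t * \<epsilon>) \<in> {-\<epsilon>..\<epsilon>}" "- ((1 - \<theta>) * (s * \<epsilon>)) \<in> {-\<epsilon>..\<epsilon>}"
          using bound[of \<theta> t] bound[of "1 - \<theta>" s] s t by (auto simp: abs_le_iff)
      qed
      ultimately show ?thesis using box unfolding D1_def D2_def by blast
    qed
    have hm: "h (\<rho> (-\<epsilon>)) = j (0, - (t * \<epsilon>))" "h (\<rho> \<epsilon>) = j (0, t * \<epsilon>)"
      "g (\<psi> \<epsilon>) = j (s * \<epsilon>, 0)" "g (\<psi> (-\<epsilon>)) = j (- (s * \<epsilon>), 0)"
      using \<rho>(4) \<psi>(4) by auto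
    have mono: "\<rho> (-\<epsilon>) < \<tau>" "\<tau> < \<rho> \<epsilon>" "\<psi> (-\<epsilon>) < \<sigma>" "\<sigma> < \<psi> \<epsilon>"
      using \<epsilon> strict_monoD[OF \<rho>(1), of _ 0] strict_monoD[OF \<rho>(1), of 0]
        strict_monoD[OF \<psi>(1), of _ 0] strict_monoD[OF \<psi>(1), of 0] \<psi>0 \<rho>0 by auto
    show ?thesis
    proof (rule finish[of "\<rho> (-\<epsilon>)" "\<rho> \<epsilon>" "\<psi> (-\<epsilon>)" "\<psi> \<epsilon>" D1 D2 \<tau>])
      show "0 < \<rho> (-\<epsilon>)" "\<rho> \<epsilon> < 1" "0 < \<psi> (-\<epsilon>)" "\<psi> \<epsilon> < 1" by (rule \<rho> \<psi>)+
      show "\<rho> (-\<epsilon>) < \<rho> \<epsilon>" "\<psi> (-\<epsilon>) < \<psi> \<epsilon>" "\<tau> < \<rho> \<epsilon>" using mono by auto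
      show "h t' \<notin> A" if "0 < t'" "t' < \<rho> (-\<epsilon>)" for t' using hfree that mono by auto
      show "g t' \<notin> B" if "0 < t'" "t' < \<psi> (-\<epsilon>)" for t' using gfree that mono by auto
      show "D1 = {h (\<rho> (-\<epsilon>))} \<and> h (\<rho> (-\<epsilon>)) = g (\<psi> \<epsilon>) \<or> arc_between X D1 (h (\<rho> (-\<epsilon>))) (g (\<psi> \<epsilon>))"
        unfolding hm D1_def using st by (intro disjI2 arc_between_chart_segment[OF ch]) auto
      show "D2 = {g (\<psi> (-\<epsilon>))} \<and> g (\<psi> (-\<epsilon>)) = h (\<rho> \<epsilon>) \<or> arc_between X D2 (g (\<psi> (-\<epsilon>))) (h (\<rho> \<epsilon>))"
        unfolding hm D2_def using st by (intro disjI2 arc_between_chart_segment[OF ch]) auto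
      show "D1 \<inter> A = {g (\<psi> \<epsilon>)}" unfolding hm D1_def seg1 using st
        by (auto simp: jA injj image_iff intro!: exI[of _ "(s * \<epsilon>, 0)"] exI[of _ 1])
      show "D1 \<inter> B = {h (\<rho> (-\<epsilon>))}" unfolding hm D1_def seg1 using st
        by (auto simp: jB injj image_iff intro!: exI[of _ "(0, - (t * \<epsilon>))"] exI[of _ 0])
      show "D2 \<inter> A = {g (\<psi> (-\<epsilon>))}" unfolding hm D2_def seg2 using st
        by (auto simp: jA injj image_iff intro!: exI[of _ "(- (s * \<epsilon>), 0)"] exI[of _ 0])
      show "D2 \<inter> B = {h (\<rho> \<epsilon>)}" unfolding hm D2_def seg2 using st
        by (auto simp: jB injj image_iff intro!: exI[of _ "(0, t * \<epsilon>)"] exI[of _ 1])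
      show "D1 \<inter> D2 = {}"
      proof -
        have False if "0 \<le> \<theta>" "\<theta> \<le> 1" "0 \<le> \<theta>'" "\<theta>' \<le> 1" "\<theta> * (s * \<epsilon>) = - ((1 - \<theta>') * (s * \<epsilon>))"
          "- ((1 - \<theta>) * (t * \<epsilon>)) = \<theta>' * (t * \<epsilon>)" for \<theta> \<theta>' :: real
        proof -
          have "(\<theta> + (1 - \<theta>')) * (s * \<epsilon>) = 0" "((1 - \<theta>) + \<theta>') * (t * \<epsilon>) = 0"
            using that(5,6) by (simp_all add: algebra_simps)
          then have "\<theta> + (1 - \<theta>') = 0" "(1 - \<theta>) + \<theta>' = 0" using st by auto
          then show False using that(1-4) by linarith
        qed
        then show ?thesis unfolding D1_def D2_def seg1 seg2 by (auto simp: injj) blast+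
      qed
      show "(D1 \<union> D2) \<inter> \<phi> ` V = {}" using inbox by (auto simp: C_def)
      show "(D1 \<union> D2) \<inter> \<gamma> k ` {0..1} = {}" if "k \<in> E" "k \<noteq> e" "k \<noteq> f" for k
        using inbox that by (auto simp: C_def)
      show "0 < \<tau>" "h \<tau> \<in> A" using rng hmem by auto
    qed
  qed
qed

section \<open>Geodesic drawings in the projective plane\<close>

definition det3 :: "real ^ 3 \<Rightarrow> real ^ 3 \<Rightarrow> real ^ 3 \<Rightarrow> real" where
  "det3 a b c = cross3 a b \<bullet> c"

lemma det3_add [simp]:
  "det3 (a + a') b c = det3 a b c + det3 a' b c"
  "det3 a (b + b') c = det3 a b c + det3 a b' c"
  "det3 a b (c + c') = det3 a b c + det3 a b c'"
  by (simp_all add: det3_def cross_add_left cross_add_right inner_add_left inner_add_right)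

lemma det3_diff [simp]:
  "det3 (a - a') b c = det3 a b c - det3 a' b c"
  "det3 a (b - b') c = det3 a b c - det3 a b' c"
  "det3 a b (c - c') = det3 a b c - det3 a b c'"
  by (simp_all add: det3_def Cross3.left_diff_distrib Cross3.right_diff_distrib inner_diff_left inner_diff_right)

lemma det3_scale [simp]:
  "det3 (k *\<^sub>R a) b c = k * det3 a b c" "det3 a (k *\<^sub>R b) c = k * det3 a b c" "det3 a b (k *\<^sub>R c) = k * det3 a b c"
  by (simp_all add: det3_def cross_mult_left cross_mult_right)

lemma det3_minus [simp]:
  "det3 (- a) b c = - det3 a b c" "det3 a (- b) c = - det3 a b c" "det3 a b (- c) = - det3 a b c"
  by (simp_all add: det3_def)

lemma det3_zero [simp]: "det3 0 b c = 0" "det3 a 0 c = 0" "det3 a b 0 = 0"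
  by (simp_all add: det3_def)

lemma det3_same [simp]: "det3 a a c = 0" "det3 a b a = 0" "det3 a b b = 0"
  by (simp_all add: det3_def dot_cross_self)

lemma det3_swap: "det3 b a c = - det3 a b c" "det3 a c b = - det3 a b c" "det3 c b a = - det3 a b c"
  by (simp_all add: det3_def cross3_simps)

lemma det3_rotate: "det3 b c a = det3 a b c"
  by (simp add: det3_def cross3_simps)

lemma det3_component:
  "det3 a b c = a$1 * (b$2 * c$3 - b$3 * c$2) - a$2 * (b$1 * c$3 - b$3 * c$1) + a$3 * (b$1 * c$2 - b$2 * c$1)"
  by (simp add: det3_def cross3_simps)

lemma continuous_on_det3 [continuous_intros]:
  "continuous_on S f \<Longrightarrow> continuous_on S g \<Longrightarrow> continuous_on S h \<Longrightarrow> continuous_on S (\<lambda>x. det3 (f x) (g x) (h x))"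
  unfolding det3_component by (intro continuous_intros)

lemma tendsto_det3 [tendsto_intros]:
  "(f \<longlongrightarrow> a) F \<Longrightarrow> (g \<longlongrightarrow> b) F \<Longrightarrow> (h \<longlongrightarrow> c) F \<Longrightarrow> ((\<lambda>x. det3 (f x) (g x) (h x)) \<longlongrightarrow> det3 a b c) F"
  unfolding det3_component by (intro tendsto_intros)

text \<open>Cramer's rule with the denominator cleared: for independent \<open>p\<close>,
  \<open>n\<close>, \<open>m\<close> it gives the coordinates of \<open>x\<close>.\<close>

lemma cramer3:
  "det3 p n m *\<^sub>R x = det3 x n m *\<^sub>R p + det3 p x m *\<^sub>R n + det3 p n x *\<^sub>R m"
proof -
  have "(det3 p n m *\<^sub>R x) $ i = (det3 x n m *\<^sub>R p + det3 p x m *\<^sub>R n + det3 p n x *\<^sub>R m) $ i" for i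
    using exhaust_3[of i] by (auto simp: det3_component algebra_simps)
  then show ?thesis by (simp add: vec_eq_iff)
qed

lemma det3_orthogonal_zero:
  assumes "det3 a b c \<noteq> 0" "a \<bullet> x = 0" "b \<bullet> x = 0" "c \<bullet> x = 0"
  shows "x = 0"
proof -
  have "det3 a b c *\<^sub>R (x \<bullet> x) = (det3 a b c *\<^sub>R x) \<bullet> x" by simp
  also have "\<dots> = 0" unfolding cramer3[of a b c x] using assms(2-4) by (simp add: inner_add_left)
  finally show ?thesis using assms(1) by simp
qed

section \<open>Homogeneous coordinates and affine charts\<close>

definition proj :: "real ^ 3 \<Rightarrow> (real ^ 3) set" where
  "proj x = antipodal_pair (x /\<^sub>R norm x)"

lemma antipodal_pair_eq_iff: "antipodal_pair x = antipodal_pair y \<longleftrightarrow> x = y \<or> x = - y"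
  unfolding antipodal_pair_def by (auto simp: doubleton_eq_iff)

lemma proj_unit: "norm x = 1 \<Longrightarrow> proj x = antipodal_pair x"
  by (simp add: proj_def)

lemma proj_in_topspace: "x \<noteq> 0 \<Longrightarrow> proj x \<in> topspace projective_plane"
  unfolding topspace_projective_plane proj_def by (intro imageI) simp

lemma proj_scale: "k \<noteq> 0 \<Longrightarrow> proj (k *\<^sub>R x) = proj x"
  by (cases "k > 0") (auto simp: proj_def antipodal_pair_eq_iff)

lemma proj_eq_iff:
  assumes "x \<noteq> 0" "y \<noteq> 0"
  shows "proj x = proj y \<longleftrightarrow> (\<exists>k. k \<noteq> 0 \<and> x = k *\<^sub>R y)"
proof
  assume "proj x = proj y"
  then have "x /\<^sub>R norm x = y /\<^sub>R norm y \<or> x /\<^sub>R norm x = - (y /\<^sub>R norm y)"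
    by (simp add: proj_def antipodal_pair_eq_iff)
  moreover have "x = norm x *\<^sub>R (x /\<^sub>R norm x)" using assms by simp
  ultimately have "x = norm x *\<^sub>R (y /\<^sub>R norm y) \<or> x = norm x *\<^sub>R (- (y /\<^sub>R norm y))" by metis
  then have "x = (norm x / norm y) *\<^sub>R y \<or> x = (- (norm x / norm y)) *\<^sub>R y"
    by (simp add: divide_inverse)
  then show "\<exists>k. k \<noteq> 0 \<and> x = k *\<^sub>R y"
    using assms by (metis divide_eq_0_iff neg_equal_0_iff_equal norm_eq_zero)
qed (auto simp: proj_scale)

lemma continuous_map_proj:
  assumes "continuous_on S f" "\<And>x. x \<in> S \<Longrightarrow> f x \<noteq> 0"
  shows "continuous_map (top_of_set S) projective_plane (\<lambda>x. proj (f x))"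
proof -
  have "continuous_on S (\<lambda>x. f x /\<^sub>R norm (f x))"
    using assms by (intro continuous_intros) auto
  then have "continuous_map (top_of_set S) (top_of_set (sphere 0 1)) (\<lambda>x. f x /\<^sub>R norm (f x))"
    using assms(2) by (auto simp: continuous_map_in_subtopology)
  moreover have "continuous_map (top_of_set (sphere 0 1)) projective_plane antipodal_pair"
    using quotient_imp_continuous_map quotient_map_projective_plane by blast
  ultimately have "continuous_map (top_of_set S) projective_plane (antipodal_pair \<circ> (\<lambda>x. f x /\<^sub>R norm (f x)))"
    by (rule continuous_map_compose)
  then show ?thesis by (simp add: o_def proj_def)
qed

text \<open>The projection onto a line, \<open>x x\<^sup>T\<close>, embeds the projective plane into the space of matrices.\<close>

lemma Hausdorff_projective_plane: "Hausdorff_space projective_plane"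
proof -
  define M :: "real ^ 3 \<Rightarrow> real ^ 3 ^ 3" where "M x = (\<chi> i j. x $ i * x $ j)" for x
  define F where "F S = M (SOME x. x \<in> S)" for S
  have FM: "F (antipodal_pair x) = M x" for x
  proof -
    have "(SOME y. y \<in> antipodal_pair x) \<in> antipodal_pair x"
      by (rule someI[of _ x]) (simp add: antipodal_pair_def)
    then have "(SOME y. y \<in> antipodal_pair x) = x \<or> (SOME y. y \<in> antipodal_pair x) = - x"
      by (simp add: antipodal_pair_def)
    moreover have "M (- x) = M x" by (simp add: M_def)
    ultimately show ?thesis unfolding F_def by metis
  qed
  have "continuous_on (sphere 0 1) M"
    unfolding M_def by (intro continuous_intros)
  then have "continuous_map (top_of_set (sphere 0 1)) euclidean (F \<circ> antipodal_pair)"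
    by (simp add: o_def FM)
  then have cF: "continuous_map projective_plane euclidean F"
    using continuous_compose_quotient_map_eq[OF quotient_map_projective_plane] by blast
  have "inj_on F (topspace projective_plane)"
  proof (rule inj_onI)
    fix S T assume "S \<in> topspace projective_plane" "T \<in> topspace projective_plane" and FST: "F S = F T"
    then obtain x y where S: "S = antipodal_pair x" "T = antipodal_pair y" and x: "norm x = 1"
      unfolding topspace_projective_plane by auto
    have "M x = M y" using FST by (simp add: S FM)
    then have eq: "x $ i * x $ j = y $ i * y $ j" for i j by (simp add: M_def vec_eq_iff)
    have "x \<noteq> 0" using x by auto
    then obtain i where i: "x $ i \<noteq> 0" by (auto simp: vec_eq_iff)
    have "(x $ i)\<^sup>2 = (y $ i)\<^sup>2" using eq[of i i] by (simp add: power2_eq_square)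
    then consider "x $ i = y $ i" | "x $ i = - y $ i" using power2_eq_iff by blast
    then have "x = y \<or> x = - y"
    proof cases
      case 1
      then have "x $ j = y $ j" for j using eq[of i j] i by auto
      then show ?thesis by (simp add: vec_eq_iff)
    next
      case 2
      have "x $ j = - y $ j" for j
      proof -
        have "x $ i * x $ j = x $ i * (- y $ j)" using eq[of i j] 2 by simp
        then show ?thesis using i by (metis mult_left_cancel)
      qed
      then show ?thesis by (simp add: vec_eq_iff)
    qed
    then show "S = T" unfolding S antipodal_pair_eq_iff .
  qed
  then show ?thesis
    using Hausdorff_space_injective_preimage[OF Hausdorff_space_euclidean cF] by blast
qed

text \<open>This is the affine chart of the points off the line spanned by \<open>n\<close> and
  \<open>m\<close>. Its inverse consists of quotients of Cramer's coordinates. Openness of images is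
  checked on the sphere, where the preimage is cut out by \<open>det3 x n m \<noteq> 0\<close> and
  by the values of these continuous quotients.\<close>

lemma plane_chart_projective_plane:
  assumes D: "det3 p n m \<noteq> 0"
  shows "\<exists>U h. plane_chart projective_plane U h (\<lambda>(y, z). proj (p + y *\<^sub>R n + z *\<^sub>R m))"
proof -
  define j where "j = (\<lambda>(y, z). proj (p + y *\<^sub>R n + z *\<^sub>R m))"
  define f where "f = (\<lambda>(y, z). p + y *\<^sub>R n + z *\<^sub>R m)"
  have jf: "j w = proj (f w)" for w by (simp add: j_def f_def case_prod_unfold)
  have coord: "det3 (f w) n m = det3 p n m" "det3 p (f w) m = fst w * det3 p n m" "det3 p n (f w) = snd w * det3 p n m" for w
    by (simp_all add: f_def case_prod_unfold)
  have f0: "f w \<noteq> 0" for w using coord(1)[of w] D by auto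
  have "continuous_on UNIV f" unfolding f_def case_prod_unfold by (intro continuous_intros)
  then have cj: "continuous_map euclidean projective_plane j"
    using continuous_map_proj[of UNIV f] f0 jf[THEN ext[of j "\<lambda>w. proj (f w)"]] by simp
  have injj: "inj j"
  proof (rule injI)
    fix w w' assume "j w = j w'"
    then obtain k where k: "k \<noteq> 0" "f w = k *\<^sub>R f w'" using proj_eq_iff[OF f0 f0] by (auto simp: jf)
    have "k = 1" using coord(1)[of w] coord(1)[of w'] D by (simp add: k(2))
    then show "w = w'"
      using coord(2,3)[of w] coord(2,3)[of w'] D by (simp add: k(2) prod_eq_iff)
  qed
  have openj: "openin projective_plane (j ` W)" if "open W" for W
    unfolding openin_projective_plane
  proof
    show "j ` W \<subseteq> antipodal_pair ` sphere 0 1"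
      using proj_in_topspace[OF f0] unfolding topspace_projective_plane jf by auto
    define S' where "S' = sphere 0 1 \<inter> (\<lambda>x. det3 x n m) -` (- {0})"
    define g where "g x = (det3 p x m / det3 x n m, det3 p n x / det3 x n m)" for x
    have iff: "antipodal_pair x \<in> j ` W \<longleftrightarrow> x \<in> S' \<and> g x \<in> W" if x: "x \<in> sphere 0 1" for x
    proof
      have x1: "norm x = 1" "x \<noteq> 0" using x by auto
      assume "antipodal_pair x \<in> j ` W"
      then obtain w where w: "w \<in> W" "proj x = proj (f w)" using x1 by (auto simp: proj_unit jf)
      then obtain k where k: "k \<noteq> 0" "x = k *\<^sub>R f w" using proj_eq_iff[OF x1(2) f0] by auto
      then have "g x = w" using D by (simp add: g_def coord)
      moreover have "det3 x n m \<noteq> 0" using k D by (simp add: coord)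
      ultimately show "x \<in> S' \<and> g x \<in> W" using w x by (simp add: S'_def)
    next
      have x1: "norm x = 1" "x \<noteq> 0" using x by auto
      assume "x \<in> S' \<and> g x \<in> W"
      then have d: "det3 x n m \<noteq> 0" "g x \<in> W" by (auto simp: S'_def)
      have "det3 x n m *\<^sub>R f (g x) = det3 p n m *\<^sub>R x"
        unfolding cramer3[of p n m x] using d(1) by (simp add: f_def g_def algebra_simps)
      then have "proj (f (g x)) = proj x" using proj_scale[OF d(1), of "f (g x)"] proj_scale[OF D, of x] by simp
      then show "antipodal_pair x \<in> j ` W" using d(2) x1(1) by (metis image_eqI jf proj_unit)
    qed
    have "openin (top_of_set (sphere 0 1)) S'"
      unfolding S'_def by (rule continuous_openin_preimage_gen) (auto intro!: continuous_intros)
    moreover have "openin (top_of_set S') (S' \<inter> g -` W)"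
    proof (rule continuous_openin_preimage_gen[OF _ that])
      show "continuous_on S' g" unfolding g_def by (intro continuous_intros) (auto simp: S'_def)
    qed
    moreover have "{x \<in> sphere 0 1. antipodal_pair x \<in> j ` W} = S' \<inter> g -` W"
      using iff by (auto simp: S'_def)
    ultimately show "openin (top_of_set (sphere 0 1)) {x \<in> sphere 0 1. antipodal_pair x \<in> j ` W}"
      using openin_trans by metis
  qed
  define U where "U = range j"
  have oU: "openin projective_plane U" using openj[of UNIV] by (simp add: U_def)
  have "homeomorphic_map euclidean (subtopology projective_plane U) j"
  proof (rule bijective_open_imp_homeomorphic_map)
    show "continuous_map euclidean (subtopology projective_plane U) j"
      using cj by (simp add: continuous_map_in_subtopology U_def)
    show "open_map euclidean (subtopology projective_plane U) j"
      unfolding open_map_def using openj oU by (auto simp: openin_open_subtopology U_def)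
    show "j ` topspace euclidean = topspace (subtopology projective_plane U)"
      using openin_subset[OF oU] by (auto simp: U_def)
    show "inj_on j (topspace euclidean)" using injj by simp
  qed
  then obtain h where "homeomorphic_maps euclidean (subtopology projective_plane U) j h"
    using homeomorphic_map_maps by blast
  then have "homeomorphic_maps (subtopology projective_plane U) euclidean h j"
    using homeomorphic_maps_sym by blast
  then show ?thesis using oU unfolding plane_chart_def j_def by blast
qed

section \<open>Projective segments: the two arcs into which two points divide their line\<close>

definition proj_segment :: "real ^ 3 \<Rightarrow> real ^ 3 \<Rightarrow> (real ^ 3) set set" where
  "proj_segment a b = {proj (\<alpha> *\<^sub>R a + \<beta> *\<^sub>R b) |\<alpha> \<beta>. 0 \<le> \<alpha> \<and> 0 \<le> \<beta> \<and> 0 < \<alpha> + \<beta>}"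

definition open_proj_segment :: "real ^ 3 \<Rightarrow> real ^ 3 \<Rightarrow> (real ^ 3) set set" where
  "open_proj_segment a b = {proj (\<alpha> *\<^sub>R a + \<beta> *\<^sub>R b) |\<alpha> \<beta>. 0 < \<alpha> \<and> 0 < \<beta>}"

text \<open>A vector \<open>c\<close> with \<open>det3 a b c \<noteq> 0\<close> witnesses that
  \<open>a\<close> and \<open>b\<close> are independent; the lemmas on segments carry such a witness
  along.\<close>

lemma linear_combination_nonzero:
  assumes "det3 a b c \<noteq> 0" "\<alpha> \<noteq> 0 \<or> \<beta> \<noteq> 0"
  shows "\<alpha> *\<^sub>R a + \<beta> *\<^sub>R b \<noteq> 0"
proof
  assume "\<alpha> *\<^sub>R a + \<beta> *\<^sub>R b = 0"
  then have "det3 (\<alpha> *\<^sub>R a + \<beta> *\<^sub>R b) b c = 0" "det3 a (\<alpha> *\<^sub>R a + \<beta> *\<^sub>R b) c = 0" by simp_all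
  then show False using assms by simp
qed

lemma linear_combination_eq:
  assumes "det3 a b c \<noteq> 0" "\<alpha> *\<^sub>R a + \<beta> *\<^sub>R b = \<alpha>' *\<^sub>R a + \<beta>' *\<^sub>R b"
  shows "\<alpha> = \<alpha>' \<and> \<beta> = \<beta>'"
proof -
  have "(\<alpha> - \<alpha>') *\<^sub>R a + (\<beta> - \<beta>') *\<^sub>R b = 0" using assms(2) by (simp add: algebra_simps)
  then show ?thesis using linear_combination_nonzero[OF assms(1), of "\<alpha> - \<alpha>'" "\<beta> - \<beta>'"] by auto
qed

lemma proj_segment_commute: "proj_segment a b = proj_segment b a"
  unfolding proj_segment_def by (metis (no_types, opaque_lifting) add.commute)

lemma open_proj_segment_commute: "open_proj_segment a b = open_proj_segment b a"
  unfolding open_proj_segment_def by (metis (no_types, opaque_lifting) add.commute)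

lemma open_proj_segment_minus: "open_proj_segment (- a) (- b) = open_proj_segment a b"
proof -
  have "proj (\<alpha> *\<^sub>R (- a) + \<beta> *\<^sub>R (- b)) = proj (\<alpha> *\<^sub>R a + \<beta> *\<^sub>R b)" for \<alpha> \<beta>
    using proj_scale[of "-1" "\<alpha> *\<^sub>R a + \<beta> *\<^sub>R b"] by simp
  then show ?thesis unfolding open_proj_segment_def by simp
qed

lemma proj_path:
  assumes D: "det3 a b c \<noteq> 0"
  shows "simple_arc_in projective_plane (\<lambda>t. proj ((1 - t) *\<^sub>R a + t *\<^sub>R b))"
    and "(\<lambda>t. proj ((1 - t) *\<^sub>R a + t *\<^sub>R b)) ` {0..1} = proj_segment a b"
    and "(\<lambda>t. proj ((1 - t) *\<^sub>R a + t *\<^sub>R b)) ` {0<..<1} = open_proj_segment a b"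
proof -
  let ?g = "\<lambda>t. (1 - t) *\<^sub>R a + t *\<^sub>R b"
  have nz: "?g t \<noteq> 0" for t using linear_combination_nonzero[OF D, of "1 - t" t] by auto
  show "simple_arc_in projective_plane (\<lambda>t. proj (?g t))"
    unfolding simple_arc_in_def pathin_def
  proof
    show "continuous_map (top_of_set {0..1}) projective_plane (\<lambda>t. proj (?g t))"
      using nz by (intro continuous_map_proj continuous_intros) auto
    show "inj_on (\<lambda>t. proj (?g t)) {0..1}"
    proof (rule inj_onI)
      fix s t :: real assume "proj (?g s) = proj (?g t)"
      then obtain k where "?g s = k *\<^sub>R ?g t" using proj_eq_iff[OF nz nz] by auto
      then have "(1 - s) *\<^sub>R a + s *\<^sub>R b = (k * (1 - t)) *\<^sub>R a + (k * t) *\<^sub>R b" by (simp add: scaleR_add_right)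
      from linear_combination_eq[OF D this] have e: "1 - s = k * (1 - t)" "s = k * t" by auto
      then have "k = 1" by (simp add: algebra_simps)
      then show "s = t" using e by simp
    qed
  qed
  have norm: "proj (\<alpha> *\<^sub>R a + \<beta> *\<^sub>R b) = proj (?g (\<beta> / (\<alpha> + \<beta>)))" if "\<alpha> + \<beta> > 0" for \<alpha> \<beta>
  proof -
    have "1 - \<beta> / (\<alpha> + \<beta>) = \<alpha> / (\<alpha> + \<beta>)" using that by (simp add: field_simps)
    then have "(\<alpha> + \<beta>) *\<^sub>R ?g (\<beta> / (\<alpha> + \<beta>)) = \<alpha> *\<^sub>R a + \<beta> *\<^sub>R b" using that by (simp add: scaleR_add_right)
    then show ?thesis using proj_scale[of "\<alpha> + \<beta>" "?g (\<beta> / (\<alpha> + \<beta>))"] that by simp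
  qed
  show "(\<lambda>t. proj (?g t)) ` {0..1} = proj_segment a b"
  proof
    show "(\<lambda>t. proj (?g t)) ` {0..1} \<subseteq> proj_segment a b"
    proof
      fix x assume "x \<in> (\<lambda>t. proj (?g t)) ` {0..1}"
      then obtain t where "t \<in> {0..1}" "x = proj (?g t)" by blast
      then show "x \<in> proj_segment a b"
        unfolding proj_segment_def by (intro CollectI exI[of _ "1 - t"] exI[of _ t]) auto
    qed
    show "proj_segment a b \<subseteq> (\<lambda>t. proj (?g t)) ` {0..1}"
    proof
      fix x assume "x \<in> proj_segment a b"
      then obtain \<alpha> \<beta> where "0 \<le> \<alpha>" "0 \<le> \<beta>" "0 < \<alpha> + \<beta>" "x = proj (\<alpha> *\<^sub>R a + \<beta> *\<^sub>R b)"
        unfolding proj_segment_def by blast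
      then show "x \<in> (\<lambda>t. proj (?g t)) ` {0..1}"
        using norm[of \<alpha> \<beta>] by (intro image_eqI[of _ _ "\<beta> / (\<alpha> + \<beta>)"]) (auto simp: field_simps)
    qed
  qed
  show "(\<lambda>t. proj (?g t)) ` {0<..<1} = open_proj_segment a b"
  proof
    show "(\<lambda>t. proj (?g t)) ` {0<..<1} \<subseteq> open_proj_segment a b"
    proof
      fix x assume "x \<in> (\<lambda>t. proj (?g t)) ` {0<..<1}"
      then obtain t where "t \<in> {0<..<1}" "x = proj (?g t)" by blast
      then show "x \<in> open_proj_segment a b"
        unfolding open_proj_segment_def by (intro CollectI exI[of _ "1 - t"] exI[of _ t]) auto
    qed
    show "open_proj_segment a b \<subseteq> (\<lambda>t. proj (?g t)) ` {0<..<1}"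
    proof
      fix x assume "x \<in> open_proj_segment a b"
      then obtain \<alpha> \<beta> where "0 < \<alpha>" "0 < \<beta>" "x = proj (\<alpha> *\<^sub>R a + \<beta> *\<^sub>R b)"
        unfolding open_proj_segment_def by blast
      then show "x \<in> (\<lambda>t. proj (?g t)) ` {0<..<1}"
        using norm[of \<alpha> \<beta>] by (intro image_eqI[of _ _ "\<beta> / (\<alpha> + \<beta>)"]) (auto simp: field_simps)
    qed
  qed
qed

lemma closedin_proj_segment:
  assumes "det3 a b c \<noteq> 0"
  shows "closedin projective_plane (proj_segment a b)"
proof -
  have "pathin projective_plane (\<lambda>t. proj ((1 - t) *\<^sub>R a + t *\<^sub>R b))"
    using proj_path(1)[OF assms] by (simp add: simple_arc_in_def)
  from simple_arc_in_closedin[OF Hausdorff_projective_plane this, of 0 1]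
  show ?thesis unfolding proj_path(2)[OF assms] by simp
qed

text \<open>Negating \<open>b\<close> passes to the other segment with the same ends. Together the
  two segments make up the whole line, which has a linear equation.\<close>

lemma proj_in_segments_iff:
  assumes D: "det3 a b c \<noteq> 0" and "x \<noteq> 0"
  shows "proj x \<in> proj_segment a b \<union> proj_segment a (- b) \<longleftrightarrow> det3 a b x = 0"
proof
  assume "proj x \<in> proj_segment a b \<union> proj_segment a (- b)"
  then obtain \<alpha> \<beta> b' where b': "b' = b \<or> b' = - b" "0 \<le> \<alpha>" "0 \<le> \<beta>" "0 < \<alpha> + \<beta>" "proj x = proj (\<alpha> *\<^sub>R a + \<beta> *\<^sub>R b')"
    unfolding proj_segment_def by blast
  moreover have "\<alpha> *\<^sub>R a + \<beta> *\<^sub>R b' \<noteq> 0"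
    using b' D by (intro linear_combination_nonzero[of _ _ c]) auto
  ultimately obtain k where "x = k *\<^sub>R (\<alpha> *\<^sub>R a + \<beta> *\<^sub>R b')" using proj_eq_iff[OF assms(2)] by blast
  then show "det3 a b x = 0" using b'(1) by auto
next
  assume 0: "det3 a b x = 0"
  define \<alpha> where "\<alpha> = det3 x b c / det3 a b c"
  define \<beta> where "\<beta> = det3 a x c / det3 a b c"
  have "det3 a b c *\<^sub>R x = det3 a b c *\<^sub>R (\<alpha> *\<^sub>R a + \<beta> *\<^sub>R b)"
    unfolding cramer3[of a b c x] using D by (simp add: 0 \<alpha>_def \<beta>_def scaleR_add_right)
  then have x: "x = \<alpha> *\<^sub>R a + \<beta> *\<^sub>R b" using D by simp
  have mx: "proj x = proj (- x)" using proj_scale[of "-1" x] by simp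
  have ne: "\<alpha> \<noteq> 0 \<or> \<beta> \<noteq> 0" using assms(2) x by auto
  have pos: "proj y \<in> proj_segment a b \<union> proj_segment a (- b)"
    if y: "y = \<alpha> *\<^sub>R a + \<beta> *\<^sub>R b" "\<alpha> \<ge> 0" "\<alpha> \<noteq> 0 \<or> \<beta> \<noteq> 0" for y \<alpha> \<beta>
  proof (cases "\<beta> \<ge> 0")
    case True
    then have "proj y \<in> proj_segment a b" unfolding proj_segment_def using y by fastforce
    then show ?thesis by blast
  next
    case False
    then have "y = \<alpha> *\<^sub>R a + (- \<beta>) *\<^sub>R (- b)" "0 \<le> - \<beta>" "0 < \<alpha> + - \<beta>" using y by auto
    then have "proj y \<in> proj_segment a (- b)" unfolding proj_segment_def using y(2) by blast
    then show ?thesis by blast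
  qed
  show "proj x \<in> proj_segment a b \<union> proj_segment a (- b)"
  proof (cases "\<alpha> \<ge> 0")
    case True
    then show ?thesis using pos[OF x] ne by blast
  next
    case False
    have "- x = (- \<alpha>) *\<^sub>R a + (- \<beta>) *\<^sub>R b" using x by simp
    then show ?thesis unfolding mx using pos[of "- x" "- \<alpha>" "- \<beta>"] False ne by simp
  qed
qed

text \<open>As the complementary segment is closed, an interior point of a segment then has a
  neighbourhood in which the segment agrees with its whole line. This carries statements from lines
  over to segments.\<close>

lemma open_proj_segment_disjoint_complement:
  assumes D: "det3 a b c \<noteq> 0" and r: "r \<in> open_proj_segment a b"
  shows "r \<notin> proj_segment a (- b)"
proof
  assume "r \<in> proj_segment a (- b)"
  then obtain \<alpha>' \<beta>' where 1: "0 \<le> \<alpha>'" "0 \<le> \<beta>'" "0 < \<alpha>' + \<beta>'" "r = proj (\<alpha>' *\<^sub>R a + \<beta>' *\<^sub>R (- b))"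
    unfolding proj_segment_def by blast
  obtain \<alpha> \<beta> where 2: "0 < \<alpha>" "0 < \<beta>" "r = proj (\<alpha> *\<^sub>R a + \<beta> *\<^sub>R b)"
    using r unfolding open_proj_segment_def by blast
  have "\<alpha> *\<^sub>R a + \<beta> *\<^sub>R b \<noteq> 0" "\<alpha>' *\<^sub>R a + (- \<beta>') *\<^sub>R b \<noteq> 0"
    using 1 2 by (intro linear_combination_nonzero[OF D]; force)+
  then obtain k where "\<alpha> *\<^sub>R a + \<beta> *\<^sub>R b = k *\<^sub>R (\<alpha>' *\<^sub>R a + (- \<beta>') *\<^sub>R b)"
    using proj_eq_iff[of "\<alpha> *\<^sub>R a + \<beta> *\<^sub>R b" "\<alpha>' *\<^sub>R a + (- \<beta>') *\<^sub>R b"] 1(4) 2(3) by auto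
  then have "\<alpha> *\<^sub>R a + \<beta> *\<^sub>R b = (k * \<alpha>') *\<^sub>R a + (k * (- \<beta>')) *\<^sub>R b" by (simp add: scaleR_diff_right)
  from linear_combination_eq[OF D this] have "\<alpha> = k * \<alpha>'" "\<beta> = - (k * \<beta>')" by auto
  then have "0 < k * \<alpha>'" "k * \<beta>' < 0" using 2 by auto
  then show False using 1 by (auto simp: zero_less_mult_iff mult_less_0_iff)
qed

text \<open>If a vector lies in both planes \<open>span {a, b}\<close> and \<open>span {c, d}\<close>, its coordinates with respect to
  \<open>c, d\<close> are proportional to \<open>det3 a b d, - det3 a b c\<close>.\<close>

lemma proj_segments_meet:
  assumes abc: "det3 a b c \<noteq> 0" and abd: "det3 a b d \<noteq> 0" and cda: "det3 c d a \<noteq> 0"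
    and r: "r \<in> proj_segment a b" "r \<in> proj_segment c d"
  shows "r = proj (det3 a b d *\<^sub>R c - det3 a b c *\<^sub>R d)"
    and "r \<in> open_proj_segment c d \<Longrightarrow> det3 a b c * det3 a b d < 0"
proof -
  obtain \<alpha> \<beta> where ab: "0 \<le> \<alpha>" "0 \<le> \<beta>" "0 < \<alpha> + \<beta>" "r = proj (\<alpha> *\<^sub>R a + \<beta> *\<^sub>R b)"
    using r unfolding proj_segment_def by blast
  have nzab: "\<alpha> *\<^sub>R a + \<beta> *\<^sub>R b \<noteq> 0" using ab by (intro linear_combination_nonzero[OF abc]) auto
  have gen: "r = proj (det3 a b d *\<^sub>R c - det3 a b c *\<^sub>R d) \<and> (0 < \<gamma> \<and> 0 < \<delta> \<longrightarrow> det3 a b c * det3 a b d < 0)"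
    if cd: "0 \<le> \<gamma>" "0 \<le> \<delta>" "0 < \<gamma> + \<delta>" "r = proj (\<gamma> *\<^sub>R c + \<delta> *\<^sub>R d)" for \<gamma> \<delta>
  proof -
    have nzcd: "\<gamma> *\<^sub>R c + \<delta> *\<^sub>R d \<noteq> 0" using cd by (intro linear_combination_nonzero[OF cda]) auto
    obtain k where k: "k \<noteq> 0" "\<gamma> *\<^sub>R c + \<delta> *\<^sub>R d = k *\<^sub>R (\<alpha> *\<^sub>R a + \<beta> *\<^sub>R b)"
      using proj_eq_iff[OF nzcd nzab] ab(4) cd(4) by auto
    have "det3 a b (\<gamma> *\<^sub>R c + \<delta> *\<^sub>R d) = 0" unfolding k(2) by simp
    then have e: "\<gamma> * det3 a b c = - (\<delta> * det3 a b d)" by simp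
    have d0: "\<delta> \<noteq> 0" using e abc cd by auto
    have "det3 a b d *\<^sub>R (\<gamma> *\<^sub>R c + \<delta> *\<^sub>R d) = \<gamma> *\<^sub>R (det3 a b d *\<^sub>R c - det3 a b c *\<^sub>R d)"
    proof -
      have "det3 a b d *\<^sub>R (\<gamma> *\<^sub>R c + \<delta> *\<^sub>R d) = (\<gamma> * det3 a b d) *\<^sub>R c + (\<delta> * det3 a b d) *\<^sub>R d"
        by (simp add: scaleR_add_right mult.commute)
      also have "\<delta> * det3 a b d = - (\<gamma> * det3 a b c)" using e by simp
      finally show ?thesis by (simp add: scaleR_diff_right)
    qed
    moreover have g0: "\<gamma> \<noteq> 0" using e d0 abd by auto
    ultimately have "r = proj (det3 a b d *\<^sub>R c - det3 a b c *\<^sub>R d)"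
      using proj_scale[OF abd, of "\<gamma> *\<^sub>R c + \<delta> *\<^sub>R d"] proj_scale[OF g0] cd(4) by metis
    moreover have "det3 a b c * det3 a b d < 0" if "0 < \<gamma>" "0 < \<delta>"
    proof -
      have "\<gamma> * (det3 a b c * det3 a b d) = - (\<delta> * (det3 a b d * det3 a b d))" using e by (metis mult.assoc mult.commute mult_minus_left)
      moreover have "\<delta> * (det3 a b d * det3 a b d) > 0" using that abd by (metis not_real_square_gt_zero mult_pos_pos)
      ultimately have "\<gamma> * (det3 a b c * det3 a b d) < 0" by simp
      then show ?thesis using that by (simp add: mult_less_0_iff)
    qed
    ultimately show ?thesis by blast
  qed
  show "r = proj (det3 a b d *\<^sub>R c - det3 a b c *\<^sub>R d)"
    using r(2) gen unfolding proj_segment_def by blast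
  show "det3 a b c * det3 a b d < 0" if o: "r \<in> open_proj_segment c d"
  proof -
    obtain \<gamma> \<delta> where "0 < \<gamma>" "0 < \<delta>" "r = proj (\<gamma> *\<^sub>R c + \<delta> *\<^sub>R d)"
      using o unfolding open_proj_segment_def by blast
    then show ?thesis using gen[of \<gamma> \<delta>] by auto
  qed
qed

lemma open_proj_segment_subset: "open_proj_segment a b \<subseteq> proj_segment a b"
  unfolding open_proj_segment_def proj_segment_def by fastforce

lemma proj_segments_common_end:
  assumes abd: "det3 a b d \<noteq> 0" and r: "r \<in> proj_segment a b" "r \<in> proj_segment a d"
  shows "r = proj a"
proof -
  obtain \<alpha> \<beta> where 1: "0 \<le> \<alpha>" "0 \<le> \<beta>" "0 < \<alpha> + \<beta>" "r = proj (\<alpha> *\<^sub>R a + \<beta> *\<^sub>R b)"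
    using r unfolding proj_segment_def by blast
  obtain \<gamma> \<delta> where 2: "0 \<le> \<gamma>" "0 \<le> \<delta>" "0 < \<gamma> + \<delta>" "r = proj (\<gamma> *\<^sub>R a + \<delta> *\<^sub>R d)"
    using r unfolding proj_segment_def by blast
  have nz1: "\<alpha> *\<^sub>R a + \<beta> *\<^sub>R b \<noteq> 0" using 1 by (intro linear_combination_nonzero[OF abd]) auto
  have nz2: "\<gamma> *\<^sub>R a + \<delta> *\<^sub>R d \<noteq> 0"
    using 2 abd by (intro linear_combination_nonzero[of a d b]) (auto simp: det3_swap(2)[of a d b])
  obtain k where k: "k \<noteq> 0" "\<alpha> *\<^sub>R a + \<beta> *\<^sub>R b = k *\<^sub>R (\<gamma> *\<^sub>R a + \<delta> *\<^sub>R d)"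
    using proj_eq_iff[OF nz1 nz2] 1(4) 2(4) by auto
  have "det3 a (\<alpha> *\<^sub>R a + \<beta> *\<^sub>R b) d = 0" unfolding k(2) by simp
  then have "\<beta> = 0" using abd by simp
  then show ?thesis using 1 proj_scale[of \<alpha> a] by simp
qed

lemma proj_notin_segment:
  assumes "det3 a b c \<noteq> 0"
  shows "proj c \<notin> proj_segment a b"
  using proj_in_segments_iff[OF assms, of c] assms by (cases "c = 0") auto

lemma proj_end_notin_open_segment:
  assumes D: "det3 a b c \<noteq> 0"
  shows "proj a \<notin> open_proj_segment a b"
proof
  assume "proj a \<in> open_proj_segment a b"
  then have "proj a \<notin> proj_segment a (- b)" by (rule open_proj_segment_disjoint_complement[OF D])
  moreover have "proj (1 *\<^sub>R a + 0 *\<^sub>R (- b)) \<in> proj_segment a (- b)"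
    unfolding proj_segment_def by (intro CollectI exI[of _ "1 :: real"] exI[of _ "0 :: real"]) simp
  ultimately show False by simp
qed

text \<open>In the affine chart centred at the crossing with directions \<open>b\<close> and
  \<open>d\<close>, the two lines are the coordinate axes. So the lines cross transversally, and
  taking away the complementary segments restricts this to the segments.\<close>

lemma cross_transversally_proj_segments:
  assumes abc: "det3 a b c \<noteq> 0" and abd: "det3 a b d \<noteq> 0" and cda: "det3 c d a \<noteq> 0" and cdb: "det3 c d b \<noteq> 0"
    and r: "r \<in> open_proj_segment a b" "r \<in> open_proj_segment c d"
  shows "cross_transversally_at projective_plane (proj_segment a b) (proj_segment c d) r"
proof -
  obtain \<alpha> \<beta> where ab: "0 < \<alpha>" "0 < \<beta>" "r = proj (\<alpha> *\<^sub>R a + \<beta> *\<^sub>R b)"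
    using r unfolding open_proj_segment_def by blast
  obtain \<gamma> \<delta> where cd: "0 < \<gamma>" "0 < \<delta>" "r = proj (\<gamma> *\<^sub>R c + \<delta> *\<^sub>R d)"
    using r unfolding open_proj_segment_def by blast
  define p where "p = \<alpha> *\<^sub>R a + \<beta> *\<^sub>R b"
  have p0: "p \<noteq> 0" unfolding p_def using ab by (intro linear_combination_nonzero[OF abc]) auto
  have q0: "\<gamma> *\<^sub>R c + \<delta> *\<^sub>R d \<noteq> 0" using cd by (intro linear_combination_nonzero[OF cda]) auto
  obtain k where k: "k \<noteq> 0" "p = k *\<^sub>R (\<gamma> *\<^sub>R c + \<delta> *\<^sub>R d)"
    using proj_eq_iff[OF p0 q0] ab(3) cd(3) unfolding p_def by auto
  have D: "det3 p b d \<noteq> 0" using ab abd by (simp add: p_def)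
  obtain U h where ch: "plane_chart projective_plane U h (\<lambda>(y, z). proj (p + y *\<^sub>R b + z *\<^sub>R d))"
    using plane_chart_projective_plane[OF D] by blast
  have nz: "p + y *\<^sub>R b + z *\<^sub>R d \<noteq> 0" for y z
  proof
    assume "p + y *\<^sub>R b + z *\<^sub>R d = 0"
    then have "det3 (p + y *\<^sub>R b + z *\<^sub>R d) b d = 0" by simp
    then show False using D by simp
  qed
  have "det3 a b (p + y *\<^sub>R b + z *\<^sub>R d) = z * det3 a b d" for y z by (simp add: p_def)
  then have 1: "proj (p + y *\<^sub>R b + z *\<^sub>R d) \<in> proj_segment a b \<union> proj_segment a (- b) \<longleftrightarrow> z = 0" for y z
    using proj_in_segments_iff[OF abc nz[of y z]] abd by simp
  have "det3 c d (p + y *\<^sub>R b + z *\<^sub>R d) = y * det3 c d b" for y z by (simp add: k(2))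
  then have 2: "proj (p + y *\<^sub>R b + z *\<^sub>R d) \<in> proj_segment c d \<union> proj_segment c (- d) \<longleftrightarrow> y = 0" for y z
    using proj_in_segments_iff[OF cda nz[of y z]] cdb by simp
  have "r = proj p" using ab by (simp add: p_def)
  then have full: "cross_transversally_at projective_plane (proj_segment a b \<union> proj_segment a (- b))
      (proj_segment c d \<union> proj_segment c (- d)) r"
    unfolding cross_transversally_at_iff
    by (intro exI[of _ U] exI[of _ h] exI[of _ "\<lambda>(y, z). proj (p + y *\<^sub>R b + z *\<^sub>R d)"])
       (simp only: ch 1 2 case_prod_conv, simp)
  define W where "W = topspace projective_plane - (proj_segment a (- b) \<union> proj_segment c (- d))"
  have "closedin projective_plane (proj_segment a (- b))" "closedin projective_plane (proj_segment c (- d))"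
    using closedin_proj_segment[of a "- b" c] closedin_proj_segment[of c "- d" a] abc cda by auto
  then have "openin projective_plane W" unfolding W_def by (intro openin_diff openin_topspace closedin_Un)
  moreover have "r \<in> W"
    using open_proj_segment_disjoint_complement[OF abc r(1)] open_proj_segment_disjoint_complement[OF cda r(2)]
      proj_in_topspace[OF p0] \<open>r = proj p\<close> by (simp add: W_def)
  ultimately show ?thesis
    by (rule cross_transversally_at_local[OF full]) (auto simp: W_def)
qed

text \<open>The edge \<open>ab\<close> is the segment from \<open>p a\<close> to
  \<open>s a b\<close> times \<open>p b\<close>. The lines \<open>ab\<close> and \<open>cd\<close>
  have one common point, and it lies inside the edge \<open>cd\<close> when the plane of
  \<open>p a\<close> and \<open>p b\<close> separates \<open>p c\<close> from \<open>s c d\<close>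
  times \<open>p d\<close>. The two inequalities express this for both edges.\<close>

definition crosses :: "(nat \<Rightarrow> real ^ 3) \<Rightarrow> (nat \<Rightarrow> nat \<Rightarrow> real) \<Rightarrow> nat \<Rightarrow> nat \<Rightarrow> nat \<Rightarrow> nat \<Rightarrow> bool" where
  "crosses p s a b c d \<longleftrightarrow>
     det3 (p a) (p b) (p c) * det3 (p a) (p b) (p d) * s c d < 0 \<and>
     det3 (p c) (p d) (p a) * det3 (p c) (p d) (p b) * s a b < 0"

text \<open>Quadruples are ordered: for symmetric \<open>s\<close>, exchanging the ends of an edge
  or the two edges lists every crossing pair of edges eight times.\<close>

definition crossing_quads :: "nat \<Rightarrow> (nat \<Rightarrow> real ^ 3) \<Rightarrow> (nat \<Rightarrow> nat \<Rightarrow> real) \<Rightarrow> (nat \<times> nat \<times> nat \<times> nat) set" where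
  "crossing_quads n p s = {(a, b, c, d). a < n \<and> b < n \<and> c < n \<and> d < n \<and> distinct [a, b, c, d] \<and> crosses p s a b c d}"

definition no_three_collinear :: "nat \<Rightarrow> (nat \<Rightarrow> real ^ 3) \<Rightarrow> bool" where
  "no_three_collinear n p \<longleftrightarrow>
     (\<forall>i<n. \<forall>j<n. \<forall>k<n. distinct [i, j, k] \<longrightarrow> det3 (p i) (p j) (p k) \<noteq> 0)"

text \<open>The cross product of two points is the normal vector of their line, and three lines are
  concurrent when their normals are dependent. The lines are spanned by disjoint pairs because,
  without collinear triples, straight edges with a common end meet nowhere else.\<close>

definition no_three_concurrent :: "nat \<Rightarrow> (nat \<Rightarrow> real ^ 3) \<Rightarrow> bool" where
  "no_three_concurrent n p \<longleftrightarrow>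
     (\<forall>a<n. \<forall>b<n. \<forall>c<n. \<forall>d<n. \<forall>x<n. \<forall>y<n. distinct [a, b, c, d, x, y] \<longrightarrow>
        det3 (cross3 (p a) (p b)) (cross3 (p c) (p d)) (cross3 (p x) (p y)) \<noteq> 0)"

text \<open>\<open>s i j\<close> chooses one of the two segments between the points \<open>i\<close>
  and \<open>j\<close>; by symmetry the choice does not depend on the order of the ends.\<close>

definition edge_signs :: "(nat \<Rightarrow> nat \<Rightarrow> real) \<Rightarrow> bool" where
  "edge_signs s \<longleftrightarrow> (\<forall>i j. (s i j = 1 \<or> s i j = -1) \<and> s j i = s i j)"

lemma finite_crossing_quads: "finite (crossing_quads n p s)"
  by (rule finite_subset[of _ "{..<n} \<times> {..<n} \<times> {..<n} \<times> {..<n}"]) (auto simp: crossing_quads_def)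

lemma two_edges_cases:
  assumes "card e = 2" "card f = 2" "e \<noteq> f"
  obtains a b d where "distinct [a, b, d]" "e = {a, b}" "f = {a, d}"
    | a b c d where "distinct [a, b, c, d]" "e = {a, b}" "f = {c, d}"
proof -
  obtain a b where e: "e = {a, b}" "a \<noteq> b" using assms(1) card_2_iff by metis
  obtain c d where f: "f = {c, d}" "c \<noteq> d" using assms(2) card_2_iff by metis
  consider "a = c" | "a = d" | "b = c" | "b = d" | "distinct [a, b, c, d]" using e f by auto
  then show thesis
  proof cases
    case 1 then show ?thesis using that(1)[of a b d] e f assms(3) by auto
  next
    case 2 then show ?thesis using that(1)[of a b c] e f assms(3) by auto
  next
    case 3 then show ?thesis using that(1)[of b a d] e f assms(3) by auto
  next
    case 4 then show ?thesis using that(1)[of b a c] e f assms(3) by auto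
  next
    case 5 then show ?thesis using that(2) e f by blast
  qed
qed

text \<open>Since two lines meet once, disjoint edges have at most one common point and adjacent
  edges only their common end. The two assumptions of general position keep vertices off the edges
  and exclude triple points. A crossing point yields eight quadruples, and different points yield
  different ones.\<close>

theorem geodesic_drawing:
  assumes n: "3 \<le> n" and gp3: "no_three_collinear n p" and gp6: "no_three_concurrent n p" and sg: "edge_signs s"
  defines "E \<equiv> {e. e \<subseteq> {..<n} \<and> card e = 2}"
  shows "\<exists>\<phi> \<gamma>. is_drawing projective_plane {..<n} E \<phi> \<gamma> \<and> 8 * card (crossings E \<gamma>) \<le> card (crossing_quads n p s)"
proof -
  have d3: "det3 (p i) (p j) (p k) \<noteq> 0" if "i < n" "j < n" "k < n" "distinct [i, j, k]" for i j k
    using gp3 that unfolding no_three_collinear_def by blast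
  have s1: "s i j = 1 \<or> s i j = -1" and ssym: "s j i = s i j" for i j
    using sg unfolding edge_signs_def by blast+
  have s0: "s i j \<noteq> 0" and ss: "s i j * s i j = 1" for i j using s1[of i j] by auto
  have third: "\<exists>k<n. distinct [i, j, k]" if "i < n" "j < n" "i \<noteq> j" for i j
  proof -
    have "\<not> {..<n} \<subseteq> {i, j}"
    proof
      assume "{..<n} \<subseteq> {i, j}"
      then have "card {..<n} \<le> card {i, j}" by (intro card_mono) auto
      then show False using n card_insert_le_m1[of 2 "{j}" i] by (simp add: card_insert_if split: if_splits)
    qed
    then show ?thesis using that by auto
  qed
  define q where "q v w = s v w *\<^sub>R p w" for v w
  define seg where "seg v w = proj_segment (p v) (q v w)" for v w
  define I where "I v w = open_proj_segment (p v) (q v w)" for v w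
  define \<phi> where "\<phi> v = proj (p v)" for v
  \<comment> \<open>The parametrization must be a function of the unordered edge, so it runs from
    the smaller to the larger index.\<close>
  define \<gamma> where "\<gamma> e = (\<lambda>t. proj ((1 - t) *\<^sub>R p (Min e) + t *\<^sub>R q (Min e) (Max e)))" for e
  have dq: "det3 (p v) (q v w) x = s v w * det3 (p v) (p w) x" for v w x by (simp add: q_def)
  have p0: "p v \<noteq> 0" if v: "v < n" for v
  proof -
    have "\<exists>w<n. w \<noteq> v" using n by (intro exI[of _ "if v = 0 then 1 else 0"]) auto
    then obtain w where w: "w < n" "w \<noteq> v" by blast
    obtain k where "k < n" "distinct [v, w, k]" using third[of v w] v w by auto
    then have "det3 (p v) (p w) (p k) \<noteq> 0" using d3 v w by blast
    then show ?thesis by auto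
  qed
  have seg_sym: "seg w v = seg v w" and I_sym: "I w v = I v w" for v w
  proof -
    have "open_proj_segment (p w) (- p v) = open_proj_segment (p v) (- p w)"
      using open_proj_segment_minus[of "p w" "- p v"] open_proj_segment_commute[of "- p w" "p v"] by simp
    then show "I w v = I v w"
      using s1[of v w] ssym[of v w] open_proj_segment_commute[of "p w" "p v"] by (auto simp: I_def q_def)
    have "proj (\<alpha> *\<^sub>R p w + \<beta> *\<^sub>R (- p v)) = proj (\<beta> *\<^sub>R p v + \<alpha> *\<^sub>R (- p w))" for \<alpha> \<beta>
      using proj_scale[of "-1" "\<alpha> *\<^sub>R p w + \<beta> *\<^sub>R (- p v)"] by (simp add: add.commute)
    then have "proj_segment (p w) (- p v) = proj_segment (p v) (- p w)"
      unfolding proj_segment_def by (metis (no_types, opaque_lifting) add.commute)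
    then show "seg w v = seg v w"
      using s1[of v w] ssym[of v w] proj_segment_commute[of "p w" "p v"] by (auto simp: seg_def q_def)
  qed
  have mm: "{Min {v, w}, Max {v, w}} = {v, w}" "Min {v, w} = v \<and> Max {v, w} = w \<or> Min {v, w} = w \<and> Max {v, w} = v"
    for v w :: nat by (auto simp: min_def max_def)
  have edge: "simple_arc_in projective_plane (\<gamma> {v, w})" "\<gamma> {v, w} ` {0..1} = seg v w"
      "edge_interior \<gamma> {v, w} = I v w" "{\<gamma> {v, w} 0, \<gamma> {v, w} 1} = \<phi> ` {v, w}"
    if vw: "v < n" "w < n" "v \<noteq> w" for v w
  proof -
    define v' where "v' = Min {v, w}"
    define w' where "w' = Max {v, w}"
    have m: "v' = v \<and> w' = w \<or> v' = w \<and> w' = v" using mm(2) unfolding v'_def w'_def .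
    then have vw': "v' < n" "w' < n" "v' \<noteq> w'" using vw by auto
    obtain k where k: "k < n" "distinct [v', w', k]" using third[OF vw'] by blast
    have D: "det3 (p v') (q v' w') (p k) \<noteq> 0" using d3[OF vw'(1,2) k] s0 by (simp add: dq)
    have g: "\<gamma> {v, w} = (\<lambda>t. proj ((1 - t) *\<^sub>R p v' + t *\<^sub>R q v' w'))" by (simp add: \<gamma>_def v'_def w'_def)
    show "simple_arc_in projective_plane (\<gamma> {v, w})" unfolding g by (rule proj_path(1)[OF D])
    have "\<gamma> {v, w} ` {0..1} = seg v' w'" unfolding g seg_def by (rule proj_path(2)[OF D])
    then show "\<gamma> {v, w} ` {0..1} = seg v w" using m seg_sym by metis
    have "edge_interior \<gamma> {v, w} = I v' w'" unfolding g I_def edge_interior_def by (rule proj_path(3)[OF D])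
    then show "edge_interior \<gamma> {v, w} = I v w" using m I_sym by metis
    have "\<gamma> {v, w} 0 = \<phi> v'" "\<gamma> {v, w} 1 = \<phi> w'" using proj_scale[OF s0] by (auto simp: g \<phi>_def q_def)
    then show "{\<gamma> {v, w} 0, \<gamma> {v, w} 1} = \<phi> ` {v, w}" using m by auto
  qed
  have Iseg: "I v w \<subseteq> seg v w" for v w unfolding I_def seg_def by (rule open_proj_segment_subset)
  have adj: "r = \<phi> a" if "distinct [a, b, d]" "a < n" "b < n" "d < n" "r \<in> seg a b" "r \<in> seg a d" for a b d r
    using proj_segments_common_end[of "p a" "q a b" "q a d" r] d3[of a b d] that s0
    by (auto simp: seg_def q_def \<phi>_def)
  have endI: "\<phi> a \<notin> I a b" if ab: "a < n" "b < n" "a \<noteq> b" for a b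
  proof -
    obtain k where k: "k < n" "distinct [a, b, k]" using third[OF ab] by blast
    then have "det3 (p a) (q a b) (p k) \<noteq> 0" using d3[of a b k] that s0 by (simp add: dq)
    from proj_end_notin_open_segment[OF this] show ?thesis by (simp add: I_def \<phi>_def)
  qed
  have adjI: False if "distinct [a, b, d]" "a < n" "b < n" "d < n" "r \<in> I a b" "r \<in> I a d" for a b d r
    using adj[OF that(1-4)] that(5,6) Iseg endI[of a b] that(1-3) by (metis distinct_length_2_or_more subsetD)
  have vtx: "\<phi> k \<notin> seg a b" if "distinct [a, b, k]" "a < n" "b < n" "k < n" for a b k
    using proj_notin_segment[of "p a" "q a b" "p k"] d3[of a b k] that s0 by (simp add: seg_def \<phi>_def dq)
  have dets: "det3 (p a) (q a b) (p c) \<noteq> 0" "det3 (p a) (q a b) (q c d) \<noteq> 0" "det3 (p c) (q c d) (p a) \<noteq> 0"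
      "det3 (p c) (q c d) (q a b) \<noteq> 0"
    if "distinct [a, b, c, d]" "a < n" "b < n" "c < n" "d < n" for a b c d
  proof -
    have di: "distinct [a, b, c]" "distinct [a, b, d]" "distinct [c, d, a]" "distinct [c, d, b]" using that(1) by auto
    show "det3 (p a) (q a b) (p c) \<noteq> 0" "det3 (p a) (q a b) (q c d) \<noteq> 0" "det3 (p c) (q c d) (p a) \<noteq> 0"
      "det3 (p c) (q c d) (q a b) \<noteq> 0"
      using d3[OF that(2,3,4) di(1)] d3[OF that(2,3,5) di(2)] d3[OF that(4,5,2) di(3)] d3[OF that(4,5,3) di(4)]
        s0[of a b] s0[of c d] by (simp_all add: q_def)
  qed
  have meet: "r = proj (det3 (p a) (q a b) (q c d) *\<^sub>R p c - det3 (p a) (q a b) (p c) *\<^sub>R q c d)"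
    if "distinct [a, b, c, d]" "a < n" "b < n" "c < n" "d < n" "r \<in> seg a b" "r \<in> seg c d" for a b c d r
    using proj_segments_meet(1)[OF dets(1-3)[OF that(1-5)]] that(6,7) by (simp add: seg_def)
  have half: "det3 (p a) (p b) (p c) * det3 (p a) (p b) (p d) * s c d < 0"
    if "distinct [a, b, c, d]" "a < n" "b < n" "c < n" "d < n" "r \<in> I a b" "r \<in> I c d" for a b c d r
  proof -
    have "det3 (p a) (q a b) (p c) * det3 (p a) (q a b) (q c d) < 0"
      using proj_segments_meet(2)[OF dets(1-3)[OF that(1-5)], of r] that(6,7) Iseg[of a b] Iseg[of c d]
      by (auto simp: seg_def I_def)
    then have "(s a b * s a b) * (det3 (p a) (p b) (p c) * det3 (p a) (p b) (p d) * s c d) < 0"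
      by (simp add: q_def algebra_simps)
    then show ?thesis using ss[of a b] by simp
  qed
  have crossI: "crosses p s a b c d" if "distinct [a, b, c, d]" "a < n" "b < n" "c < n" "d < n" "r \<in> I a b" "r \<in> I c d" for a b c d r
    using half[of a b c d r] half[of c d a b r] that unfolding crosses_def by auto
  have Ecard: "card e = 2" "e \<subseteq> {..<n}" if "e \<in> E" for e using that by (auto simp: E_def)
  have Eobt: "\<exists>v w. e = {v, w} \<and> v < n \<and> w < n \<and> v \<noteq> w" if e: "e \<in> E" for e
  proof -
    obtain v w where "e = {v, w}" "v \<noteq> w" using Ecard(1)[OF e] card_2_iff by metis
    then show ?thesis using Ecard(2)[OF e] by auto
  qed
  have disj: "\<exists>a b c d. distinct [a, b, c, d] \<and> e = {a, b} \<and> f = {c, d} \<and> a < n \<and> b < n \<and> c < n \<and> d < n \<and> r \<in> I a b \<and> r \<in> I c d"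
    if ef: "e \<in> E" "f \<in> E" "e \<noteq> f" "r \<in> edge_interior \<gamma> e" "r \<in> edge_interior \<gamma> f" for e f r
  proof (rule two_edges_cases[OF Ecard(1)[OF ef(1)] Ecard(1)[OF ef(2)] ef(3)])
    fix a b d assume *: "distinct [a, b, d]" "e = {a, b}" "f = {a, d}"
    then have lt: "a < n" "b < n" "d < n" using Ecard(2)[OF ef(1)] Ecard(2)[OF ef(2)] by auto
    then have "r \<in> I a b" "r \<in> I a d" using edge(3)[of a b] edge(3)[of a d] ef * by auto
    then show ?thesis using adjI[OF *(1) lt] by blast
  next
    fix a b c d assume *: "distinct [a, b, c, d]" "e = {a, b}" "f = {c, d}"
    then have lt: "a < n" "b < n" "c < n" "d < n" using Ecard(2)[OF ef(1)] Ecard(2)[OF ef(2)] by auto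
    then have "r \<in> I a b" "r \<in> I c d" using edge(3)[of a b] edge(3)[of c d] ef * by auto
    then show ?thesis using * lt by blast
  qed
  have disjoint: "e \<inter> f = {}"
    if ef: "e \<in> E" "f \<in> E" "e \<noteq> f" "r \<in> edge_interior \<gamma> e" "r \<in> edge_interior \<gamma> f" for e f r
  proof -
    obtain a b c d where "distinct [a, b, c, d]" "e = {a, b}" "f = {c, d}" using disj[OF ef] by blast
    then show ?thesis by auto
  qed
  \<comment> \<open>A vector on a line is orthogonal to its normal, so a common point of three edges
    would give a nonzero vector orthogonal to three independent normals.\<close>
  have perp: "cross3 (p a) (p b) \<bullet> x = 0" if ab: "proj x \<in> I a b" "x \<noteq> 0" "a < n" "b < n" "a \<noteq> b" for a b x
  proof -
    obtain k where k: "k < n" "distinct [a, b, k]" using third[OF ab(3-5)] by blast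
    then have D: "det3 (p a) (q a b) (p k) \<noteq> 0" using d3[of a b k] that s0 by (simp add: dq)
    have "proj x \<in> proj_segment (p a) (q a b)" using that(1) Iseg by (auto simp: seg_def)
    then have "det3 (p a) (q a b) x = 0" using proj_in_segments_iff[OF D that(2)] by blast
    then show ?thesis using s0[of a b] by (simp add: dq) (simp add: det3_def)
  qed
  have triple: False if efg: "e \<in> E" "f \<in> E" "g \<in> E" "e \<noteq> f" "e \<noteq> g" "f \<noteq> g"
    "r \<in> edge_interior \<gamma> e" "r \<in> edge_interior \<gamma> f" "r \<in> edge_interior \<gamma> g" for e f g r
  proof -
    obtain a b c d where 1: "distinct [a, b, c, d]" "e = {a, b}" "f = {c, d}" "a < n" "b < n" "c < n" "d < n" "r \<in> I a b" "r \<in> I c d"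
      using disj[of e f r] efg by blast
    obtain x y where 2: "g = {x, y}" "x < n" "y < n" "x \<noteq> y" using Eobt[OF efg(3)] by blast
    have rg: "r \<in> I x y" using efg(9) edge(3)[OF 2(2-4)] 2(1) by simp
    have "e \<inter> g = {}" "f \<inter> g = {}"
      using disjoint[of e g r] disjoint[of f g r] efg by blast+
    then have dist: "distinct [a, b, c, d, x, y]" using 1 2 by auto
    obtain \<alpha> \<beta> where ab: "0 < \<alpha>" "0 < \<beta>" "r = proj (\<alpha> *\<^sub>R p a + \<beta> *\<^sub>R q a b)"
      using 1(8) unfolding I_def open_proj_segment_def by blast
    define z where "z = \<alpha> *\<^sub>R p a + \<beta> *\<^sub>R q a b"
    have z0: "z \<noteq> 0" unfolding z_def using ab dets(1)[OF 1(1,4-7)]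
      by (intro linear_combination_nonzero[of _ _ "p c"]) auto
    have "cross3 (p a) (p b) \<bullet> z = 0" "cross3 (p c) (p d) \<bullet> z = 0" "cross3 (p x) (p y) \<bullet> z = 0"
      using perp[of z] z0 1 2 rg ab(3) unfolding z_def[symmetric] by auto
    moreover have "det3 (cross3 (p a) (p b)) (cross3 (p c) (p d)) (cross3 (p x) (p y)) \<noteq> 0"
      using gp6 dist 1 2 unfolding no_three_concurrent_def by blast
    ultimately show False using det3_orthogonal_zero z0 by blast
  qed
  have inj\<phi>: "inj_on \<phi> {..<n}"
  proof (rule inj_onI, rule ccontr)
    fix v w assume vw: "v \<in> {..<n}" "w \<in> {..<n}" "\<phi> v = \<phi> w" "v \<noteq> w"
    then obtain k where k: "k < n" "distinct [v, w, k]" using third[of v w] by auto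
    obtain c where "p v = c *\<^sub>R p w" using vw p0 proj_eq_iff[of "p v" "p w"] by (auto simp: \<phi>_def)
    then have "det3 (p v) (p w) (p k) = 0" by simp
    then show False using d3[of v w k] k vw by simp
  qed
  have draw: "is_drawing projective_plane {..<n} E \<phi> \<gamma>"
    unfolding is_drawing_def
  proof (intro conjI ballI impI)
    show "\<phi> ` {..<n} \<subseteq> topspace projective_plane" using proj_in_topspace p0 by (auto simp: \<phi>_def)
    show "inj_on \<phi> {..<n}" by (rule inj\<phi>)
    fix e assume e: "e \<in> E"
    then obtain v w where vw: "e = {v, w}" "v < n" "w < n" "v \<noteq> w" using Eobt by blast
    show "simple_arc_in projective_plane (\<gamma> e)" "{\<gamma> e 0, \<gamma> e 1} = \<phi> ` e"
      unfolding vw(1) by (rule edge[OF vw(2-4)])+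
    show "edge_interior \<gamma> e \<inter> \<phi> ` {..<n} = {}"
    proof -
      have "\<phi> k \<notin> I v w" if "k < n" for k
      proof -
        consider "k = v" | "k = w" | "distinct [v, w, k]" using vw by auto
        then show ?thesis
        proof cases
          case 1 then show ?thesis using endI vw by simp
        next
          case 2 then show ?thesis using endI[of w v] I_sym[of v w] vw by simp
        next
          case 3 then show ?thesis using vtx[of v w k] Iseg[of v w] vw that by blast
        qed
      qed
      then show ?thesis unfolding vw(1) edge(3)[OF vw(2-4)] by auto
    qed
    fix f assume f: "f \<in> E"
    {
      assume ne: "e \<noteq> f"
      show "finite (\<gamma> e ` {0..1} \<inter> \<gamma> f ` {0..1})"
      proof (rule two_edges_cases[OF Ecard(1)[OF e] Ecard(1)[OF f] ne])
        fix a b d assume *: "distinct [a, b, d]" "e = {a, b}" "f = {a, d}"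
        then have lt: "a < n" "b < n" "d < n" using Ecard(2)[OF e] Ecard(2)[OF f] by auto
        then have "\<gamma> e ` {0..1} \<inter> \<gamma> f ` {0..1} \<subseteq> {\<phi> a}"
          using edge(2)[of a b] edge(2)[of a d] adj[OF *(1) lt] * by auto
        then show ?thesis using finite_subset by blast
      next
        fix a b c d assume *: "distinct [a, b, c, d]" "e = {a, b}" "f = {c, d}"
        then have lt: "a < n" "b < n" "c < n" "d < n" using Ecard(2)[OF e] Ecard(2)[OF f] by auto
        then have "\<gamma> e ` {0..1} \<inter> \<gamma> f ` {0..1} \<subseteq>
            {proj (det3 (p a) (q a b) (q c d) *\<^sub>R p c - det3 (p a) (q a b) (p c) *\<^sub>R q c d)}"
          using edge(2)[of a b] edge(2)[of c d] meet[OF *(1) lt] * by auto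
        then show ?thesis using finite_subset by blast
      qed
    next
      fix r assume ne: "e \<noteq> f" and r: "r \<in> edge_interior \<gamma> e \<inter> edge_interior \<gamma> f"
      then obtain a b c d where 1: "distinct [a, b, c, d]" "e = {a, b}" "f = {c, d}" "a < n" "b < n" "c < n" "d < n" "r \<in> I a b" "r \<in> I c d"
        using disj[OF e f ne] by blast
      have "cross_transversally_at projective_plane (seg a b) (seg c d) r"
        using cross_transversally_proj_segments[OF dets[OF 1(1,4-7)]] 1(8,9) by (simp add: seg_def I_def)
      then show "cross_transversally_at projective_plane (\<gamma> e ` {0..1}) (\<gamma> f ` {0..1}) r"
        using edge(2)[of a b] edge(2)[of c d] 1 by simp
    next
      fix g assume "g \<in> E" "e \<noteq> f \<and> e \<noteq> g \<and> f \<noteq> g"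
      then show "edge_interior \<gamma> e \<inter> edge_interior \<gamma> f \<inter> edge_interior \<gamma> g = {}"
        using triple[OF e f] by blast
    }
  qed
  \<comment> \<open>Two disjoint edges determine their common point, so these sets are disjoint for
    different \<open>r\<close>; over a crossing each contains the eight reorderings of one
    quadruple.\<close>
  define Q where "Q r = {(a, b, c, d). a < n \<and> b < n \<and> c < n \<and> d < n \<and> distinct [a, b, c, d] \<and> r \<in> I a b \<and> r \<in> I c d}" for r
  have Qsub: "Q r \<subseteq> crossing_quads n p s" for r
    using crossI unfolding Q_def crossing_quads_def by blast
  have finQ: "finite (Q r)" for r using finite_subset[OF Qsub finite_crossing_quads] .
  have Qdisj: "Q r \<inter> Q r' = {}" if "r \<noteq> r'" for r r'
  proof (rule ccontr)
    assume "Q r \<inter> Q r' \<noteq> {}"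
    then obtain a b c d where "distinct [a, b, c, d]" "a < n" "b < n" "c < n" "d < n" "r \<in> I a b" "r \<in> I c d" "r' \<in> I a b" "r' \<in> I c d"
      unfolding Q_def by blast
    then have "r = r'" using meet[of a b c d r] meet[of a b c d r'] Iseg by (metis subsetD)
    then show False using that by simp
  qed
  have Qcard: "8 \<le> card (Q r)" if "r \<in> crossings E \<gamma>" for r
  proof -
    obtain e f where "e \<in> E" "f \<in> E" "e \<noteq> f" "r \<in> edge_interior \<gamma> e" "r \<in> edge_interior \<gamma> f"
      using \<open>r \<in> crossings E \<gamma>\<close> unfolding crossings_def by blast
    then obtain a b c d where 1: "distinct [a, b, c, d]" "a < n" "b < n" "c < n" "d < n" "r \<in> I a b" "r \<in> I c d"
      using disj[of e f r] by blast
    define S where "S = {(a, b, c, d), (b, a, c, d), (a, b, d, c), (b, a, d, c), (c, d, a, b), (d, c, a, b), (c, d, b, a), (d, c, b, a)}"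
    have "S \<subseteq> Q r" using 1 I_sym[of a b] I_sym[of c d] unfolding Q_def S_def by auto
    moreover have "card S = 8" using 1(1) by (simp add: S_def card_insert_if)
    ultimately show ?thesis using card_mono[OF finQ] by metis
  qed
  have "8 * card (crossings E \<gamma>) \<le> card (crossing_quads n p s)"
  proof (cases "finite (crossings E \<gamma>)")
    case True
    have "8 * card (crossings E \<gamma>) = (\<Sum>r \<in> crossings E \<gamma>. 8)" by simp
    also have "\<dots> \<le> (\<Sum>r \<in> crossings E \<gamma>. card (Q r))" by (rule sum_mono[OF Qcard])
    also have "\<dots> = card (\<Union>r \<in> crossings E \<gamma>. Q r)"
      using card_UN_disjoint[OF True, of Q] finQ Qdisj by simp
    also have "\<dots> \<le> card (crossing_quads n p s)"
      using Qsub by (intro card_mono finite_crossing_quads) blast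
    finally show ?thesis .
  qed simp
  then show ?thesis using draw by blast
qed

section \<open>Doubling the points\<close>

text \<open>\<open>p i\<close> and \<open>d i\<close> span a line through the point
  \<open>i\<close>, and the sign of the product tells on which side of it the edge to
  \<open>j\<close> leaves. Of the \<open>n - 1\<close> edges at \<open>i\<close>,
  \<open>n / 2\<close> leave on the positive side and \<open>n / 2 - 1\<close> on the other: the
  most even split, with \<open>n\<close> forced to be even.\<close>

definition halving_directions :: "nat \<Rightarrow> (nat \<Rightarrow> real ^ 3) \<Rightarrow> (nat \<Rightarrow> nat \<Rightarrow> real) \<Rightarrow> (nat \<Rightarrow> real ^ 3) \<Rightarrow> bool" where
  "halving_directions n p s d \<longleftrightarrow>
     (\<forall>i<n. (\<forall>j<n. j \<noteq> i \<longrightarrow> det3 (p i) (d i) (p j) \<noteq> 0) \<and>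
        2 * card {j. j < n \<and> j \<noteq> i \<and> 0 < s i j * det3 (p i) (d i) (p j)} = n)"

text \<open>Crossings depend only on the orientation signs of triples and on the edge signs, and
  nonzero orientations survive small perturbations.\<close>

lemma crosses_sgn:
  "crosses p s a b c d \<longleftrightarrow>
     sgn (det3 (p a) (p b) (p c)) * sgn (det3 (p a) (p b) (p d)) * s c d < 0 \<and>
     sgn (det3 (p c) (p d) (p a)) * sgn (det3 (p c) (p d) (p b)) * s a b < 0"
proof -
  have "x * y * z < 0 \<longleftrightarrow> sgn x * sgn y * z < 0" for x y z :: real
    by (auto simp: sgn_if mult_less_0_iff zero_less_mult_iff)
  then show ?thesis unfolding crosses_def by blast
qed

lemma eventually_sgn_eq:
  fixes f :: "'a \<Rightarrow> real"
  assumes "(f \<longlongrightarrow> l) F" "l \<noteq> 0"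
  shows "eventually (\<lambda>x. sgn (f x) = sgn l) F"
proof (cases "l > 0")
  case True
  then have "eventually (\<lambda>x. 0 < f x) F" using order_tendstoD(1)[OF assms(1)] by blast
  then show ?thesis by eventually_elim (use True in simp)
next
  case False
  then have "eventually (\<lambda>x. f x < 0) F" using order_tendstoD(2)[OF assms(1), of 0] assms(2) by simp
  then show ?thesis by eventually_elim (use False assms(2) in simp)
qed

section \<open>Numbering of twins: the points 2 a and 2 a + 1 replace the point a\<close>

lemma same_half: "x div 2 = y div 2 \<Longrightarrow> v div 2 = x div 2 \<Longrightarrow> x = y \<or> v = x \<or> v = (y :: nat)"
proof -
  assume "x div 2 = y div 2" "v div 2 = x div 2"
  moreover have "t = 2 * (t div 2) + t mod 2" "t mod 2 = 0 \<or> t mod 2 = 1" for t :: nat by auto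
  ultimately show ?thesis by metis
qed

lemma parity_cases: "x = 2 * (x div 2) \<or> x = Suc (2 * (x div 2))" for x :: nat
  by (metis even_two_times_div_two odd_two_times_div_two_succ Suc_eq_plus1)

lemma halves_twins:
  assumes "x \<noteq> y" "x div 2 = y div 2"
  shows "x = 2 * (x div 2) \<and> y = Suc (2 * (x div 2)) \<or> x = Suc (2 * (x div 2)) \<and> y = 2 * (x div 2)"
  using parity_cases[of x] parity_cases[of y] assms by metis

lemma card_halves:
  assumes "finite S"
  shows "card {y. y div 2 \<in> S} = 2 * card (S :: nat set)"
proof -
  have "{y. y div 2 \<in> S} = (\<lambda>b. 2 * b) ` S \<union> (\<lambda>b. 2 * b + 1) ` S"
  proof (intro set_eqI iffI)
    fix y assume "y \<in> {y. y div 2 \<in> S}"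
    moreover have "y = 2 * (y div 2) \<or> y = 2 * (y div 2) + 1" using parity_cases[of y] by simp
    ultimately show "y \<in> (\<lambda>b. 2 * b) ` S \<union> (\<lambda>b. 2 * b + 1) ` S" by blast
  qed auto
  moreover have "card ((\<lambda>b. 2 * b) ` S \<union> (\<lambda>b. 2 * b + 1) ` S) = card ((\<lambda>b. 2 * b) ` S) + card ((\<lambda>b. 2 * b + 1) ` S)"
  proof (rule card_Un_disjoint)
    show "(\<lambda>b. 2 * b) ` S \<inter> (\<lambda>b. 2 * b + 1) ` S = {}"
    proof (rule ccontr)
      assume "(\<lambda>b. 2 * b) ` S \<inter> (\<lambda>b. 2 * b + 1) ` S \<noteq> {}"
      then obtain b c where "2 * b = 2 * c + (1 :: nat)" by blast
      then have "even (2 * c + (1 :: nat))" by (metis dvd_triv_left)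
      then show False by simp
    qed
  qed (use assms in auto)
  moreover have "card ((\<lambda>b. 2 * b) ` S) = card S" "card ((\<lambda>b. 2 * b + 1) ` S) = card S"
    by (auto intro!: card_image inj_onI)
  ultimately show ?thesis by simp
qed

lemma card_halves2:
  assumes "finite S"
  shows "card {(y, w). (y div 2, w div 2) \<in> S} \<le> 4 * card (S :: (nat \<times> nat) set)"
    and "finite {(y, w). (y div 2, w div 2) \<in> S}"
proof -
  let ?f = "\<lambda>((b, d), i, j). (2 * b + i, 2 * d + j) :: nat \<times> nat"
  have fin: "finite (S \<times> {0, 1 :: nat} \<times> {0, 1 :: nat})" using assms by simp
  have sub: "{(y, w). (y div 2, w div 2) \<in> S} \<subseteq> ?f ` (S \<times> {0, 1} \<times> {0, 1})"
  proof
    fix q assume "q \<in> {(y, w). (y div 2, w div 2) \<in> S}"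
    then obtain y w where q: "q = (y, w)" "(y div 2, w div 2) \<in> S" by blast
    have "q = ?f ((y div 2, w div 2), y mod 2, w mod 2)" using q by simp
    moreover have "((y div 2, w div 2), y mod 2, w mod 2) \<in> S \<times> {0, 1} \<times> {0, 1}" using q by auto
    ultimately show "q \<in> ?f ` (S \<times> {0, 1} \<times> {0, 1})" by (rule image_eqI)
  qed
  show "finite {(y, w). (y div 2, w div 2) \<in> S}" by (rule finite_subset[OF sub]) (use fin in blast)
  have "card {(y, w). (y div 2, w div 2) \<in> S} \<le> card (S \<times> {0, 1 :: nat} \<times> {0, 1 :: nat})"
    by (rule surj_card_le[OF fin sub])
  then show "card {(y, w). (y div 2, w div 2) \<in> S} \<le> 4 * card S" by (simp add: card_cartesian_product)
qed

lemma card_halves4: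
  assumes "finite S"
  shows "card {(x, y, z, w). (x div 2, y div 2, z div 2, w div 2) \<in> S} \<le> 16 * card (S :: (nat \<times> nat \<times> nat \<times> nat) set)"
    and "finite {(x, y, z, w). (x div 2, y div 2, z div 2, w div 2) \<in> S}"
proof -
  let ?f = "\<lambda>((a, b, c, d), i, j, k, l). (2 * a + i, 2 * b + j, 2 * c + k, 2 * d + l) :: nat \<times> nat \<times> nat \<times> nat"
  let ?B = "{0, 1 :: nat} \<times> {0, 1 :: nat} \<times> {0, 1 :: nat} \<times> {0, 1 :: nat}"
  have fin: "finite (S \<times> ?B)" using assms by simp
  have sub: "{(x, y, z, w). (x div 2, y div 2, z div 2, w div 2) \<in> S} \<subseteq> ?f ` (S \<times> ?B)"
  proof
    fix q assume "q \<in> {(x, y, z, w). (x div 2, y div 2, z div 2, w div 2) \<in> S}"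
    then obtain x y z w where q: "q = (x, y, z, w)" "(x div 2, y div 2, z div 2, w div 2) \<in> S" by blast
    have "q = ?f ((x div 2, y div 2, z div 2, w div 2), x mod 2, y mod 2, z mod 2, w mod 2)" using q by simp
    moreover have "((x div 2, y div 2, z div 2, w div 2), x mod 2, y mod 2, z mod 2, w mod 2) \<in> S \<times> ?B"
      by (intro SigmaI q(2)) auto
    ultimately show "q \<in> ?f ` (S \<times> ?B)" by (rule image_eqI)
  qed
  show "finite {(x, y, z, w). (x div 2, y div 2, z div 2, w div 2) \<in> S}" by (rule finite_subset[OF sub]) (use fin in blast)
  have "card {(x, y, z, w). (x div 2, y div 2, z div 2, w div 2) \<in> S} \<le> card (S \<times> ?B)"
    by (rule surj_card_le[OF fin sub])
  then show "card {(x, y, z, w). (x div 2, y div 2, z div 2, w div 2) \<in> S} \<le> 16 * card S" by (simp add: card_cartesian_product)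
qed

lemma crosses_swap:
  assumes "edge_signs s"
  shows "crosses p s b a c d \<longleftrightarrow> crosses p s a b c d" "crosses p s a b d c \<longleftrightarrow> crosses p s a b c d"
proof -
  have s: "s b a = s a b" "s d c = s c d" using assms by (auto simp: edge_signs_def)
  show "crosses p s b a c d \<longleftrightarrow> crosses p s a b c d"
    unfolding crosses_def det3_swap(1)[of "p b" "p a"] by (simp add: s mult.commute)
  show "crosses p s a b d c \<longleftrightarrow> crosses p s a b c d"
    unfolding crosses_def det3_swap(1)[of "p d" "p c"] by (simp add: s mult.commute)
qed

lemma ordered_pairs_card:
  assumes "finite L"
  shows "card {(b, d). b \<in> L \<and> d \<in> L \<and> b \<noteq> d} = card L * (card L - 1)"
proof -
  have "{(b, d). b \<in> L \<and> d \<in> L \<and> b \<noteq> d} = (SIGMA b : L. L - {b})" by auto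
  then show ?thesis using assms by (simp add: card_SigmaI)
qed

lemma card_reindex_quads:
  assumes "finite B"
  shows "card {(x, y, v, w). (y, x, v, w) \<in> B} \<le> card B" "finite {(x, y, v, w). (y, x, v, w) \<in> B}"
    "card {(x, y, v, w). (x, y, w, v) \<in> B} \<le> card B" "finite {(x, y, v, w). (x, y, w, v) \<in> B}"
    "card {(x, y, v, w). (y, x, w, v) \<in> B} \<le> card B" "finite {(x, y, v, w). (y, x, w, v) \<in> B}"
proof -
  have 1: "{(x, y, v, w). (y, x, v, w) \<in> B} \<subseteq> (\<lambda>(x, y, v, w). (y, x, v, w)) ` B"
    "{(x, y, v, w). (x, y, w, v) \<in> B} \<subseteq> (\<lambda>(x, y, v, w). (x, y, w, v)) ` B"
    "{(x, y, v, w). (y, x, w, v) \<in> B} \<subseteq> (\<lambda>(x, y, v, w). (y, x, w, v)) ` B"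
    by force+
  show "card {(x, y, v, w). (y, x, v, w) \<in> B} \<le> card B" "finite {(x, y, v, w). (y, x, v, w) \<in> B}"
    using surj_card_le[OF assms 1(1)] finite_subset[OF 1(1)] assms by auto
  show "card {(x, y, v, w). (x, y, w, v) \<in> B} \<le> card B" "finite {(x, y, v, w). (x, y, w, v) \<in> B}"
    using surj_card_le[OF assms 1(2)] finite_subset[OF 1(2)] assms by auto
  show "card {(x, y, v, w). (y, x, w, v) \<in> B} \<le> card B" "finite {(x, y, v, w). (y, x, w, v) \<in> B}"
    using surj_card_le[OF assms 1(3)] finite_subset[OF 1(3)] assms by auto
qed

text \<open>The point \<open>a\<close> is replaced by \<open>p a\<close> and
  \<open>p a + \<epsilon> *\<^sub>R d a\<close>. Crossing quadruples are sorted by the old points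
  below them: four different ones give at most 16 quadruples over each old crossing quadruple; one
  pair of twins on different edges is controlled by the halving; two pairs of twins on different
  edges give the last term. All three terms count quadruples, eight for each crossing.\<close>

theorem doubling:
  assumes n: "2 \<le> n" and gp3: "no_three_collinear n p" and sg: "edge_signs s" and hv: "halving_directions n p s d"
  shows "\<exists>p' s' d'. no_three_collinear (2 * n) p' \<and> edge_signs s' \<and> halving_directions (2 * n) p' s' d' \<and>
    card (crossing_quads (2 * n) p' s') \<le> 16 * card (crossing_quads n p s) + 8 * n * (n - 2)\<^sup>2 + 4 * n * (n - 1)"
proof -
  have gp: "det3 (p i) (p j) (p k) \<noteq> 0" if "i < n" "j < n" "k < n" "distinct [i, j, k]" for i j k
    using gp3 that unfolding no_three_collinear_def by blast
  have dd: "det3 (p i) (d i) (p j) \<noteq> 0" if "i < n" "j < n" "j \<noteq> i" for i j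
    using hv that unfolding halving_directions_def by blast
  have hvL: "2 * card {j. j < n \<and> j \<noteq> i \<and> 0 < s i j * det3 (p i) (d i) (p j)} = n" if "i < n" for i
    using hv that unfolding halving_directions_def by blast
  have s1: "s i j = 1 \<or> s i j = -1" and ssym: "s j i = s i j" for i j
    using sg unfolding edge_signs_def by blast+
  have "\<exists>z. i < n \<longrightarrow> det3 (p i) (d i) z = 1" for i
  proof (cases "i < n")
    case True
    have "(if i = 0 then 1 else 0) < n" "(if i = 0 then 1 else 0) \<noteq> i" using n by auto
    then obtain j where "j < n" "j \<noteq> i" by blast
    then have "det3 (p i) (d i) (p j) \<noteq> 0" using dd True by blast
    then have "det3 (p i) (d i) ((1 / det3 (p i) (d i) (p j)) *\<^sub>R p j) = 1" by simp
    then show ?thesis by blast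
  qed auto
  \<comment> \<open>A vector off the line of \<open>p i\<close> and \<open>d i\<close>, scaled to
    determinant 1; the new directions are \<open>d i\<close> tilted along it.\<close>
  then obtain z where z: "\<And>i. i < n \<Longrightarrow> det3 (p i) (d i) (z i) = 1" by metis
  define P where "P \<epsilon> x = (if even x then p (x div 2) else p (x div 2) + \<epsilon> *\<^sub>R d (x div 2))" for \<epsilon> and x :: nat
  \<comment> \<open>The opposite tilts make each twin see the other on its negative side, which is
    the side with one point fewer. After doubling, the sides have \<open>n\<close> and
    \<open>n - 2 + 1\<close> points, as required for \<open>2 * n\<close> points.\<close>
  define D where "D \<epsilon> x = (if even x then d (x div 2) + \<epsilon> *\<^sub>R z (x div 2) else d (x div 2) - \<epsilon> *\<^sub>R z (x div 2))" for \<epsilon> and x :: nat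
  define s' where "s' x y = (if x div 2 = y div 2 then 1 else s (x div 2) (y div 2))" for x y :: nat
  have limP: "((\<lambda>\<epsilon>. P \<epsilon> x) \<longlongrightarrow> p (x div 2)) (at_right 0)" for x
  proof -
    have "((\<lambda>\<epsilon>. p (x div 2) + \<epsilon> *\<^sub>R d (x div 2)) \<longlongrightarrow> p (x div 2) + 0 *\<^sub>R d (x div 2)) (at_right 0)"
      by (intro tendsto_intros)
    then show ?thesis by (cases "even x") (simp_all add: P_def)
  qed
  have limD: "((\<lambda>\<epsilon>. D \<epsilon> x) \<longlongrightarrow> d (x div 2)) (at_right 0)" for x
  proof -
    have "((\<lambda>\<epsilon>. d (x div 2) + \<epsilon> *\<^sub>R z (x div 2)) \<longlongrightarrow> d (x div 2) + 0 *\<^sub>R z (x div 2)) (at_right 0)"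
      "((\<lambda>\<epsilon>. d (x div 2) - \<epsilon> *\<^sub>R z (x div 2)) \<longlongrightarrow> d (x div 2) - 0 *\<^sub>R z (x div 2)) (at_right 0)"
      by (intro tendsto_intros)+
    then show ?thesis by (cases "even x") (simp_all add: D_def)
  qed
  define N where "N = {..<2 * n}"
  have finN: "finite N" by (simp add: N_def)
  have half: "x div 2 < n" if "x \<in> N" for x using that by (auto simp: N_def)
  \<comment> \<open>Finitely many determinants have a nonzero limit, so a small
    \<open>\<epsilon>\<close> keeps all their signs. Determinants that contain two twins tend to 0
    and are computed exactly further on.\<close>
  have "eventually (\<lambda>\<epsilon>. \<forall>t \<in> N \<times> N \<times> N. case t of (x, y, w) \<Rightarrow> distinct [x div 2, y div 2, w div 2] \<longrightarrow>
      sgn (det3 (P \<epsilon> x) (P \<epsilon> y) (P \<epsilon> w)) = sgn (det3 (p (x div 2)) (p (y div 2)) (p (w div 2)))) (at_right 0)"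
  proof (rule eventually_ball_finite)
    show "\<forall>t \<in> N \<times> N \<times> N. \<forall>\<^sub>F \<epsilon> in at_right 0. case t of (x, y, w) \<Rightarrow> distinct [x div 2, y div 2, w div 2] \<longrightarrow>
      sgn (det3 (P \<epsilon> x) (P \<epsilon> y) (P \<epsilon> w)) = sgn (det3 (p (x div 2)) (p (y div 2)) (p (w div 2)))"
    proof clarify
      fix x y w assume xyw: "x \<in> N" "y \<in> N" "w \<in> N"
      show "\<forall>\<^sub>F \<epsilon> in at_right 0. distinct [x div 2, y div 2, w div 2] \<longrightarrow>
        sgn (det3 (P \<epsilon> x) (P \<epsilon> y) (P \<epsilon> w)) = sgn (det3 (p (x div 2)) (p (y div 2)) (p (w div 2)))"
      proof (cases "distinct [x div 2, y div 2, w div 2]")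
        case True
        have "\<forall>\<^sub>F \<epsilon> in at_right 0. sgn (det3 (P \<epsilon> x) (P \<epsilon> y) (P \<epsilon> w)) = sgn (det3 (p (x div 2)) (p (y div 2)) (p (w div 2)))"
          using gp[OF half[OF xyw(1)] half[OF xyw(2)] half[OF xyw(3)] True]
          by (intro eventually_sgn_eq tendsto_det3 limP)
        then show ?thesis by eventually_elim simp
      next
        case False then show ?thesis by auto
      qed
    qed
  qed (use finN in simp)
  moreover have "eventually (\<lambda>\<epsilon>. \<forall>t \<in> N \<times> N. case t of (x, y) \<Rightarrow> x div 2 \<noteq> y div 2 \<longrightarrow>
      sgn (det3 (p (x div 2)) (d (x div 2)) (P \<epsilon> y)) = sgn (det3 (p (x div 2)) (d (x div 2)) (p (y div 2))) \<and>
      sgn (det3 (P \<epsilon> x) (D \<epsilon> x) (P \<epsilon> y)) = sgn (det3 (p (x div 2)) (d (x div 2)) (p (y div 2)))) (at_right 0)"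
  proof (rule eventually_ball_finite)
    show "\<forall>t \<in> N \<times> N. \<forall>\<^sub>F \<epsilon> in at_right 0. case t of (x, y) \<Rightarrow> x div 2 \<noteq> y div 2 \<longrightarrow>
      sgn (det3 (p (x div 2)) (d (x div 2)) (P \<epsilon> y)) = sgn (det3 (p (x div 2)) (d (x div 2)) (p (y div 2))) \<and>
      sgn (det3 (P \<epsilon> x) (D \<epsilon> x) (P \<epsilon> y)) = sgn (det3 (p (x div 2)) (d (x div 2)) (p (y div 2)))"
    proof clarify
      fix x y assume xy: "x \<in> N" "y \<in> N"
      show "\<forall>\<^sub>F \<epsilon> in at_right 0. x div 2 \<noteq> y div 2 \<longrightarrow>
        sgn (det3 (p (x div 2)) (d (x div 2)) (P \<epsilon> y)) = sgn (det3 (p (x div 2)) (d (x div 2)) (p (y div 2))) \<and>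
        sgn (det3 (P \<epsilon> x) (D \<epsilon> x) (P \<epsilon> y)) = sgn (det3 (p (x div 2)) (d (x div 2)) (p (y div 2)))"
      proof (cases "x div 2 = y div 2")
        case False
        have nz: "det3 (p (x div 2)) (d (x div 2)) (p (y div 2)) \<noteq> 0"
          using dd[OF half[OF xy(1)] half[OF xy(2)]] False by auto
        have "\<forall>\<^sub>F \<epsilon> in at_right 0. sgn (det3 (p (x div 2)) (d (x div 2)) (P \<epsilon> y)) = sgn (det3 (p (x div 2)) (d (x div 2)) (p (y div 2)))"
          "\<forall>\<^sub>F \<epsilon> in at_right 0. sgn (det3 (P \<epsilon> x) (D \<epsilon> x) (P \<epsilon> y)) = sgn (det3 (p (x div 2)) (d (x div 2)) (p (y div 2)))"
          using nz by (intro eventually_sgn_eq tendsto_det3 limP limD tendsto_const; assumption)+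
        then show ?thesis by eventually_elim simp
      qed auto
    qed
  qed (use finN in simp)
  moreover have "eventually (\<lambda>\<epsilon> :: real. 0 < \<epsilon>) (at_right 0)" by (rule eventually_at_right_less)
  ultimately have "eventually (\<lambda>\<epsilon>. 0 < \<epsilon> \<and>
    (\<forall>t \<in> N \<times> N \<times> N. case t of (x, y, w) \<Rightarrow> distinct [x div 2, y div 2, w div 2] \<longrightarrow>
      sgn (det3 (P \<epsilon> x) (P \<epsilon> y) (P \<epsilon> w)) = sgn (det3 (p (x div 2)) (p (y div 2)) (p (w div 2)))) \<and>
    (\<forall>t \<in> N \<times> N. case t of (x, y) \<Rightarrow> x div 2 \<noteq> y div 2 \<longrightarrow>
      sgn (det3 (p (x div 2)) (d (x div 2)) (P \<epsilon> y)) = sgn (det3 (p (x div 2)) (d (x div 2)) (p (y div 2))) \<and>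
      sgn (det3 (P \<epsilon> x) (D \<epsilon> x) (P \<epsilon> y)) = sgn (det3 (p (x div 2)) (d (x div 2)) (p (y div 2))))) (at_right 0)"
    by eventually_elim blast
  then obtain \<epsilon> where \<epsilon>: "0 < \<epsilon>"
    and "\<forall>t \<in> N \<times> N \<times> N. case t of (x, y, w) \<Rightarrow> distinct [x div 2, y div 2, w div 2] \<longrightarrow>
      sgn (det3 (P \<epsilon> x) (P \<epsilon> y) (P \<epsilon> w)) = sgn (det3 (p (x div 2)) (p (y div 2)) (p (w div 2)))"
    and "\<forall>t \<in> N \<times> N. case t of (x, y) \<Rightarrow> x div 2 \<noteq> y div 2 \<longrightarrow>
      sgn (det3 (p (x div 2)) (d (x div 2)) (P \<epsilon> y)) = sgn (det3 (p (x div 2)) (d (x div 2)) (p (y div 2))) \<and>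
      sgn (det3 (P \<epsilon> x) (D \<epsilon> x) (P \<epsilon> y)) = sgn (det3 (p (x div 2)) (d (x div 2)) (p (y div 2)))"
    using eventually_happens'[OF trivial_limit_at_right_real] by blast
  then have S1: "\<And>x y w. x \<in> N \<Longrightarrow> y \<in> N \<Longrightarrow> w \<in> N \<Longrightarrow> distinct [x div 2, y div 2, w div 2] \<Longrightarrow>
      sgn (det3 (P \<epsilon> x) (P \<epsilon> y) (P \<epsilon> w)) = sgn (det3 (p (x div 2)) (p (y div 2)) (p (w div 2)))"
    and S2: "\<And>x y. x \<in> N \<Longrightarrow> y \<in> N \<Longrightarrow> x div 2 \<noteq> y div 2 \<Longrightarrow>
      sgn (det3 (p (x div 2)) (d (x div 2)) (P \<epsilon> y)) = sgn (det3 (p (x div 2)) (d (x div 2)) (p (y div 2)))"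
    and S3: "\<And>x y. x \<in> N \<Longrightarrow> y \<in> N \<Longrightarrow> x div 2 \<noteq> y div 2 \<Longrightarrow>
      sgn (det3 (P \<epsilon> x) (D \<epsilon> x) (P \<epsilon> y)) = sgn (det3 (p (x div 2)) (d (x div 2)) (p (y div 2)))"
    by auto
  define p' where "p' = P \<epsilon>"
  define \<sigma> where "\<sigma> x y w = sgn (det3 (p' x) (p' y) (p' w))" for x y w
  define \<delta> where "\<delta> a b = sgn (det3 (p a) (d a) (p b))" for a b
  have \<sigma>swap: "\<sigma> y x w = - \<sigma> x y w" "\<sigma> x w y = - \<sigma> x y w" "\<sigma> w y x = - \<sigma> x y w" for x y w
    unfolding \<sigma>_def det3_swap(1)[of "p' y" "p' x"] det3_swap(2)[of "p' x" "p' w" "p' y"]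
      det3_swap(3)[of "p' w" "p' y" "p' x"] by (simp_all add: sgn_minus)
  have \<delta>nz: "\<delta> a b = 1 \<or> \<delta> a b = -1" if "a < n" "b < n" "a \<noteq> b" for a b
    using dd[of a b] that unfolding \<delta>_def by (auto simp: sgn_if)
  \<comment> \<open>This determinant is exactly \<open>\<epsilon>\<close> times one with the
    direction \<open>d a\<close>, so the sides of the halving line decide the orientation of triples
    with twins.\<close>
  have twin: "\<sigma> (2 * a) (Suc (2 * a)) y = \<delta> a (y div 2)" if "a < n" "y \<in> N" "y div 2 \<noteq> a" for a y
  proof -
    have "det3 (p' (2 * a)) (p' (Suc (2 * a))) (p' y) = \<epsilon> * det3 (p a) (d a) (p' y)"
      by (simp add: p'_def P_def)
    then have "\<sigma> (2 * a) (Suc (2 * a)) y = sgn (det3 (p a) (d a) (p' y))"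
      using \<epsilon> by (simp add: \<sigma>_def sgn_mult)
    then show ?thesis using S2[of "2 * a" y] that by (simp add: \<delta>_def p'_def N_def)
  qed
  have \<sigma>nz: "\<sigma> x y w \<noteq> 0" if xyw: "x \<in> N" "y \<in> N" "w \<in> N" "distinct [x, y, w]" for x y w
  proof -
    have tw: "\<sigma> x y w \<noteq> 0" if "x \<in> N" "y \<in> N" "w \<in> N" "x \<noteq> y" "x div 2 = y div 2" "w div 2 \<noteq> x div 2" for x y w
    proof -
      have "\<sigma> (2 * (x div 2)) (Suc (2 * (x div 2))) w \<noteq> 0"
        using twin[of "x div 2" w] \<delta>nz[of "x div 2" "w div 2"] half that by auto
      then show ?thesis using halves_twins[OF that(4,5)] \<sigma>swap(1)[of x y w] by auto
    qed
    have ne: "x \<noteq> y" "x \<noteq> w" "y \<noteq> w" using xyw(4) by auto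
    have notall: "\<not> (x div 2 = y div 2 \<and> y div 2 = w div 2)" using ne same_half[of x y w] by metis
    consider "distinct [x div 2, y div 2, w div 2]" | "x div 2 = y div 2" "w div 2 \<noteq> x div 2"
      | "x div 2 = w div 2" "y div 2 \<noteq> x div 2" | "y div 2 = w div 2" "x div 2 \<noteq> y div 2"
      using notall by (cases "x div 2 = y div 2"; cases "x div 2 = w div 2"; cases "y div 2 = w div 2") auto
    then show ?thesis
    proof cases
      case 1
      then show ?thesis using S1[of x y w] gp[OF half[OF xyw(1)] half[OF xyw(2)] half[OF xyw(3)]] xyw
        unfolding \<sigma>_def p'_def by (simp add: sgn_eq_0_iff)
    next
      case 2 then show ?thesis using tw[of x y w] xyw by simp
    next
      case 3 then show ?thesis using tw[of x w y] \<sigma>swap(2)[of x y w] xyw by simp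
    next
      case 4 then show ?thesis using tw[of w y x] \<sigma>swap(3)[of w y x] xyw by simp
    qed
  qed
  have sg': "edge_signs s'" using s1 ssym unfolding edge_signs_def s'_def by auto
  have gp3': "no_three_collinear (2 * n) p'"
    unfolding no_three_collinear_def using \<sigma>nz unfolding \<sigma>_def N_def by (metis lessThan_iff sgn_zero)
  have hv': "halving_directions (2 * n) p' s' (D \<epsilon>)"
    unfolding halving_directions_def
  proof (intro allI impI conjI)
    fix x assume x: "x < 2 * n"
    define u where "u = x div 2"
    have u: "u < n" using x by (simp add: u_def)
    \<comment> \<open>The determinant equals \<open>- (\<epsilon> * \<epsilon>)\<close> for either
      twin. So the positive side at \<open>x\<close> consists of the twins over the old positive
      side and has twice its size.\<close>
    have own: "det3 (p' x) (D \<epsilon> x) (p' y) < 0" if "y \<noteq> x" "y div 2 = u" for y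
    proof -
      have e: "det3 (p u) (d u) (z u) = 1" using z u by blast
      have "det3 (p u) (z u) (d u) = -1" "det3 (d u) (z u) (p u) = 1"
        using e det3_swap(2)[of "p u" "z u" "d u"] det3_rotate[of "d u" "z u" "p u"] by auto
      moreover have "x = 2 * u \<and> y = Suc (2 * u) \<or> x = Suc (2 * u) \<and> y = 2 * u" using halves_twins[of x y] that by (auto simp: u_def)
      ultimately have "det3 (p' x) (D \<epsilon> x) (p' y) = - (\<epsilon> * \<epsilon>)"
        by (auto simp: p'_def P_def D_def)
      then show ?thesis using \<epsilon> by simp
    qed
    have oth: "sgn (det3 (p' x) (D \<epsilon> x) (p' y)) = \<delta> u (y div 2)" if "y < 2 * n" "y div 2 \<noteq> u" for y
      using S3[of x y] x that by (simp add: p'_def \<delta>_def u_def N_def)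
    show "det3 (p' x) (D \<epsilon> x) (p' y) \<noteq> 0" if "y < 2 * n" "y \<noteq> x" for y
    proof (cases "y div 2 = u")
      case True then show ?thesis using own that by fastforce
    next
      case False
      moreover have "y div 2 < n" using half[of y] that(1) by (simp add: N_def)
      ultimately have "\<delta> u (y div 2) \<noteq> 0" using \<delta>nz[of u "y div 2"] u by auto
      then show ?thesis using oth[OF that(1) False] by auto
    qed
    define L where "L = {j. j < n \<and> j \<noteq> u \<and> 0 < s u j * det3 (p u) (d u) (p j)}"
    have "{y. y < 2 * n \<and> y \<noteq> x \<and> 0 < s' x y * det3 (p' x) (D \<epsilon> x) (p' y)} = {y. y div 2 \<in> L}"
    proof -
      have "y < 2 * n \<and> y \<noteq> x \<and> 0 < s' x y * det3 (p' x) (D \<epsilon> x) (p' y) \<longleftrightarrow> y div 2 \<in> L" for y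
      proof (cases "y div 2 = u")
        case True
        then show ?thesis using own[of y] by (auto simp: s'_def L_def u_def)
      next
        case False
        have ss: "0 < a * b \<longleftrightarrow> 0 < a * sgn b" for a b :: real by (auto simp: zero_less_mult_iff sgn_if)
        show ?thesis
        proof (cases "y < 2 * n")
          case True
          have "s' x y = s u (y div 2)" using False by (simp add: s'_def u_def)
          then have "0 < s' x y * det3 (p' x) (D \<epsilon> x) (p' y) \<longleftrightarrow> 0 < s u (y div 2) * det3 (p u) (d u) (p (y div 2))"
            using oth[OF True False] ss[of "s' x y" "det3 (p' x) (D \<epsilon> x) (p' y)"]
              ss[of "s u (y div 2)" "det3 (p u) (d u) (p (y div 2))"] by (simp add: \<delta>_def)
          then show ?thesis using True False by (auto simp: L_def u_def)
        next
          case False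
          then have "\<not> y div 2 < n" by simp
          then show ?thesis using False by (simp add: L_def)
        qed
      qed
      then show ?thesis by blast
    qed
    moreover have "card {y. y div 2 \<in> L} = 2 * card L" by (rule card_halves) (simp add: L_def)
    ultimately show "2 * card {y. y < 2 * n \<and> y \<noteq> x \<and> 0 < s' x y * det3 (p' x) (D \<epsilon> x) (p' y)} = 2 * n"
      using hvL[OF u] by (simp add: L_def)
  qed
  have cross\<sigma>: "crosses p' s' x y v w \<longleftrightarrow> \<sigma> x y v * \<sigma> x y w * s' v w < 0 \<and> \<sigma> v w x * \<sigma> v w y * s' x y < 0" for x y v w
    unfolding crosses_sgn \<sigma>_def ..
  \<comment> \<open>Twins lie on the same side of the line through any two of the remaining points,
    so the edge that joins them crosses nothing.\<close>
  have noown: "x div 2 \<noteq> y div 2" if "crosses p' s' x y v w" "distinct [x, y, v, w]" "x \<in> N" "y \<in> N" "v \<in> N" "w \<in> N" for x y v w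
  proof
    assume xy: "x div 2 = y div 2"
    have ne: "x \<noteq> y" "v \<noteq> x" "v \<noteq> y" "w \<noteq> x" "w \<noteq> y" using that(2) by auto
    have vx: "v div 2 \<noteq> x div 2" "w div 2 \<noteq> x div 2"
      using ne same_half[OF xy, of v] same_half[OF xy, of w] by metis+
    have neg: "\<sigma> v w x * \<sigma> v w y < 0" using that(1) xy unfolding cross\<sigma> s'_def by simp
    show False
    proof (cases "v div 2 = w div 2")
      case True
      have "\<sigma> (2 * (v div 2)) (Suc (2 * (v div 2))) x = \<sigma> (2 * (v div 2)) (Suc (2 * (v div 2))) y"
        using twin[of "v div 2" x] twin[of "v div 2" y] that vx xy half by auto
      then have "\<sigma> v w x = \<sigma> v w y"
        using halves_twins[of v w] True that(2) \<sigma>swap(1)[of v w x] \<sigma>swap(1)[of v w y] by auto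
      then show False using neg by (simp add: mult_less_0_iff)
    next
      case False
      have "\<sigma> v w x = \<sigma> v w y" using S1[of v w x] S1[of v w y] that vx xy False unfolding \<sigma>_def p'_def by auto
      then show False using neg by (simp add: mult_less_0_iff)
    qed
  qed
  define Q where "Q = crossing_quads (2 * n) p' s'"
  have QD: "x \<in> N \<and> y \<in> N \<and> v \<in> N \<and> w \<in> N \<and> distinct [x, y, v, w] \<and> crosses p' s' x y v w"
    if "(x, y, v, w) \<in> Q" for x y v w using that unfolding Q_def crossing_quads_def N_def by auto
  have finQ: "finite Q" unfolding Q_def by (rule finite_crossing_quads)
  have Qsym: "(y, x, v, w) \<in> Q" "(x, y, w, v) \<in> Q" "(v, w, x, y) \<in> Q" if "(x, y, v, w) \<in> Q" for x y v w
    using that crosses_swap[OF sg', of p'] unfolding Q_def crossing_quads_def by (auto simp: crosses_def)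
  have Qown: "x div 2 \<noteq> y div 2" "v div 2 \<noteq> w div 2" if "(x, y, v, w) \<in> Q" for x y v w
    using noown[of x y v w] noown[of v w x y] QD[OF that] QD[OF Qsym(3)[OF that]] by auto
  \<comment> \<open>\<open>A0\<close> lies over the old crossings. In \<open>B\<close> the first
    ends of the two edges are twins and the second ends are not; in \<open>C\<close> both are.
    Exchanging the ends of one or both edges produces the remaining members of
    \<open>Q\<close>.\<close>
  define A0 where "A0 = {(x, y, v, w). (x div 2, y div 2, v div 2, w div 2) \<in> crossing_quads n p s}"
  define B where "B = {(x, y, v, w). (x, y, v, w) \<in> Q \<and> x div 2 = v div 2 \<and> y div 2 \<noteq> w div 2}"
  define C where "C = {(x, y, v, w). (x, y, v, w) \<in> Q \<and> x div 2 = v div 2 \<and> y div 2 = w div 2}"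
  have distA0: "(x, y, v, w) \<in> A0" if q: "(x, y, v, w) \<in> Q" "distinct [x div 2, y div 2, v div 2, w div 2]" for x y v w
  proof -
    note N = QD[OF q(1)]
    have e1: "s' v w = s (v div 2) (w div 2)" "s' x y = s (x div 2) (y div 2)" using q(2) by (auto simp: s'_def)
    have dx: "distinct [x div 2, y div 2, v div 2]" "distinct [x div 2, y div 2, w div 2]"
      "distinct [v div 2, w div 2, x div 2]" "distinct [v div 2, w div 2, y div 2]" using q(2) by auto
    have n: "x \<in> N" "y \<in> N" "v \<in> N" "w \<in> N" using N by auto
    have e2: "\<sigma> x y v = sgn (det3 (p (x div 2)) (p (y div 2)) (p (v div 2)))"
      "\<sigma> x y w = sgn (det3 (p (x div 2)) (p (y div 2)) (p (w div 2)))"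
      "\<sigma> v w x = sgn (det3 (p (v div 2)) (p (w div 2)) (p (x div 2)))"
      "\<sigma> v w y = sgn (det3 (p (v div 2)) (p (w div 2)) (p (y div 2)))"
      using S1[OF n(1,2,3) dx(1)] S1[OF n(1,2,4) dx(2)] S1[OF n(3,4,1) dx(3)] S1[OF n(3,4,2) dx(4)]
      by (simp_all only: \<sigma>_def p'_def)
    have "\<sigma> x y v * \<sigma> x y w * s' v w < 0 \<and> \<sigma> v w x * \<sigma> v w y * s' x y < 0" using N cross\<sigma> by blast
    then have "crosses p s (x div 2) (y div 2) (v div 2) (w div 2)"
      by (simp only: e1 e2 crosses_sgn[of p] simp_thms)
    then show ?thesis using N q(2) half by (simp add: A0_def crossing_quads_def)
  qed
  define B1 where "B1 = {(x, y, v, w). (y, x, v, w) \<in> B}"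
  define B2 where "B2 = {(x, y, v, w). (x, y, w, v) \<in> B}"
  define B3 where "B3 = {(x, y, v, w). (y, x, w, v) \<in> B}"
  define C2 where "C2 = {(x, y, v, w). (x, y, w, v) \<in> C}"
  have cover: "Q \<subseteq> A0 \<union> (B \<union> B1 \<union> B2 \<union> B3) \<union> (C \<union> C2)"
  proof
    fix q assume q: "q \<in> Q"
    obtain x y v w where e: "q = (x, y, v, w)" by (cases q)
    have Q0: "(x, y, v, w) \<in> Q" using q e by simp
    have Q1: "(y, x, v, w) \<in> Q" "(x, y, w, v) \<in> Q" "(y, x, w, v) \<in> Q" using Qsym Q0 by blast+
    show "q \<in> A0 \<union> (B \<union> B1 \<union> B2 \<union> B3) \<union> (C \<union> C2)"
    proof (rule ccontr)
      assume n: "q \<notin> A0 \<union> (B \<union> B1 \<union> B2 \<union> B3) \<union> (C \<union> C2)"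
      then have nA: "(x, y, v, w) \<notin> A0" and nB: "(x, y, v, w) \<notin> B" "(x, y, v, w) \<notin> B1" "(x, y, v, w) \<notin> B2" "(x, y, v, w) \<notin> B3"
        and nC: "(x, y, v, w) \<notin> C" "(x, y, v, w) \<notin> C2" unfolding e by blast+
      have a1: "x div 2 \<noteq> v div 2" using nB(1) nC(1) Q0 by (auto simp: B_def C_def)
      have a2: "x div 2 \<noteq> w div 2" using nB(3) nC(2) Q1(2) by (auto simp: B2_def C2_def B_def C_def)
      have a3: "y div 2 \<noteq> v div 2" using a2 nB(2) Q1(1) by (auto simp: B1_def B_def)
      have a4: "y div 2 \<noteq> w div 2" using a1 nB(4) Q1(3) by (auto simp: B3_def B_def)
      have "distinct [x div 2, y div 2, v div 2, w div 2]" using a1 a2 a3 a4 Qown[OF Q0] by simp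
      then show False using distA0[OF Q0] nA by blast
    qed
  qed
  have finB: "finite B" "finite C" by (rule finite_subset[OF _ finQ]; auto simp: B_def C_def)+
  have cardA0: "card A0 \<le> 16 * card (crossing_quads n p s)" "finite A0"
    unfolding A0_def using card_halves4[OF finite_crossing_quads] by auto
  define T where "T a = {(b, e). b < n \<and> e < n \<and> b \<noteq> a \<and> e \<noteq> a \<and> b \<noteq> e \<and> 0 < (s a b * \<delta> a b) * (s a e * \<delta> a e)}" for a
  have \<delta>sq: "\<delta> a b * \<delta> a b = 1" if "a < n" "b < n" "a \<noteq> b" for a b using \<delta>nz[OF that] by auto
  text \<open>For twins \<open>x, v\<close> and ends \<open>y, w\<close>, exactly one of the two matchings crosses when the edges leave
    on the same side, and none otherwise.\<close>
  have Bkey: "(y div 2, w div 2) \<in> T (x div 2) \<and> (even x \<longleftrightarrow> 0 < \<delta> (x div 2) (y div 2) * \<sigma> (2 * (x div 2)) y w * s (x div 2) (w div 2))"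
    if q: "(x, y, v, w) \<in> B" for x y v w
  proof -
    define a where "a = x div 2"
    have Q0: "(x, y, v, w) \<in> Q" and xv: "x div 2 = v div 2" and yw: "y div 2 \<noteq> w div 2" using q by (auto simp: B_def)
    note N = QD[OF Q0]
    have an: "a < n" "y div 2 < n" "w div 2 < n" using half N by (auto simp: a_def)
    have ya: "y div 2 \<noteq> a" "w div 2 \<noteq> a" using Qown[OF Q0] xv by (auto simp: a_def)
    define b where "b = y div 2"
    define e where "e = w div 2"
    define c where "c = \<sigma> (2 * a) y w"
    have aN: "2 * a \<in> N" "Suc (2 * a) \<in> N" using an by (auto simp: N_def)
    have c2: "\<sigma> (Suc (2 * a)) y w = c" "\<sigma> (2 * a) y w = c"
      using S1[OF aN(1), of y w] S1[OF aN(2), of y w] N ya yw unfolding c_def \<sigma>_def p'_def by auto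
    have ty: "\<sigma> (2 * a) (Suc (2 * a)) y = \<delta> a b" "\<sigma> (2 * a) (Suc (2 * a)) w = \<delta> a e"
      using twin[OF an(1)] N ya by (auto simp: b_def e_def)
    have sv: "s' v w = s a e" "s' x y = s a b" using xv ya by (auto simp: s'_def a_def b_def e_def)
    have cr: "\<sigma> x y v * \<sigma> x y w * s a e < 0" "\<sigma> v w x * \<sigma> v w y * s a b < 0" using N cross\<sigma>[of x y v w] unfolding sv by blast+
    have "x = 2 * a \<and> v = Suc (2 * a) \<or> x = Suc (2 * a) \<and> v = 2 * a" using halves_twins[of x v] xv N by (auto simp: a_def)
    then have main: "x = 2 * a \<and> 0 < \<delta> a b * c * s a e \<and> 0 < \<delta> a e * c * s a b \<or>
        x = Suc (2 * a) \<and> \<delta> a b * c * s a e < 0 \<and> \<delta> a e * c * s a b < 0"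
    proof
      assume x: "x = 2 * a \<and> v = Suc (2 * a)"
      have "\<sigma> x y v = - \<delta> a b" "\<sigma> x y w = c" "\<sigma> v w x = \<delta> a e" "\<sigma> v w y = - c"
        using x ty c2 \<sigma>swap(2)[of "2 * a" "Suc (2 * a)" y] \<sigma>swap(1)[of "Suc (2 * a)" "2 * a" w]
          \<sigma>swap(2)[of "Suc (2 * a)" "2 * a" w] \<sigma>swap(2)[of "Suc (2 * a)" y w] by auto
      then show ?thesis using cr x by (simp only: mult_minus_left mult_minus_right neg_less_0_iff_less minus_minus simp_thms)
    next
      assume x: "x = Suc (2 * a) \<and> v = 2 * a"
      have "\<sigma> x y v = \<delta> a b" "\<sigma> x y w = c" "\<sigma> v w x = - \<delta> a e" "\<sigma> v w y = - c"
        using x ty c2 \<sigma>swap(1)[of "Suc (2 * a)" "2 * a" y] \<sigma>swap(2)[of "Suc (2 * a)" "2 * a" y]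
          \<sigma>swap(2)[of "2 * a" "Suc (2 * a)" w] \<sigma>swap(2)[of "2 * a" y w] by auto
      then show ?thesis using cr x by (simp only: mult_minus_left mult_minus_right neg_less_0_iff_less minus_minus simp_thms)
    qed
    \<comment> \<open>Both factors have the same sign in either case, and \<open>c\<close> enters
      their product as a square. What remains says that the edges to \<open>b\<close> and
      \<open>e\<close> leave \<open>a\<close> on the same side.\<close>
    then have "0 < (\<delta> a b * c * s a e) * (\<delta> a e * c * s a b)" by (auto simp: zero_less_mult_iff mult_neg_neg)
    then have "0 < (c * c) * ((s a b * \<delta> a b) * (s a e * \<delta> a e))" by (simp add: mult_ac)
    moreover have "0 \<le> c * c" by simp
    ultimately have "0 < (s a b * \<delta> a b) * (s a e * \<delta> a e)" by (metis mult_nonneg_nonpos not_less)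
    then have "(b, e) \<in> T a" using an ya yw by (simp add: T_def b_def e_def)
    moreover have "even x \<longleftrightarrow> 0 < \<delta> a b * c * s a e" using main by auto
    ultimately show ?thesis
      unfolding a_def[symmetric] b_def[symmetric] e_def[symmetric] c_def[symmetric] by blast
  qed
  \<comment> \<open>With \<open>k = n / 2 - 1\<close> the sides have \<open>k + 1\<close> and
    \<open>k\<close> points, which gives \<open>(k + 1) * k + k * (k - 1) = 2 * k * k\<close>
    ordered pairs on a common side. A less even split would give more.\<close>
  have cardT: "2 * card (T a) = (n - 2)\<^sup>2" "finite (T a)" if a: "a < n" for a
  proof -
    define L where "L = {j. j < n \<and> j \<noteq> a \<and> 0 < s a j * det3 (p a) (d a) (p j)}"
    define R where "R = {j. j < n \<and> j \<noteq> a \<and> \<not> 0 < s a j * det3 (p a) (d a) (p j)}"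
    have fin: "finite L" "finite R" by (auto simp: L_def R_def)
    have "L \<union> R = {..<n} - {a}" "L \<inter> R = {}" by (auto simp: L_def R_def)
    then have "card L + card R = n - 1" using card_Un_disjoint[OF fin] a by simp
    moreover have cL: "2 * card L = n" using hvL[OF a] by (simp add: L_def)
    ultimately have cR: "card R = card L - 1" by simp
    have sgn: "0 < s a j * \<delta> a j \<longleftrightarrow> 0 < s a j * det3 (p a) (d a) (p j)" for j
      unfolding \<delta>_def by (auto simp: zero_less_mult_iff sgn_if)
    have nz: "s a j * \<delta> a j = 1 \<or> s a j * \<delta> a j = -1" if "j < n" "j \<noteq> a" for j
      using \<delta>nz[of a j] s1[of a j] a that by auto
    have "T a = {(b, e). b \<in> L \<and> e \<in> L \<and> b \<noteq> e} \<union> {(b, e). b \<in> R \<and> e \<in> R \<and> b \<noteq> e}"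
    proof -
      have "0 < (s a b * \<delta> a b) * (s a e * \<delta> a e) \<longleftrightarrow> (0 < s a b * \<delta> a b \<longleftrightarrow> 0 < s a e * \<delta> a e)"
        if "b < n" "b \<noteq> a" "e < n" "e \<noteq> a" for b e
        using nz[OF that(1,2)] nz[OF that(3,4)] by auto
      then show ?thesis unfolding T_def L_def R_def sgn[symmetric] by auto
    qed
    moreover have "{(b, e). b \<in> L \<and> e \<in> L \<and> b \<noteq> e} \<inter> {(b, e). b \<in> R \<and> e \<in> R \<and> b \<noteq> e} = {}"
      by (auto simp: L_def R_def)
    moreover have fp: "finite {(b, e). b \<in> L \<and> e \<in> L \<and> b \<noteq> e}" "finite {(b, e). b \<in> R \<and> e \<in> R \<and> b \<noteq> e}"
      by (rule finite_subset[of _ "L \<times> L"]; use fin in auto) (rule finite_subset[of _ "R \<times> R"]; use fin in auto)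
    ultimately have "card (T a) = card L * (card L - 1) + card R * (card R - 1)"
      using card_Un_disjoint[OF fp] ordered_pairs_card[OF fin(1)] ordered_pairs_card[OF fin(2)] by (simp only:)
    moreover obtain k where k: "card L = Suc k" using cL n by (cases "card L") auto
    ultimately have "card (T a) = Suc k * k + k * (k - 1)" using cR by simp
    also have "\<dots> = 2 * k * k" by (cases k) auto
    finally have "2 * card (T a) = (2 * k)\<^sup>2" by (simp add: power2_eq_square)
    moreover have "n - 2 = 2 * k" using cL k by simp
    ultimately show "2 * card (T a) = (n - 2)\<^sup>2" by simp
    show "finite (T a)" by (rule finite_subset[of _ "{..<n} \<times> {..<n}"]) (auto simp: T_def)
  qed
  \<comment> \<open>The old point below \<open>x\<close> together with \<open>y\<close> and
    \<open>w\<close> forces the parity of \<open>x\<close>, and \<open>v\<close> is then the other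
    twin. Each pair in \<open>T a\<close> lifts to at most four pairs \<open>(y, w)\<close>.\<close>
  have cardB: "card B \<le> 2 * n * (n - 2)\<^sup>2"
  proof -
    define G where "G = (SIGMA a : {..<n}. {(y, w). (y div 2, w div 2) \<in> T a})"
    have inj: "inj_on (\<lambda>(x, y, v, w). (x div 2, y, w)) B"
    proof (rule inj_onI)
      fix t t' assume t: "t \<in> B" "t' \<in> B" "(\<lambda>(x, y, v, w). (x div 2, y, w)) t = (\<lambda>(x, y, v, w). (x div 2, y, w)) t'"
      obtain x y v w where e: "t = (x, y, v, w)" by (cases t)
      obtain x' y' v' w' where e': "t' = (x', y', v', w')" by (cases t')
      have r: "y' = y" "w' = w" using t(3) unfolding e e' by simp_all
      have q: "(x, y, v, w) \<in> B" "(x', y, v', w) \<in> B" "x div 2 = x' div 2" using t unfolding e e' r by simp_all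
      have "even x \<longleftrightarrow> even x'" using Bkey[OF q(1)] Bkey[OF q(2)] unfolding q(3) by blast
      then have "x = x'" using q(3) by (metis even_two_times_div_two odd_two_times_div_two_succ)
      moreover have "v = v'"
      proof -
        have "v \<noteq> x" "v' \<noteq> x'" "v div 2 = x div 2" "v' div 2 = x' div 2" using QD q(1,2) by (auto simp: B_def)
        then show ?thesis using same_half[of v v' x] \<open>x = x'\<close> by metis
      qed
      ultimately show "t = t'" unfolding e e' r by simp
    qed
    have im: "(\<lambda>(x, y, v, w). (x div 2, y, w)) ` B \<subseteq> G"
    proof
      fix g assume "g \<in> (\<lambda>(x, y, v, w). (x div 2, y, w)) ` B"
      then obtain x y v w where q: "(x, y, v, w) \<in> B" and g: "g = (x div 2, y, w)" by auto
      have "x div 2 < n" using half QD q by (auto simp: B_def)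
      moreover have "(y div 2, w div 2) \<in> T (x div 2)" using Bkey[OF q] by blast
      ultimately show "g \<in> G" unfolding g G_def by simp
    qed
    have finG: "finite G" unfolding G_def using card_halves2(2) cardT(2) by (intro finite_SigmaI) auto
    have "card B = card ((\<lambda>(x, y, v, w). (x div 2, y, w)) ` B)" using card_image[OF inj] by simp
    also have "\<dots> \<le> card G" by (rule card_mono[OF finG im])
    also have "\<dots> = (\<Sum>a<n. card {(y, w). (y div 2, w div 2) \<in> T a})"
      unfolding G_def using card_halves2(2) cardT(2) by (intro card_SigmaI) auto
    also have "\<dots> \<le> (\<Sum>a<n. 4 * card (T a))" using card_halves2(1) cardT(2) by (intro sum_mono) auto
    also have "\<dots> = (\<Sum>a<n. 2 * (n - 2)\<^sup>2)"
    proof (rule sum.cong)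
      fix a assume "a \<in> {..<n}"
      then show "4 * card (T a) = 2 * (n - 2)\<^sup>2" using cardT(1)[of a] by simp
    qed simp
    also have "\<dots> = 2 * n * (n - 2)\<^sup>2" by simp
    finally show ?thesis .
  qed
  \<comment> \<open>For given \<open>x\<close> and given old point below \<open>y\<close>, only one
    of the two choices of \<open>y\<close> can cross: replacing \<open>y\<close> by its twin keeps
    \<open>\<sigma> x y v\<close> but reverses \<open>\<sigma> x y w\<close>.\<close>
  have cardC: "card C \<le> 2 * n * (n - 1)"
  proof -
    define G where "G = (SIGMA x : N. {..<n} - {x div 2})"
    have inj: "inj_on (\<lambda>(x, y, v, w). (x, y div 2)) C"
    proof (rule inj_onI)
      fix t t' assume t: "t \<in> C" "t' \<in> C" "(\<lambda>(x, y, v, w). (x, y div 2)) t = (\<lambda>(x, y, v, w). (x, y div 2)) t'"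
      obtain x y v w where et: "t = (x, y, v, w)" by (cases t)
      obtain x' y' v' w' where et': "t' = (x', y', v', w')" by (cases t')
      have xx: "x' = x" using t(3) unfolding et et' by simp
      have q: "(x, y, v, w) \<in> C" "(x, y', v', w') \<in> C" "y div 2 = y' div 2" using t unfolding et et' xx by simp_all
      have Q: "(x, y, v, w) \<in> Q" "(x, y', v', w') \<in> Q" and e: "x div 2 = v div 2" "x div 2 = v' div 2" "y div 2 = w div 2" "y' div 2 = w' div 2"
        using q by (auto simp: C_def)
      note N = QD[OF Q(1)] and N' = QD[OF Q(2)]
      have dq: "x \<noteq> v" "x \<noteq> v'" "y \<noteq> w" "y' \<noteq> w'" using N N' by auto
      have vv: "v = v'" using same_half[of x v v'] dq e by metis
      have "y = y'"
      proof (rule ccontr)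
        assume ne: "y \<noteq> y'"
        have wy: "w = y'" "w' = y" using same_half[of y w y'] same_half[of y' w' y] q(3) e dq ne by metis+
        have neg: "\<sigma> x y v * \<sigma> x y y' * s' v y' < 0" "\<sigma> x y' v * \<sigma> x y' y * s' v y < 0"
          using N N' cross\<sigma>[of x y v w] cross\<sigma>[of x y' v' w'] unfolding vv wy by blast+
        have e1: "s' v y = s' v y'" using q(3) by (simp add: s'_def)
        have e2: "\<sigma> x y' y = - \<sigma> x y y'" by (rule \<sigma>swap(2))
        have e3: "\<sigma> x y' v = \<sigma> x y v"
        proof -
          define a where "a = x div 2"
          have xv: "x = 2 * a \<and> v = Suc (2 * a) \<or> x = Suc (2 * a) \<and> v = 2 * a" using halves_twins[of x v] e N by (auto simp: a_def)
          have "y div 2 \<noteq> a" using Qown[OF Q(1)] by (simp add: a_def)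
          then have eq: "\<sigma> (2 * a) (Suc (2 * a)) y = \<sigma> (2 * a) (Suc (2 * a)) y'"
            using twin[of a y] twin[of a y'] N N' half[of x] q(3) by (simp add: a_def)
          have k1: "\<sigma> (2 * a) t (Suc (2 * a)) = - \<sigma> (2 * a) (Suc (2 * a)) t" for t by (rule \<sigma>swap(2))
          have k2: "\<sigma> (Suc (2 * a)) t (2 * a) = \<sigma> (2 * a) (Suc (2 * a)) t" for t
            using \<sigma>swap(2)[of "Suc (2 * a)" t "2 * a"] \<sigma>swap(1)[of "Suc (2 * a)" "2 * a" t] by simp
          show ?thesis using xv k1[of y] k1[of y'] k2[of y] k2[of y'] eq by auto
        qed
        have "\<sigma> x y' v * \<sigma> x y' y * s' v y = - (\<sigma> x y v * \<sigma> x y y' * s' v y')"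
          by (simp only: e1 e2 e3 mult_minus_left mult_minus_right)
        then show False using neg by linarith
      qed
      moreover have "w = w'" using same_half[of y w w'] dq e \<open>y = y'\<close> by metis
      ultimately show "t = t'" using vv unfolding et et' xx by simp
    qed
    have im: "(\<lambda>(x, y, v, w). (x, y div 2)) ` C \<subseteq> G"
    proof
      fix g assume "g \<in> (\<lambda>(x, y, v, w). (x, y div 2)) ` C"
      then obtain x y v w where q: "(x, y, v, w) \<in> C" and g: "g = (x, y div 2)" by auto
      then have Q: "(x, y, v, w) \<in> Q" by (simp add: C_def)
      have "x \<in> N" "y div 2 < n" using QD[OF Q] half by auto
      then show "g \<in> G" using Qown(1)[OF Q] unfolding g G_def by simp
    qed
    have finG: "finite G" unfolding G_def using finN by auto
    have "card C = card ((\<lambda>(x, y, v, w). (x, y div 2)) ` C)" using card_image[OF inj] by simp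
    also have "\<dots> \<le> card G" by (rule card_mono[OF finG im])
    also have "\<dots> = (\<Sum>x\<in>N. card ({..<n} - {x div 2}))" unfolding G_def using finN by (intro card_SigmaI) auto
    also have "\<dots> = (\<Sum>x\<in>N. n - 1)" using half by (intro sum.cong) auto
    also have "\<dots> = 2 * n * (n - 1)" by (simp add: N_def)
    finally show ?thesis .
  qed
  have cards: "card B1 \<le> card B" "card B2 \<le> card B" "card B3 \<le> card B" "card C2 \<le> card C"
    and fins: "finite B1" "finite B2" "finite B3" "finite C2"
    unfolding B1_def B2_def B3_def C2_def
    by (rule card_reindex_quads[OF finB(1)] card_reindex_quads[OF finB(2)])+
  have "card Q \<le> card (A0 \<union> (B \<union> B1 \<union> B2 \<union> B3) \<union> (C \<union> C2))"
    by (rule card_mono[OF _ cover]) (use finB fins cardA0 in auto)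
  also have "\<dots> \<le> card A0 + (card B + card B1 + card B2 + card B3) + (card C + card C2)"
    by (intro order_trans[OF card_Un_le] add_mono order_refl)
  also have "\<dots> \<le> 16 * card (crossing_quads n p s) + 8 * n * (n - 2)\<^sup>2 + 4 * n * (n - 1)"
    using cardA0(1) cardB cardC cards by simp
  finally show ?thesis using gp3' sg' hv' unfolding Q_def by blast
qed

section \<open>General position\<close>

text \<open>Finitely many planes through the origin form a null set, and a nonempty open set is not
  null.\<close>

lemma avoid_hyperplanes:
  fixes W :: "(real ^ 3) set"
  assumes "finite W" "0 \<notin> W" "open S" "a \<in> S"
  shows "\<exists>x\<in>S. \<forall>w\<in>W. w \<bullet> x \<noteq> 0"
proof (rule ccontr)
  assume "\<not> ?thesis"
  then have "S \<subseteq> (\<Union>w\<in>W. {x. w \<bullet> x = 0})" by blast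
  moreover have "negligible (\<Union>w\<in>W. {x. w \<bullet> x = 0})"
    using assms(1,2) by (intro negligible_Union) (auto intro!: negligible_hyperplane)
  ultimately have "negligible S" using negligible_subset by blast
  then show False using open_not_negligible assms(3,4) by blast
qed

lemma open_sgn_det3:
  assumes "det3 a u v \<noteq> 0"
  shows "open {x. sgn (det3 x u v) = sgn (det3 a u v)}"
proof -
  have "{x. sgn (det3 x u v) = sgn (det3 a u v)} = {x. 0 < det3 x u v * sgn (det3 a u v)}"
    using assms by (auto simp: sgn_if zero_less_mult_iff split: if_splits)
  moreover have "open {x. 0 < det3 x u v * sgn (det3 a u v)}"
    by (intro open_Collect_less continuous_intros)
  ultimately show ?thesis by simp
qed

definition lines_det :: "(nat \<Rightarrow> real ^ 3) \<Rightarrow> nat \<Rightarrow> nat \<Rightarrow> nat \<Rightarrow> nat \<Rightarrow> nat \<Rightarrow> nat \<Rightarrow> real" where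
  "lines_det p a b c d x y = det3 (cross3 (p a) (p b)) (cross3 (p c) (p d)) (cross3 (p x) (p y))"

lemma lines_det_swap:
  "lines_det p b a c d x y = - lines_det p a b c d x y"
  "lines_det p c d a b x y = - lines_det p a b c d x y"
  "lines_det p x y c d a b = - lines_det p a b c d x y"
  unfolding lines_det_def
  by (simp only: cross_skew[of "p b" "p a"] det3_minus)
     (rule det3_swap)+

text \<open>With the other five points fixed, concurrency is a single linear condition on the point
  \<open>m\<close>, so a perturbation of this point has to avoid one plane.\<close>

lemma lines_det_linear:
  "lines_det p m b c d x y = cross3 (p b) (cross3 (cross3 (p c) (p d)) (cross3 (p x) (p y))) \<bullet> p m"
  by (simp add: lines_det_def det3_def cross3_simps)

text \<open>The line \<open>cd\<close> meets the line \<open>xy\<close> in a point other than \<open>b\<close>, and the plane joining \<open>b\<close> to that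
  point has the displayed normal vector.\<close>

lemma line_through_meeting_point_nonzero:
  assumes "det3 c d x \<noteq> 0" "det3 c x y \<noteq> 0" "det3 b c d \<noteq> 0"
  shows "cross3 b (cross3 (cross3 c d) (cross3 x y)) \<noteq> 0"
proof
  assume 0: "cross3 b (cross3 (cross3 c d) (cross3 x y)) = 0"
  define q where "q = cross3 (cross3 c d) (cross3 x y)"
  have q: "q = det3 c d y *\<^sub>R x - det3 c d x *\<^sub>R y"
    unfolding q_def by (simp add: det3_component cross3_simps vec_eq_iff forall_3)
  have "det3 c x q = - (det3 c d x * det3 c x y)" unfolding q by simp
  then have q0: "q \<noteq> 0" using assms(1,2) by auto
  have bq: "cross3 b q = 0" using 0 by (simp add: q_def)
  have "cross3 c d \<bullet> q = 0" unfolding q_def by (simp add: dot_cross_self)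
  then have cdq: "det3 c d q = 0" by (simp add: det3_def)
  have "det3 b c d *\<^sub>R q = det3 q c d *\<^sub>R b + det3 b q d *\<^sub>R c + det3 b c q *\<^sub>R d"
    by (rule cramer3)
  moreover have "det3 b q d = 0" using bq by (simp add: det3_def)
  moreover have "det3 b c q = 0" using bq det3_rotate[of b c q] cross_skew[of q b] by (simp add: det3_def[of q b])
  moreover have "det3 q c d = 0" using cdq det3_rotate[of c d q] by simp
  ultimately have "det3 b c d *\<^sub>R q = 0" by simp
  then show False using q0 assms(3) by simp
qed

text \<open>The points are moved one after the other. The point \<open>m\<close> is chosen in an
  open set on which no orientation sign changes, off the finitely many planes on which its line to
  an earlier point is concurrent with two lines through four other earlier points. For equal indices
  the determinants vanish before and after, so all signs agree.\<close>

theorem perturb_no_three_concurrent: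
  assumes gp3: "no_three_collinear n p"
  shows "\<exists>p'. no_three_collinear n p' \<and> no_three_concurrent n p' \<and>
    (\<forall>i<n. \<forall>j<n. \<forall>k<n. sgn (det3 (p' i) (p' j) (p' k)) = sgn (det3 (p i) (p j) (p k)))"
proof -
  define good where "good m p' \<longleftrightarrow> (\<forall>i<n. \<forall>j<n. \<forall>k<n. sgn (det3 (p' i) (p' j) (p' k)) = sgn (det3 (p i) (p j) (p k))) \<and>
      no_three_concurrent m p'" for m p'
  have "\<exists>p'. good m p'" if "m \<le> n" for m
    using that
  proof (induction m)
    case 0
    have "good 0 p" by (simp add: good_def no_three_concurrent_def)
    then show ?case by blast
  next
    case (Suc m)
    then obtain r where r: "good m r" by auto
    have mn: "m < n" using Suc.prems by simp
    have sr: "sgn (det3 (r i) (r j) (r k)) = sgn (det3 (p i) (p j) (p k))" if "i < n" "j < n" "k < n" for i j k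
      using r that unfolding good_def by blast
    have gpr: "det3 (r i) (r j) (r k) \<noteq> 0" if "i < n" "j < n" "k < n" "distinct [i, j, k]" for i j k
    proof -
      have "det3 (p i) (p j) (p k) \<noteq> 0" using gp3 that unfolding no_three_collinear_def by blast
      then show ?thesis using sr[OF that(1-3)] by (metis sgn_0_0)
    qed
    define I where "I = {(i, j). i < n \<and> j < n \<and> distinct [m, i, j]}"
    define J where "J = {(b, c, d, x, y). b < m \<and> c < m \<and> d < m \<and> x < m \<and> y < m \<and> distinct [b, c, d, x, y]}"
    define W where "W = (\<lambda>(b, c, d, x, y). cross3 (r b) (cross3 (cross3 (r c) (r d)) (cross3 (r x) (r y)))) ` J"
    define U where "U = (\<Inter>(i, j)\<in>I. {x. sgn (det3 x (r i) (r j)) = sgn (det3 (r m) (r i) (r j))})"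
    have finI: "finite I" unfolding I_def by (rule finite_subset[of _ "{..<n} \<times> {..<n}"]) auto
    have finJ: "finite J" unfolding J_def
      by (rule finite_subset[of _ "{..<m} \<times> {..<m} \<times> {..<m} \<times> {..<m} \<times> {..<m}"]) auto
    have "open U" unfolding U_def
      by (rule open_INT[OF finI]) (use gpr mn in \<open>auto simp: I_def intro!: open_sgn_det3\<close>)
    moreover have "r m \<in> U" by (auto simp: U_def)
    moreover have "finite W" using finJ by (simp add: W_def)
    moreover have "0 \<notin> W"
    proof
      assume "0 \<in> W"
      then obtain b c d x y where bJ: "(b, c, d, x, y) \<in> J"
        and 0: "cross3 (r b) (cross3 (cross3 (r c) (r d)) (cross3 (r x) (r y))) = 0" by (auto simp: W_def)
      have "b < n" "c < n" "d < n" "x < n" "y < n" "distinct [b, c, d, x, y]" using bJ mn by (auto simp: J_def)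
      then show False using line_through_meeting_point_nonzero[of "r c" "r d" "r x" "r y" "r b"] gpr 0 by auto
    qed
    ultimately obtain x where x: "x \<in> U" "\<And>w. w \<in> W \<Longrightarrow> w \<bullet> x \<noteq> 0"
      using avoid_hyperplanes[of W U "r m"] by blast
    define r' where "r' = r(m := x)"
    have rm: "r' m = x" "\<And>i. i \<noteq> m \<Longrightarrow> r' i = r i" by (auto simp: r'_def)
    have sx: "sgn (det3 x (r i) (r j)) = sgn (det3 (r m) (r i) (r j))" if "i < n" "j < n" "distinct [m, i, j]" for i j
      using x(1) that by (auto simp: U_def I_def)
    have sr': "sgn (det3 (r' i) (r' j) (r' k)) = sgn (det3 (r i) (r j) (r k))" if ijk: "i < n" "j < n" "k < n" for i j k
    proof (cases "distinct [i, j, k]")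
      case True
      consider "i = m" | "j = m" | "k = m" | "i \<noteq> m" "j \<noteq> m" "k \<noteq> m" by blast
      then show ?thesis
      proof cases
        case 1 then show ?thesis using sx[of j k] ijk True rm by auto
      next
        case 2 then show ?thesis
          using sx[of i k] ijk True rm det3_swap(1)[of "r i" x "r k"] det3_swap(1)[of "r i" "r m" "r k"] by (auto simp: sgn_minus)
      next
        case 3 then show ?thesis
          using sx[of i j] ijk True rm det3_rotate[of "r i" "r j" x] det3_rotate[of "r i" "r j" "r m"] by auto
      next
        case 4 then show ?thesis using rm by simp
      qed
    next
      case False
      then consider "i = j" | "i = k" | "j = k" by auto
      then show ?thesis by cases simp_all
    qed
    have old: "lines_det r a b c d x y \<noteq> 0" if "a < m" "b < m" "c < m" "d < m" "x < m" "y < m" "distinct [a, b, c, d, x, y]" for a b c d x y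
    proof -
      have c: "no_three_concurrent m r" using r by (simp add: good_def)
      show ?thesis using c[unfolded no_three_concurrent_def, rule_format, OF that] by (simp add: lines_det_def)
    qed
    have less: "k < m" if "k < Suc m" "k \<noteq> m" for k using that by simp
    have new: "lines_det r' m b c d x y \<noteq> 0" if "b < m" "c < m" "d < m" "x < m" "y < m" "distinct [b, c, d, x, y]" for b c d x y
    proof -
      have "cross3 (r b) (cross3 (cross3 (r c) (r d)) (cross3 (r x) (r y))) \<in> W"
        unfolding W_def using that by (intro image_eqI[of _ _ "(b, c, d, x, y)"]) (auto simp: J_def)
      then show ?thesis using x(2) that rm unfolding lines_det_linear by auto
    qed
    have new1: "lines_det r' a b c d x y \<noteq> 0" if "a = m \<or> b = m" "a < Suc m" "b < Suc m" "c < m" "d < m" "x < m" "y < m" "distinct [a, b, c, d, x, y]" for a b c d x y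
    proof (cases "a = m")
      case True
      then have "b < m" using that by (auto simp: less_Suc_eq)
      then show ?thesis using new[of b c d x y] that True by auto
    next
      case False
      then have "b = m" "a < m" using that by (auto simp: less_Suc_eq)
      then show ?thesis using new[of a c d x y] lines_det_swap(1)[of r' a m] that by auto
    qed
    have "no_three_concurrent (Suc m) r'"
      unfolding no_three_concurrent_def lines_det_def[symmetric]
    proof (intro allI impI)
      fix a b c d x y assume lt: "a < Suc m" "b < Suc m" "c < Suc m" "d < Suc m" "x < Suc m" "y < Suc m" and dist: "distinct [a, b, c, d, x, y]"
      \<comment> \<open>The moved point lies in at most one of the three pairs; up to sign the
        determinant is symmetric, so \<open>m\<close> can be brought to the first place.\<close>
      consider "a = m \<or> b = m" | "c = m \<or> d = m" | "x = m \<or> y = m" | "m \<notin> {a, b, c, d, x, y}" by auto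
      then show "lines_det r' a b c d x y \<noteq> 0"
      proof cases
        case 1 then show ?thesis using new1[of a b c d x y] lt dist less[of c] less[of d] less[of x] less[of y] by auto
      next
        case 2 then show ?thesis using new1[of c d a b x y] lt dist less[of a] less[of b] less[of x] less[of y] lines_det_swap(2)[of r' c d a b x y] by auto
      next
        case 3 then show ?thesis using new1[of x y c d a b] lt dist less[of a] less[of b] less[of c] less[of d] lines_det_swap(3)[of r' x y c d a b] by auto
      next
        case 4
        then have "a < m" "b < m" "c < m" "d < m" "x < m" "y < m" using lt by auto
        moreover have "lines_det r' a b c d x y = lines_det r a b c d x y" using 4 rm by (simp add: lines_det_def)
        ultimately show ?thesis using old[of a b c d x y] dist by simp
      qed
    qed
    then have "good (Suc m) r'" using sr sr' by (simp add: good_def)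
    then show ?case by blast
  qed
  then obtain p' where p': "good n p'" by blast
  have "no_three_collinear n p'"
    unfolding no_three_collinear_def
  proof (intro allI impI)
    fix i j k assume "i < n" "j < n" "k < n" "distinct [i, j, k]"
    then have "det3 (p i) (p j) (p k) \<noteq> 0" "sgn (det3 (p' i) (p' j) (p' k)) = sgn (det3 (p i) (p j) (p k))"
      using gp3 p' unfolding no_three_collinear_def good_def by blast+
    then show "det3 (p' i) (p' j) (p' k) \<noteq> 0" by (metis sgn_0_0)
  qed
  then show ?thesis using p' unfolding good_def by blast
qed

section \<open>A drawing with 18 points\<close>

text \<open>Integer counterparts of the determinant, the edge sign and the crossing test make the
  finite checks a matter of evaluation.\<close>

definition int_det :: "int \<times> int \<times> int \<Rightarrow> int \<times> int \<times> int \<Rightarrow> int \<times> int \<times> int \<Rightarrow> int" where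
  "int_det = (\<lambda>(a1, a2, a3) (b1, b2, b3) (c1, c2, c3).
     a1 * (b2 * c3 - b3 * c2) - a2 * (b1 * c3 - b3 * c1) + a3 * (b1 * c2 - b2 * c1))"

text \<open>The sign of the inner product selects a shortest segment: towards \<open>b\<close> if
  the angle is acute, towards \<open>- b\<close> if it is obtuse. At a right angle both segments
  have the same length and \<open>-1\<close> is taken.\<close>

definition int_sign :: "int \<times> int \<times> int \<Rightarrow> int \<times> int \<times> int \<Rightarrow> int" where
  "int_sign = (\<lambda>(a1, a2, a3) (b1, b2, b3). if 0 < a1 * b1 + a2 * b2 + a3 * b3 then 1 else -1)"

definition int_crosses :: "int \<times> int \<times> int \<Rightarrow> int \<times> int \<times> int \<Rightarrow> int \<times> int \<times> int \<Rightarrow> int \<times> int \<times> int \<Rightarrow> bool" where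
  "int_crosses a b c d \<longleftrightarrow> int_det a b c * int_det a b d * int_sign c d < 0 \<and>
     int_det c d a * int_det c d b * int_sign a b < 0"

definition base_points :: "(int \<times> int \<times> int) list" where
  "base_points = [(-4, -1, 2), (-4, 0, 1), (-1, -1, 2), (2, -3, -4), (2, -4, 3), (2, 3, 2),
    (-4, 1, 1), (2, 3, 0), (1, -2, 3), (-1, -4, 0), (1, -1, -4), (2, 1, 3), (4, 3, 2), (0, 4, -3),
    (-4, 1, -4), (-1, -1, 4), (3, -2, -1), (-3, 4, 3)]"

definition base_directions :: "(int \<times> int \<times> int) list" where
  "base_directions = [(0, 1, 0), (-1, 0, 0), (1, 0, 1), (0, 0, -1), (-1, 0, 1), (-1, 0, 1),
    (-1, 0, 0), (0, -1, -1), (0, -1, 0), (0, 0, -1), (0, 0, -1), (-1, 0, 0), (0, 0, 1), (0, 0, 1),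
    (-1, 0, 1), (-1, 1, 0), (-1, 0, 0), (0, -1, 0)]"

text \<open>Passing the remaining tail to \<open>g\<close> lets nested sums run over each increasing
  tuple of positions once, without any indexing during evaluation.\<close>

fun tails_sum :: "('a \<Rightarrow> 'a list \<Rightarrow> int) \<Rightarrow> 'a list \<Rightarrow> int" where
  "tails_sum g [] = 0"
| "tails_sum g (x # xs) = g x xs + tails_sum g xs"

lemma tails_sum_drop:
  "tails_sum g (drop m xs) = (\<Sum>i = m..<length xs. g (xs ! i) (drop (Suc i) xs))"
proof (induction "length xs - m" arbitrary: m)
  case 0
  then show ?case by simp
next
  case (Suc k)
  then have m: "m < length xs" by simp
  have "tails_sum g (drop m xs) = g (xs ! m) (drop (Suc m) xs) + tails_sum g (drop (Suc m) xs)"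
    using Cons_nth_drop_Suc[OF m] by (metis tails_sum.simps(2))
  also have "tails_sum g (drop (Suc m) xs) = (\<Sum>i = Suc m..<length xs. g (xs ! i) (drop (Suc i) xs))"
    using Suc(1)[of "Suc m"] Suc(2) by simp
  finally show ?case using m by (simp add: sum.atLeast_Suc_lessThan)
qed

definition sum_triples :: "('a \<Rightarrow> 'a \<Rightarrow> 'a \<Rightarrow> int) \<Rightarrow> 'a list \<Rightarrow> int" where
  "sum_triples w = tails_sum (\<lambda>a. tails_sum (\<lambda>b. tails_sum (\<lambda>c _. w a b c)))"

definition sum_quadruples :: "('a \<Rightarrow> 'a \<Rightarrow> 'a \<Rightarrow> 'a \<Rightarrow> int) \<Rightarrow> 'a list \<Rightarrow> int" where
  "sum_quadruples w = tails_sum (\<lambda>a. tails_sum (\<lambda>b. tails_sum (\<lambda>c. tails_sum (\<lambda>d _. w a b c d))))"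

lemma sum_triples_eq:
  "sum_triples w xs = (\<Sum>i = 0..<length xs. \<Sum>j = Suc i..<length xs. \<Sum>k = Suc j..<length xs. w (xs ! i) (xs ! j) (xs ! k))"
  using tails_sum_drop[of _ 0 xs] unfolding sum_triples_def by (simp add: tails_sum_drop)

lemma sum_quadruples_eq:
  "sum_quadruples w xs = (\<Sum>i = 0..<length xs. \<Sum>j = Suc i..<length xs. \<Sum>k = Suc j..<length xs.
     \<Sum>l = Suc k..<length xs. w (xs ! i) (xs ! j) (xs ! k) (xs ! l))"
  using tails_sum_drop[of _ 0 xs] unfolding sum_quadruples_def by (simp add: tails_sum_drop)

text \<open>The three summands are the three ways to split four points into two edges, so every
  crossing pair of edges is counted once.\<close>

lemma base_crossings:
  "sum_quadruples (\<lambda>a b c d. (if int_crosses a b c d then 1 else 0) + (if int_crosses a c b d then 1 else 0) +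
     (if int_crosses a d b c then 1 else 0)) base_points = 684"
  by code_simp

lemma base_degenerate: "sum_triples (\<lambda>a b c. if int_det a b c = 0 then 1 else 0) base_points = 0"
  by code_simp

text \<open>The single zero is the point itself, so no other point lies on its halving line; 9 is
  half of 18.\<close>

lemma base_halving:
  "list_all (\<lambda>(v, d). length (filter (\<lambda>w. int_det v d w = 0) base_points) = 1 \<and>
     length (filter (\<lambda>w. 0 < int_sign v w * int_det v d w) base_points) = 9) (zip base_points base_directions)"
  by code_simp

section \<open>Transfer of the integer checks to vectors\<close>

definition int_vec :: "int \<times> int \<times> int \<Rightarrow> real ^ 3" where
  "int_vec = (\<lambda>(a, b, c). vector [of_int a, of_int b, of_int c])"

definition base_point :: "nat \<Rightarrow> real ^ 3" where "base_point i = int_vec (base_points ! i)"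
definition base_sign :: "nat \<Rightarrow> nat \<Rightarrow> real" where "base_sign i j = of_int (int_sign (base_points ! i) (base_points ! j))"
definition base_direction :: "nat \<Rightarrow> real ^ 3" where "base_direction i = int_vec (base_directions ! i)"

lemma int_det_self: "int_det a b a = 0"
  by (cases a; cases b) (simp add: int_det_def algebra_simps)

lemma det3_int_vec: "det3 (int_vec a) (int_vec b) (int_vec c) = of_int (int_det a b c)"
  by (cases a; cases b; cases c) (simp add: det3_component int_vec_def int_det_def vector_3)

lemma crosses_base:
  "crosses base_point base_sign a b c d \<longleftrightarrow>
     int_crosses (base_points ! a) (base_points ! b) (base_points ! c) (base_points ! d)"
  unfolding crosses_def int_crosses_def base_point_def base_sign_def det3_int_vec of_int_mult[symmetric] of_int_less_0_iff ..

lemma length_base: "length base_points = 18" "length base_directions = 18"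
  by (simp_all add: base_points_def base_directions_def)

lemma edge_signs_base: "edge_signs base_sign"
proof -
  have "int_sign a b = 1 \<or> int_sign a b = -1" "int_sign b a = int_sign a b" for a b
    by (cases a; cases b; simp add: int_sign_def mult.commute)+
  then show ?thesis unfolding edge_signs_def base_sign_def by (metis of_int_1 of_int_minus)
qed

lemma no_three_collinear_base: "no_three_collinear 18 base_point"
proof -
  have sorted: "int_det (base_points ! i) (base_points ! j) (base_points ! k) \<noteq> 0" if "i < j" "j < k" "k < 18" for i j k
  proof
    let ?w = "\<lambda>i j k. if int_det (base_points ! i) (base_points ! j) (base_points ! k) = 0 then 1 else 0 :: int"
    assume 0: "int_det (base_points ! i) (base_points ! j) (base_points ! k) = 0"
    have "1 \<le> (\<Sum>k = Suc j..<18. ?w i j k)"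
      using member_le_sum[of k "{Suc j..<18}" "?w i j"] that 0 by simp
    also have "\<dots> \<le> (\<Sum>j = Suc i..<18. \<Sum>k = Suc j..<18. ?w i j k)"
      using member_le_sum[of j "{Suc i..<18}" "\<lambda>j. \<Sum>k = Suc j..<18. ?w i j k"] that by (simp add: sum_nonneg)
    also have "\<dots> \<le> (\<Sum>i = 0..<18. \<Sum>j = Suc i..<18. \<Sum>k = Suc j..<18. ?w i j k)"
      using member_le_sum[of i "{0..<18}" "\<lambda>i. \<Sum>j = Suc i..<18. \<Sum>k = Suc j..<18. ?w i j k"] that by (simp add: sum_nonneg)
    also have "\<dots> = 0" using base_degenerate unfolding sum_triples_eq length_base .
    finally show False by simp
  qed
  have nz: "det3 (base_point i) (base_point j) (base_point k) \<noteq> 0" if "i < j" "j < k" "k < 18" for i j k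
    using sorted[OF that] by (simp add: base_point_def det3_int_vec)
  show ?thesis
    unfolding no_three_collinear_def
  proof (intro allI impI)
    fix i j k :: nat assume lt: "i < 18" "j < 18" "k < 18" "distinct [i, j, k]"
    then consider "i < j" "j < k" | "i < k" "k < j" | "j < i" "i < k" | "j < k" "k < i" | "k < i" "i < j" | "k < j" "j < i"
      by fastforce
    then show "det3 (base_point i) (base_point j) (base_point k) \<noteq> 0"
    proof cases
      case 1 then show ?thesis using nz lt by blast
    next
      case 2 then show ?thesis using nz[of i k j] lt det3_swap(2)[of "base_point i" "base_point j" "base_point k"] by simp
    next
      case 3 then show ?thesis using nz[of j i k] lt det3_swap(1)[of "base_point i" "base_point j" "base_point k"] by simp
    next
      case 4 then show ?thesis using nz[of j k i] lt det3_rotate[of "base_point j" "base_point k" "base_point i"] by simp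
    next
      case 5 then show ?thesis using nz[of k i j] lt det3_rotate[of "base_point i" "base_point j" "base_point k"] by simp
    next
      case 6 then show ?thesis using nz[of k j i] lt det3_swap(3)[of "base_point i" "base_point j" "base_point k"] by simp
    qed
  qed
qed

lemma halving_base: "halving_directions 18 base_point base_sign base_direction"
  unfolding halving_directions_def
proof (intro allI impI conjI)
  fix i :: nat assume i: "i < 18"
  let ?v = "base_points ! i" and ?d = "base_directions ! i"
  have "(?v, ?d) \<in> set (zip base_points base_directions)"
    using i length_base by (metis length_zip min.idem nth_mem nth_zip)
  then have z: "card {j. j < 18 \<and> int_det ?v ?d (base_points ! j) = 0} = 1"
    and h: "card {j. j < 18 \<and> 0 < int_sign ?v (base_points ! j) * int_det ?v ?d (base_points ! j)} = 9"
    using base_halving unfolding list_all_iff length_filter_conv_card length_base by auto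
  have self: "int_det ?v ?d ?v = 0" by (rule int_det_self)
  define Z where "Z = {j. j < 18 \<and> int_det ?v ?d (base_points ! j) = 0}"
  obtain x where Z: "Z = {x}" using z card_1_singletonE unfolding Z_def[symmetric] by blast
  have "i \<in> Z" using i self by (simp add: Z_def)
  then have zero: "j = i" if "j \<in> Z" for j using that unfolding Z by simp
  fix j :: nat assume "j < 18" "j \<noteq> i"
  then show "det3 (base_point i) (base_direction i) (base_point j) \<noteq> 0"
    using zero[of j] unfolding base_point_def base_direction_def det3_int_vec Z_def by auto
next
  fix i :: nat assume i: "i < 18"
  let ?v = "base_points ! i" and ?d = "base_directions ! i"
  have "(?v, ?d) \<in> set (zip base_points base_directions)"
    using i length_base by (metis length_zip min.idem nth_mem nth_zip)
  then have h: "card {j. j < 18 \<and> 0 < int_sign ?v (base_points ! j) * int_det ?v ?d (base_points ! j)} = 9"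
    using base_halving unfolding list_all_iff length_filter_conv_card length_base by auto
  have self: "int_det ?v ?d ?v = 0" by (rule int_det_self)
  have "{j. j < 18 \<and> j \<noteq> i \<and> 0 < base_sign i j * det3 (base_point i) (base_direction i) (base_point j)} =
      {j. j < 18 \<and> 0 < int_sign ?v (base_points ! j) * int_det ?v ?d (base_points ! j)}"
    unfolding base_point_def base_direction_def det3_int_vec base_sign_def of_int_mult[symmetric] of_int_0_less_iff
    using self by auto
  then show "2 * card {j. j < 18 \<and> j \<noteq> i \<and> 0 < base_sign i j * det3 (base_point i) (base_direction i) (base_point j)} = 18"
    using h by simp
qed

text \<open>The eight reorderings are removed in two steps: \<open>Q1\<close> has the edge with the
  smallest index first, which costs a factor 2, and in \<open>Q2\<close> both edges are also sorted,
  which costs a factor 4. A member of \<open>Q2\<close> is a sorted quadruple with one of three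
  pairings.\<close>

lemma card_crossing_quads_le_sorted:
  fixes n :: nat
  assumes sg: "edge_signs s"
  defines "S \<equiv> {(i, j, k, l). i < j \<and> j < k \<and> k < l \<and> l < n}"
  shows "card (crossing_quads n p s) \<le> 8 * (\<Sum>(i, j, k, l)\<in>S. (if crosses p s i j k l then 1 else 0) +
      (if crosses p s i k j l then 1 else 0) + (if crosses p s i l j k then 1 else 0))"
proof -
  define Q where "Q = crossing_quads n p s"
  define Q1 where "Q1 = {(a, b, c, d). (a, b, c, d) \<in> Q \<and> min a b < min c d}"
  define Q2 where "Q2 = {(a, b, c, d). (a, b, c, d) \<in> Q \<and> a < b \<and> c < d \<and> a < c}"
  have finQ: "finite Q" unfolding Q_def by (rule finite_crossing_quads)
  have finQ1: "finite Q1" and finQ2: "finite Q2"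
    by (rule finite_subset[OF _ finQ]; auto simp: Q1_def Q2_def)+
  have sym: "(b, a, c, d) \<in> Q" "(a, b, d, c) \<in> Q" "(c, d, a, b) \<in> Q" if "(a, b, c, d) \<in> Q" for a b c d
    using that crosses_swap[OF sg, of p] unfolding Q_def crossing_quads_def by (auto simp: crosses_def)
  have dist: "distinct [a, b, c, d]" if "(a, b, c, d) \<in> Q" for a b c d
    using that by (auto simp: Q_def crossing_quads_def)
  let ?flip = "\<lambda>(a, b, c, d). (c, d, a, b) :: nat \<times> nat \<times> nat \<times> nat"
  have "Q \<subseteq> Q1 \<union> ?flip ` Q1"
  proof
    fix q assume q: "q \<in> Q"
    obtain a b c d where e: "q = (a, b, c, d)" by (cases q)
    have "min a b \<noteq> min c d" using dist[of a b c d] q e by (auto simp: min_def)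
    then consider "min a b < min c d" | "min c d < min a b" by linarith
    then show "q \<in> Q1 \<union> ?flip ` Q1"
    proof cases
      case 1 then show ?thesis using q e by (simp add: Q1_def)
    next
      case 2
      then have "(c, d, a, b) \<in> Q1" using sym(3)[of a b c d] q unfolding e Q1_def by simp
      then have "?flip (c, d, a, b) \<in> ?flip ` Q1" by (rule imageI)
      then show ?thesis using e by simp
    qed
  qed
  then have "card Q \<le> card (Q1 \<union> ?flip ` Q1)" using finQ1 by (intro card_mono) auto
  also have "\<dots> \<le> card Q1 + card Q1" using card_Un_le[of Q1 "?flip ` Q1"] card_image_le[OF finQ1, of ?flip] by linarith
  finally have le1: "card Q \<le> 2 * card Q1" by simp
  define R1 where "R1 = {(x, y, v, w). (y, x, v, w) \<in> Q2}"
  define R2 where "R2 = {(x, y, v, w). (x, y, w, v) \<in> Q2}"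
  define R3 where "R3 = {(x, y, v, w). (y, x, w, v) \<in> Q2}"
  have cR: "card R1 \<le> card Q2" "card R2 \<le> card Q2" "card R3 \<le> card Q2" "finite R1" "finite R2" "finite R3"
    unfolding R1_def R2_def R3_def using card_reindex_quads[OF finQ2] by blast+
  have "Q1 \<subseteq> Q2 \<union> R1 \<union> R2 \<union> R3"
  proof
    fix q assume q: "q \<in> Q1"
    obtain a b c d where e: "q = (a, b, c, d)" by (cases q)
    have Q: "(a, b, c, d) \<in> Q" and m: "min a b < min c d" using q e by (auto simp: Q1_def)
    have "a \<noteq> b" "c \<noteq> d" using dist[OF Q] by auto
    then consider "a < b" "c < d" | "b < a" "c < d" | "a < b" "d < c" | "b < a" "d < c" by linarith
    then show "q \<in> Q2 \<union> R1 \<union> R2 \<union> R3"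
    proof cases
      case 1 then show ?thesis using Q m e by (simp add: Q2_def)
    next
      case 2 then show ?thesis using sym(1)[OF Q] m e by (simp add: Q2_def R1_def)
    next
      case 3 then show ?thesis using sym(2)[OF Q] m e by (simp add: Q2_def R2_def)
    next
      case 4 then show ?thesis using sym(2)[OF sym(1)[OF Q]] m e by (simp add: Q2_def R3_def)
    qed
  qed
  then have "card Q1 \<le> card (Q2 \<union> R1 \<union> R2 \<union> R3)" using finQ2 cR by (intro card_mono) auto
  also have "\<dots> \<le> card Q2 + card R1 + card R2 + card R3"
    by (intro order_trans[OF card_Un_le] add_mono order_refl)
  finally have le2: "card Q1 \<le> 4 * card Q2" using cR by linarith
  have finS: "finite S" unfolding S_def
    by (rule finite_subset[of _ "{..<n} \<times> {..<n} \<times> {..<n} \<times> {..<n}"]) auto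
  define A1 where "A1 = {(i, j, k, l). (i, j, k, l) \<in> S \<and> crosses p s i j k l}"
  define A2 where "A2 = {(i, j, k, l). (i, j, k, l) \<in> S \<and> crosses p s i k j l}"
  define A3 where "A3 = {(i, j, k, l). (i, j, k, l) \<in> S \<and> crosses p s i l j k}"
  have finA: "finite A1" "finite A2" "finite A3"
    by (rule finite_subset[OF _ finS]; auto simp: A1_def A2_def A3_def)+
  let ?f2 = "\<lambda>(i, j, k, l). (i, k, j, l) :: nat \<times> nat \<times> nat \<times> nat"
  let ?f3 = "\<lambda>(i, j, k, l). (i, l, j, k) :: nat \<times> nat \<times> nat \<times> nat"
  have "Q2 \<subseteq> A1 \<union> ?f2 ` A2 \<union> ?f3 ` A3"
  proof
    fix q assume q: "q \<in> Q2"
    obtain a b c d where e: "q = (a, b, c, d)" by (cases q)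
    have Q: "(a, b, c, d) \<in> Q" and m: "a < b" "c < d" "a < c" using q e by (auto simp: Q2_def)
    have ne: "b \<noteq> c" "b \<noteq> d" using dist[OF Q] by auto
    have lt: "b < n" "d < n" and cr: "crosses p s a b c d" using Q by (auto simp: Q_def crossing_quads_def)
    consider "b < c" | "c < b" "b < d" | "d < b" using ne by linarith
    then show "q \<in> A1 \<union> ?f2 ` A2 \<union> ?f3 ` A3"
    proof cases
      case 1
      then have "q \<in> A1" using e m lt cr by (simp add: A1_def S_def)
      then show ?thesis by blast
    next
      case 2
      then have "(a, c, b, d) \<in> A2" using m lt cr by (simp add: A2_def S_def)
      then have "?f2 (a, c, b, d) \<in> ?f2 ` A2" by (rule imageI)
      then show ?thesis using e by simp
    next
      case 3
      then have "(a, c, d, b) \<in> A3" using m lt cr by (simp add: A3_def S_def)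
      then have "?f3 (a, c, d, b) \<in> ?f3 ` A3" by (rule imageI)
      then show ?thesis using e by simp
    qed
  qed
  then have "card Q2 \<le> card (A1 \<union> ?f2 ` A2 \<union> ?f3 ` A3)" using finA by (intro card_mono) auto
  also have "\<dots> \<le> card A1 + card (?f2 ` A2) + card (?f3 ` A3)"
    by (intro order_trans[OF card_Un_le] add_mono order_refl)
  also have "\<dots> \<le> card A1 + card A2 + card A3" using finA by (intro add_mono order_refl card_image_le)
  also have "\<dots> = (\<Sum>(i, j, k, l)\<in>S. (if crosses p s i j k l then 1 else 0) +
      (if crosses p s i k j l then 1 else 0) + (if crosses p s i l j k then 1 else 0))"
  proof -
    have ind: "card {q \<in> S. P q} = (\<Sum>q\<in>S. if P q then 1 else 0)" for P
      using finS by (simp add: sum.If_cases Int_def)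
    have "A1 = {q \<in> S. (\<lambda>(i, j, k, l). crosses p s i j k l) q}" "A2 = {q \<in> S. (\<lambda>(i, j, k, l). crosses p s i k j l) q}"
      "A3 = {q \<in> S. (\<lambda>(i, j, k, l). crosses p s i l j k) q}"
      by (auto simp: A1_def A2_def A3_def)
    then show ?thesis unfolding ind[symmetric] by (simp only: ind sum.distrib[symmetric] case_prod_unfold)
  qed
  finally show ?thesis using le1 le2 unfolding Q_def by linarith
qed

lemma card_crossing_quads_base: "card (crossing_quads 18 base_point base_sign) \<le> 8 * 684"
proof -
  define S where "S = {(i, j, k, l). i < j \<and> j < k \<and> k < l \<and> l < (18 :: nat)}"
  define W where "W i j k l = (if crosses base_point base_sign i j k l then 1 else 0) +
      (if crosses base_point base_sign i k j l then 1 else 0) + (if crosses base_point base_sign i l j k then 1 else (0 :: nat))"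
    for i j k l
  have S: "S = (SIGMA i:{0..<18}. SIGMA j:{Suc i..<18}. SIGMA k:{Suc j..<18}. {Suc k..<18})"
    unfolding S_def by auto
  have "(\<Sum>(i, j, k, l)\<in>S. W i j k l) = (\<Sum>i = 0..<18. \<Sum>j = Suc i..<18. \<Sum>k = Suc j..<18. \<Sum>l = Suc k..<18. W i j k l)"
    unfolding S by (simp add: sum.Sigma)
  then have "int (\<Sum>(i, j, k, l)\<in>S. W i j k l) = (\<Sum>i = 0..<18. \<Sum>j = Suc i..<18. \<Sum>k = Suc j..<18. \<Sum>l = Suc k..<18. int (W i j k l))"
    by simp
  also have "\<dots> = 684"
    using base_crossings unfolding sum_quadruples_eq length_base W_def crosses_base
    by (simp only: of_nat_add of_nat_1 of_nat_0 if_distrib[of int])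
  finally have "(\<Sum>(i, j, k, l)\<in>S. W i j k l) = 684" by linarith
  then show ?thesis
    using card_crossing_quads_le_sorted[OF edge_signs_base, of 18 base_point] unfolding S_def W_def by simp
qed

section \<open>The limit\<close>

lemma is_drawing_relabel:
  assumes D: "is_drawing X V E \<phi> \<gamma>" and \<sigma>: "inj_on \<sigma> W" "\<sigma> ` W \<subseteq> V"
    and E': "\<And>e. e \<in> E' \<Longrightarrow> e \<subseteq> W \<and> \<sigma> ` e \<in> E"
  shows "is_drawing X W E' (\<phi> \<circ> \<sigma>) (\<lambda>e. \<gamma> (\<sigma> ` e))"
proof -
  have ne: "\<sigma> ` e \<noteq> \<sigma> ` f" if "e \<in> E'" "f \<in> E'" "e \<noteq> f" for e f
    using inj_on_image_eq_iff[OF \<sigma>(1)] E' that by blast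
  note D' = is_drawingD[OF D]
  have sub: "(\<phi> \<circ> \<sigma>) ` W \<subseteq> \<phi> ` V" using \<sigma>(2) by (auto simp: image_comp[symmetric])
  have ei: "edge_interior (\<lambda>e. \<gamma> (\<sigma> ` e)) e = edge_interior \<gamma> (\<sigma> ` e)" for e
    by (simp add: edge_interior_def)
  show ?thesis
    unfolding is_drawing_def ei
  proof (intro conjI ballI impI)
    show "(\<phi> \<circ> \<sigma>) ` W \<subseteq> topspace X" using sub D'(1) by blast
    show "inj_on (\<phi> \<circ> \<sigma>) W" using \<sigma> D'(2) by (meson comp_inj_on inj_on_subset)
    fix e assume e: "e \<in> E'"
    then have \<sigma>e: "\<sigma> ` e \<in> E" using E' by blast
    show "simple_arc_in X (\<gamma> (\<sigma> ` e))" by (rule D'(3)[OF \<sigma>e])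
    show "{\<gamma> (\<sigma> ` e) 0, \<gamma> (\<sigma> ` e) 1} = (\<phi> \<circ> \<sigma>) ` e" using D'(4)[OF \<sigma>e] by (simp add: image_comp)
    show "edge_interior \<gamma> (\<sigma> ` e) \<inter> (\<phi> \<circ> \<sigma>) ` W = {}" using D'(5)[OF \<sigma>e] sub by blast
    fix f assume f: "f \<in> E'"
    then have \<sigma>f: "\<sigma> ` f \<in> E" using E' by blast
    {
      assume "e \<noteq> f"
      then show "finite (\<gamma> (\<sigma> ` e) ` {0..1} \<inter> \<gamma> (\<sigma> ` f) ` {0..1})" using D'(6)[OF \<sigma>e \<sigma>f] ne e f by blast
    next
      fix p assume "e \<noteq> f" "p \<in> edge_interior \<gamma> (\<sigma> ` e) \<inter> edge_interior \<gamma> (\<sigma> ` f)"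
      then show "cross_transversally_at X (\<gamma> (\<sigma> ` e) ` {0..1}) (\<gamma> (\<sigma> ` f) ` {0..1}) p"
        using D'(7)[OF \<sigma>e \<sigma>f] ne e f by blast
    next
      fix g assume g: "g \<in> E'" and d: "e \<noteq> f \<and> e \<noteq> g \<and> f \<noteq> g"
      then have \<sigma>g: "\<sigma> ` g \<in> E" using E' by blast
      show "edge_interior \<gamma> (\<sigma> ` e) \<inter> edge_interior \<gamma> (\<sigma> ` f) \<inter> edge_interior \<gamma> (\<sigma> ` g) = {}"
        by (rule D'(8)[OF \<sigma>e \<sigma>f \<sigma>g]) (use ne e f g d in blast)+
    }
  qed
qed

definition complete_edges :: "nat \<Rightarrow> nat set set" where
  "complete_edges n = {e. e \<subseteq> {..<n} \<and> card e = 2}"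

lemma finite_complete_edges: "finite (complete_edges n)"
  unfolding complete_edges_def by (rule finite_subset[of _ "Pow {..<n}"]) auto

lemma relabelled_complete_edge:
  assumes "inj_on \<sigma> {..<m}" "\<sigma> ` {..<m} \<subseteq> {..<n}" "e \<in> complete_edges m"
  shows "e \<subseteq> {..<m} \<and> \<sigma> ` e \<in> complete_edges n"
proof -
  have e: "e \<subseteq> {..<m}" "card e = 2" using assms(3) by (auto simp: complete_edges_def)
  then have "card (\<sigma> ` e) = 2" using card_image[OF inj_on_subset[OF assms(1) e(1)]] by simp
  then show ?thesis using e assms(2) by (auto simp: complete_edges_def)
qed

lemma finite_crossings:
  assumes D: "is_drawing X V E \<phi> \<gamma>" and "finite E"
  shows "finite (crossings E \<gamma>)"
proof (rule finite_subset)
  show "crossings E \<gamma> \<subseteq> (\<Union>e\<in>E. \<Union>f\<in>E - {e}. \<gamma> e ` {0..1} \<inter> \<gamma> f ` {0..1})"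
    unfolding crossings_def edge_interior_def by fastforce
  show "finite (\<Union>e\<in>E. \<Union>f\<in>E - {e}. \<gamma> e ` {0..1} \<inter> \<gamma> f ` {0..1})"
    using assms(2) is_drawingD(6)[OF D] by (intro finite_UN_I finite_Diff) auto
qed

lemma cr_P_complete_le:
  assumes "is_drawing projective_plane {..<n} (complete_edges n) \<phi> \<gamma>"
  shows "cr_P_complete n \<le> card (crossings (complete_edges n) \<gamma>)"
  unfolding cr_P_complete_def crossing_number_def
  by (rule cInf_lower) (use assms in \<open>auto simp: complete_edges_def\<close>)

text \<open>The given drawing keeps the infimum from being the default value of the empty set, so it
  is a minimum.\<close>

lemma cr_P_complete_attained:
  assumes "is_drawing projective_plane {..<n} (complete_edges n) \<phi>0 \<gamma>0"
  obtains \<phi> \<gamma> where "is_drawing projective_plane {..<n} (complete_edges n) \<phi> \<gamma>"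
    "card (crossings (complete_edges n) \<gamma>) = cr_P_complete n"
proof -
  let ?S = "{card (crossings (complete_edges n) \<gamma>) | \<phi> \<gamma>. is_drawing projective_plane {..<n} (complete_edges n) \<phi> \<gamma>}"
  have "?S \<noteq> {}" using assms by blast
  then have "Inf ?S \<in> ?S" by (rule Inf_nat_def1)
  then show thesis
    using that unfolding cr_P_complete_def crossing_number_def complete_edges_def[symmetric] by force
qed

lemma drawing_exists_mono:
  assumes "is_drawing projective_plane {..<n} (complete_edges n) \<phi> \<gamma>" "m \<le> n"
  shows "\<exists>\<phi> \<gamma>. is_drawing projective_plane {..<m} (complete_edges m) \<phi> \<gamma>"
proof -
  have "is_drawing projective_plane {..<m} (complete_edges m) (\<phi> \<circ> id) (\<lambda>e. \<gamma> (id ` e))"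
    using assms(2) by (intro is_drawing_relabel[OF assms(1)] relabelled_complete_edge) auto
  then show ?thesis by blast
qed

text \<open>In an optimal drawing adjacent edges do not cross, so each crossing involves four vertices and
  survives the deletion of the \<open>n - 4\<close> others.\<close>

lemma cr_P_complete_vertex_deletion:
  assumes ex: "is_drawing projective_plane {..<Suc n} (complete_edges (Suc n)) \<phi>0 \<gamma>0" and n: "3 \<le> n"
  shows "Suc n * cr_P_complete n \<le> (n - 3) * cr_P_complete (Suc n)"
proof -
  let ?E = "complete_edges (Suc n)"
  obtain \<phi> \<gamma> where D: "is_drawing projective_plane {..<Suc n} ?E \<phi> \<gamma>"
    and opt: "card (crossings ?E \<gamma>) = cr_P_complete (Suc n)"
    using cr_P_complete_attained[OF ex] by blast
  define C where "C = crossings ?E \<gamma>"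
  have finC: "finite C" unfolding C_def by (rule finite_crossings[OF D finite_complete_edges])
  have EV: "k \<subseteq> {..<Suc n}" "card k = 2" if "k \<in> ?E" for k using that by (auto simp: complete_edges_def)
  \<comment> \<open>Crossing edges with a common end could be uncrossed, and the drawing would not
    be optimal.\<close>
  have disj: "e \<inter> f = {}" if ef: "e \<in> ?E" "f \<in> ?E" "e \<noteq> f" "p \<in> edge_interior \<gamma> e" "p \<in> edge_interior \<gamma> f" for e f p
  proof (rule two_edges_cases[OF EV(2)[OF ef(1)] EV(2)[OF ef(2)] ef(3)])
    fix a b d assume "distinct [a, b, d]" "e = {a, b}" "f = {a, d}"
    then obtain \<gamma>' where "is_drawing projective_plane {..<Suc n} ?E \<phi> \<gamma>'" "crossings ?E \<gamma>' \<subset> crossings ?E \<gamma>"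
      using uncross_adjacent_edges[OF Hausdorff_projective_plane D EV(1) finite_complete_edges _ ef(1-3) _ _ ef(4,5), of a b d]
      by auto
    then have "cr_P_complete (Suc n) < card (crossings ?E \<gamma>)"
      using cr_P_complete_le psubset_card_mono finC unfolding C_def by (metis le_less_trans)
    then show ?thesis using opt by simp
  next
    fix a b c d assume "distinct [a, b, c, d]" "e = {a, b}" "f = {c, d}"
    then show ?thesis by auto
  qed
  \<comment> \<open>These crossings survive the deletion of \<open>v\<close>;
    \<open>\<sigma>\<close> below renumbers the other vertices by skipping \<open>v\<close>.\<close>
  define Cv where "Cv v = {p. \<exists>e\<in>?E. \<exists>f\<in>?E. e \<noteq> f \<and> v \<notin> e \<and> v \<notin> f \<and> p \<in> edge_interior \<gamma> e \<inter> edge_interior \<gamma> f}" for v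
  have CvC: "Cv v \<subseteq> C" for v unfolding Cv_def C_def crossings_def by blast
  have del: "cr_P_complete n \<le> card (Cv v)" if v: "v < Suc n" for v
  proof -
    define \<sigma> where "\<sigma> i = (if i < v then i else Suc i)" for i
    have inj: "inj_on \<sigma> {..<n}" by (rule inj_onI) (auto simp: \<sigma>_def split: if_splits)
    have im: "\<sigma> ` {..<n} \<subseteq> {..<Suc n}" by (auto simp: \<sigma>_def)
    have nv: "\<sigma> i \<noteq> v" for i by (auto simp: \<sigma>_def)
    have rel: "e \<subseteq> {..<n} \<and> \<sigma> ` e \<in> ?E" if "e \<in> complete_edges n" for e
      by (rule relabelled_complete_edge[OF inj im that])
    have D2: "is_drawing projective_plane {..<n} (complete_edges n) (\<phi> \<circ> \<sigma>) (\<lambda>e. \<gamma> (\<sigma> ` e))"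
      by (rule is_drawing_relabel[OF D inj im rel])
    have "crossings (complete_edges n) (\<lambda>e. \<gamma> (\<sigma> ` e)) \<subseteq> Cv v"
    proof
      fix p assume "p \<in> crossings (complete_edges n) (\<lambda>e. \<gamma> (\<sigma> ` e))"
      then obtain e f where ef: "e \<in> complete_edges n" "f \<in> complete_edges n" "e \<noteq> f"
        "p \<in> edge_interior \<gamma> (\<sigma> ` e)" "p \<in> edge_interior \<gamma> (\<sigma> ` f)"
        unfolding crossings_def by (auto simp: edge_interior_def)
      have "\<sigma> ` e \<noteq> \<sigma> ` f" using inj_on_image_eq_iff[OF inj] rel[OF ef(1)] rel[OF ef(2)] ef(3) by blast
      moreover have "v \<notin> \<sigma> ` e" "v \<notin> \<sigma> ` f" using nv by (metis imageE)+
      ultimately show "p \<in> Cv v" unfolding Cv_def mem_Collect_eq using rel[OF ef(1)] rel[OF ef(2)] ef(4,5)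
        by (intro bexI[of _ "\<sigma> ` e"] bexI[of _ "\<sigma> ` f"] conjI IntI) simp_all
    qed
    then have "card (crossings (complete_edges n) (\<lambda>e. \<gamma> (\<sigma> ` e))) \<le> card (Cv v)"
      using finite_subset[OF CvC finC] by (intro card_mono)
    then show ?thesis using cr_P_complete_le[OF D2] by simp
  qed
  \<comment> \<open>Only \<open>e\<close> and \<open>f\<close> pass through \<open>p\<close>, and
    they have four different ends. Deleting an end destroys the crossing, which leaves
    \<open>Suc n - 4 = n - 3\<close> vertices.\<close>
  have few: "card {v \<in> {..<Suc n}. p \<in> Cv v} \<le> n - 3" if p: "p \<in> C" for p
  proof -
    obtain e f where ef: "e \<in> ?E" "f \<in> ?E" "e \<noteq> f" "p \<in> edge_interior \<gamma> e" "p \<in> edge_interior \<gamma> f"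
      using p unfolding C_def crossings_def by blast
    have only: "k = e \<or> k = f" if k: "k \<in> ?E" "p \<in> edge_interior \<gamma> k" for k
    proof (rule ccontr)
      assume "\<not> (k = e \<or> k = f)"
      then have "edge_interior \<gamma> e \<inter> edge_interior \<gamma> f \<inter> edge_interior \<gamma> k = {}"
        using is_drawingD(8)[OF D ef(1,2) k(1) ef(3)] by blast
      then show False using ef k by blast
    qed
    have "{v \<in> {..<Suc n}. p \<in> Cv v} \<subseteq> {..<Suc n} - (e \<union> f)"
    proof
      fix v assume v: "v \<in> {v \<in> {..<Suc n}. p \<in> Cv v}"
      then obtain e' f' where e': "e' \<in> ?E" "f' \<in> ?E" "e' \<noteq> f'" "v \<notin> e'" "v \<notin> f'"
        "p \<in> edge_interior \<gamma> e'" "p \<in> edge_interior \<gamma> f'" unfolding Cv_def by blast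
      then have "e' \<union> f' = e \<union> f" using only[of e'] only[of f'] by blast
      then show "v \<in> {..<Suc n} - (e \<union> f)" using v e' by blast
    qed
    then have "card {v \<in> {..<Suc n}. p \<in> Cv v} \<le> card ({..<Suc n} - (e \<union> f))" by (intro card_mono) auto
    also have "\<dots> = Suc n - card (e \<union> f)"
      using EV(1)[OF ef(1)] EV(1)[OF ef(2)] by (subst card_Diff_subset) (auto intro: finite_subset)
    also have "card (e \<union> f) = 4"
    proof -
      have "finite e" "finite f" using EV(2)[OF ef(1)] EV(2)[OF ef(2)] by (auto intro: card_ge_0_finite)
      then show ?thesis using card_Un_disjoint[of e f] disj[OF ef] EV(2)[OF ef(1)] EV(2)[OF ef(2)] by simp
    qed
    finally show ?thesis by simp
  qed
  \<comment> \<open>Pairs of a deleted vertex and a surviving crossing are counted in two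
    ways.\<close>
  have "Suc n * cr_P_complete n = (\<Sum>v<Suc n. cr_P_complete n)" by simp
  also have "\<dots> \<le> (\<Sum>v<Suc n. card (Cv v))" using del by (intro sum_mono) auto
  also have "\<dots> = (\<Sum>v<Suc n. \<Sum>p\<in>C. if p \<in> Cv v then 1 else 0)"
  proof (rule sum.cong)
    fix v
    have "card (Cv v) = card (C \<inter> Cv v)" using CvC[of v] by (simp add: Int_absorb1)
    then show "card (Cv v) = (\<Sum>p\<in>C. if p \<in> Cv v then 1 else 0)" using finC by (simp add: sum.If_cases Int_def)
  qed simp
  also have "\<dots> = (\<Sum>p\<in>C. \<Sum>v<Suc n. if p \<in> Cv v then 1 else 0)" by (rule sum.swap)
  also have "\<dots> = (\<Sum>p\<in>C. card {v \<in> {..<Suc n}. p \<in> Cv v})"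
    by (rule sum.cong) (simp_all add: sum.If_cases Int_def del: sum.lessThan_Suc lessThan_Suc)
  also have "\<dots> \<le> (\<Sum>p\<in>C. n - 3)" using few by (rule sum_mono)
  also have "\<dots> = (n - 3) * cr_P_complete (Suc n)" using opt by (simp add: C_def)
  finally show ?thesis .
qed

text \<open>\<open>b n\<close> is 24 times the binomial coefficient of \<open>n\<close> over 4, and
  vertex deletion makes the quotients \<open>a\<close> increase. So a bound along the unbounded
  sequence \<open>M\<close> reaches every term, the sequence converges, and replacing
  \<open>b n\<close> by \<open>real n ^ 4\<close> does not change the limit.\<close>

theorem limit_from_drawings:
  fixes c :: real and M :: "nat \<Rightarrow> nat"
  assumes M: "filterlim M at_top sequentially"
    and D: "\<And>j. \<exists>\<phi> \<gamma>. is_drawing projective_plane {..<M j} (complete_edges (M j)) \<phi> \<gamma> \<and>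
        real (card (crossings (complete_edges (M j)) \<gamma>)) \<le> c * real (M j) ^ 4"
  shows "convergent (\<lambda>n. real (cr_P_complete n) / real n ^ 4) \<and> projective_plane_constant \<le> c"
proof -
  have ex: "\<exists>\<phi> \<gamma>. is_drawing projective_plane {..<n} (complete_edges n) \<phi> \<gamma>" for n
  proof -
    obtain j where "n \<le> M j" using M unfolding filterlim_at_top eventually_sequentially by blast
    then show ?thesis using D[of j] drawing_exists_mono by blast
  qed
  define b where "b n = real n * (real n - 1) * (real n - 2) * (real n - 3)" for n
  \<comment> \<open>The shift by 4 keeps the denominator positive.\<close>
  define a where "a n = real (cr_P_complete (n + 4)) / b (n + 4)" for n
  have bpos: "b (n + 4) > 0" for n by (simp add: b_def)
  have "a n \<le> a (Suc n)" for n
  proof -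
    obtain \<phi> \<gamma> where "is_drawing projective_plane {..<Suc (n + 4)} (complete_edges (Suc (n + 4))) \<phi> \<gamma>"
      using ex by blast
    from cr_P_complete_vertex_deletion[OF this]
    have "Suc (n + 4) * cr_P_complete (n + 4) \<le> (n + 1) * cr_P_complete (Suc n + 4)" by simp
    then have "real (Suc (n + 4) * cr_P_complete (n + 4)) \<le> real ((n + 1) * cr_P_complete (Suc n + 4))"
      by (rule of_nat_mono)
    then have le: "(real n + 5) * real (cr_P_complete (n + 4)) \<le> (real n + 1) * real (cr_P_complete (Suc n + 4))"
      by (simp add: algebra_simps)
    have bS: "b (Suc n + 4) * (real n + 1) = b (n + 4) * (real n + 5)" by (simp add: b_def algebra_simps)
    have "real (cr_P_complete (n + 4)) * (b (Suc n + 4) * (real n + 1)) \<le> real (cr_P_complete (Suc n + 4)) * (b (n + 4) * (real n + 1))"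
    proof -
      have "real (cr_P_complete (n + 4)) * (b (Suc n + 4) * (real n + 1)) = b (n + 4) * ((real n + 5) * real (cr_P_complete (n + 4)))"
        unfolding bS by simp
      also have "\<dots> \<le> b (n + 4) * ((real n + 1) * real (cr_P_complete (Suc n + 4)))"
        using le bpos[of n] by (intro mult_left_mono) auto
      finally show ?thesis by (simp add: mult_ac)
    qed
    then have "real (cr_P_complete (n + 4)) * b (Suc n + 4) \<le> real (cr_P_complete (Suc n + 4)) * b (n + 4)"
      by (simp add: mult.assoc[symmetric] del: of_nat_Suc)
    then show ?thesis unfolding a_def using bpos[of n] bpos[of "Suc n"] by (simp add: field_simps)
  qed
  then have inc: "incseq a" by (rule incseq_SucI)
  have ratio: "(\<lambda>n. b n / real n ^ 4) \<longlonglongrightarrow> 1" unfolding b_def by real_asymp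
  \<comment> \<open>The term is bounded by all later terms along \<open>M\<close>, and the bounds of
    these tend to \<open>c\<close>.\<close>
  have ale: "a n \<le> c" for n
  proof (rule LIMSEQ_le_const)
    have "(\<lambda>j. c / (b (M j) / real (M j) ^ 4)) \<longlonglongrightarrow> c / 1"
      by (intro tendsto_divide tendsto_const filterlim_compose[OF ratio M]) simp
    then show "(\<lambda>j. c / (b (M j) / real (M j) ^ 4)) \<longlonglongrightarrow> c" by simp
    obtain N where N: "\<And>j. j \<ge> N \<Longrightarrow> n + 4 \<le> M j"
      using M unfolding filterlim_at_top eventually_sequentially by blast
    show "\<exists>N. \<forall>j\<ge>N. a n \<le> c / (b (M j) / real (M j) ^ 4)"
    proof (intro exI allI impI)
      fix j assume "N \<le> j"
      then have j: "n + 4 \<le> M j" using N by blast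
      define k where "k = M j - 4"
      have k: "M j = k + 4" "n \<le> k" using j by (auto simp: k_def)
      obtain \<phi> \<gamma> where "is_drawing projective_plane {..<M j} (complete_edges (M j)) \<phi> \<gamma>"
        "real (card (crossings (complete_edges (M j)) \<gamma>)) \<le> c * real (M j) ^ 4" using D[of j] by blast
      then have "real (cr_P_complete (M j)) \<le> c * real (M j) ^ 4"
        using cr_P_complete_le by (meson of_nat_le_iff order_trans)
      then have "a k \<le> c * real (M j) ^ 4 / b (M j)"
        unfolding a_def k(1) using bpos[of k] by (intro divide_right_mono) auto
      moreover have "a n \<le> a k" using inc k(2) by (simp add: incseqD)
      ultimately show "a n \<le> c / (b (M j) / real (M j) ^ 4)" by simp
    qed
  qed
  obtain L where L: "a \<longlonglongrightarrow> L" "L \<le> c"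
  proof -
    have "bdd_above (range a)" using ale by (intro bdd_aboveI[of _ c]) auto
    then have "a \<longlonglongrightarrow> (SUP i. a i)" using LIMSEQ_incseq_SUP inc by blast
    moreover have "(SUP i. a i) \<le> c" using ale by (intro cSUP_least) auto
    ultimately show thesis using that by blast
  qed
  have "(\<lambda>n. a n * (b (n + 4) / real (n + 4) ^ 4)) \<longlonglongrightarrow> L * 1"
    by (intro tendsto_mult L LIMSEQ_ignore_initial_segment[OF ratio])
  moreover have "a n * (b (n + 4) / real (n + 4) ^ 4) = real (cr_P_complete (n + 4)) / real (n + 4) ^ 4" for n
    using bpos[of n] by (simp add: a_def)
  ultimately have "(\<lambda>n. real (cr_P_complete (n + 4)) / real (n + 4) ^ 4) \<longlonglongrightarrow> L" by simp
  then have lim: "(\<lambda>n. real (cr_P_complete n) / real n ^ 4) \<longlonglongrightarrow> L"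
    by (rule LIMSEQ_offset)
  then have "projective_plane_constant = L" unfolding projective_plane_constant_def by (rule limI)
  then show ?thesis using lim L(2) convergentI by blast
qed

text \<open>The cubic \<open>f\<close> without constant term that solves
  \<open>16 * f m - f (2 * m) = m * (m - 2)^2 + m * (m - 1) / 2\<close>. Comparing coefficients
  means dividing \<open>1\<close>, \<open>- 7 / 2\<close> and \<open>7 / 2\<close> by
  \<open>16 - 8\<close>, \<open>16 - 4\<close> and \<open>16 - 2\<close>.\<close>

definition doubling_correction :: "real \<Rightarrow> real" where
  "doubling_correction m = m ^ 3 / 8 - 7 * m\<^sup>2 / 24 + m / 4"

text \<open>The correction term turns the recurrence of \<open>doubling\<close> into \<open>t' + f (2 m) \<le> 16 (t + f m)\<close>;
  the start is \<open>684 + f 18 = 1323\<close>.\<close>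

lemma doubled_configurations:
  "\<exists>p s d. no_three_collinear (18 * 2 ^ j) p \<and> edge_signs s \<and> halving_directions (18 * 2 ^ j) p s d \<and>
     real (card (crossing_quads (18 * 2 ^ j) p s)) / 8 + doubling_correction (18 * 2 ^ j) \<le> 1323 * 16 ^ j"
proof (induction j)
  case 0
  have "real (card (crossing_quads 18 base_point base_sign)) \<le> real (8 * 684)"
    using card_crossing_quads_base by (rule of_nat_mono)
  then show ?case
    using no_three_collinear_base edge_signs_base halving_base
    by (intro exI[of _ base_point] exI[of _ base_sign] exI[of _ base_direction]) (simp add: doubling_correction_def)
next
  case (Suc j)
  define n :: nat where "n = 18 * 2 ^ j"
  obtain p s d where c: "no_three_collinear n p" "edge_signs s" "halving_directions n p s d"
    and t: "real (card (crossing_quads n p s)) / 8 + doubling_correction (real n) \<le> 1323 * 16 ^ j"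
    using Suc.IH unfolding n_def by auto
  have n: "2 \<le> n" using one_le_power[of "2 :: nat" j] unfolding n_def by linarith
  obtain p' s' d' where c': "no_three_collinear (2 * n) p'" "edge_signs s'" "halving_directions (2 * n) p' s' d'"
    and t': "card (crossing_quads (2 * n) p' s') \<le> 16 * card (crossing_quads n p s) + 8 * n * (n - 2)\<^sup>2 + 4 * n * (n - 1)"
    using doubling[OF n c] by blast
  have "real (card (crossing_quads (2 * n) p' s')) \<le>
      real (16 * card (crossing_quads n p s) + 8 * n * (n - 2)\<^sup>2 + 4 * n * (n - 1))"
    using t' by (rule of_nat_mono)
  also have "\<dots> = 16 * real (card (crossing_quads n p s)) + 8 * real n * (real n - 2)\<^sup>2 + 4 * real n * (real n - 1)"
    using n by (simp add: of_nat_diff)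
  \<comment> \<open>Divided by 8, the two added terms equal the difference of 16 times the old
    correction and the new one, so they are absorbed exactly.\<close>
  finally have "real (card (crossing_quads (2 * n) p' s')) / 8 + doubling_correction (2 * real n) \<le>
      16 * (real (card (crossing_quads n p s)) / 8 + doubling_correction (real n))"
    by (simp add: doubling_correction_def power2_eq_square power3_eq_cube algebra_simps)
  also have "\<dots> \<le> 16 * (1323 * 16 ^ j)" using t by (rule mult_left_mono) simp
  finally have "real (card (crossing_quads (2 * n) p' s')) / 8 + doubling_correction (2 * real n) \<le> 1323 * 16 ^ Suc j"
    by simp
  moreover have "2 * n = 18 * 2 ^ Suc j" "2 * real n = 18 * 2 ^ Suc j" by (simp_all add: n_def)
  ultimately show ?case using c' by metis
qed

lemma good_drawings:
  "\<exists>\<phi> \<gamma>. is_drawing projective_plane {..<18 * 2 ^ j} (complete_edges (18 * 2 ^ j)) \<phi> \<gamma> \<and>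
     real (card (crossings (complete_edges (18 * 2 ^ j)) \<gamma>)) \<le> 1323 / 18 ^ 4 * real (18 * 2 ^ j) ^ 4"
proof -
  define n :: nat where "n = 18 * 2 ^ j"
  obtain p s d where c: "no_three_collinear n p" "edge_signs s"
    and t: "real (card (crossing_quads n p s)) / 8 + doubling_correction (real n) \<le> 1323 * 16 ^ j"
    using doubled_configurations[of j] unfolding n_def by auto
  obtain p' where p': "no_three_collinear n p'" "no_three_concurrent n p'"
    and sgn: "\<And>i j k. i < n \<Longrightarrow> j < n \<Longrightarrow> k < n \<Longrightarrow> sgn (det3 (p' i) (p' j) (p' k)) = sgn (det3 (p i) (p j) (p k))"
    using perturb_no_three_concurrent[OF c(1)] by blast
  have Q: "crossing_quads n p' s = crossing_quads n p s"
    unfolding crossing_quads_def crosses_sgn by (auto simp: sgn)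
  have n: "18 \<le> n" using one_le_power[of "2 :: nat" j] unfolding n_def by linarith
  then have "3 \<le> n" by simp
  from geodesic_drawing[OF this p' c(2)]
  obtain \<phi> \<gamma> where D: "is_drawing projective_plane {..<n} (complete_edges n) \<phi> \<gamma>"
    and le: "8 * card (crossings (complete_edges n) \<gamma>) \<le> card (crossing_quads n p s)"
    unfolding Q complete_edges_def[symmetric] by blast
  have "0 \<le> doubling_correction (real n)"
  proof -
    have "doubling_correction (real n) = (real n)\<^sup>2 * (real n / 8 - 7 / 24) + real n / 4"
      by (simp add: doubling_correction_def power2_eq_square power3_eq_cube algebra_simps)
    moreover have "18 \<le> real n" using n by simp
    ultimately show ?thesis by simp
  qed
  moreover have "real (8 * card (crossings (complete_edges n) \<gamma>)) \<le> real (card (crossing_quads n p s))"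
    using le by (rule of_nat_mono)
  ultimately have "real (card (crossings (complete_edges n) \<gamma>)) \<le> 1323 * 16 ^ j" using t by simp
  also have "1323 * 16 ^ j = 1323 / 18 ^ 4 * real n ^ 4"
  proof -
    have "(2 ^ j) ^ 4 = ((2 :: real) ^ 4) ^ j" by (metis power_mult mult.commute)
    then show ?thesis by (simp add: n_def power_mult_distrib)
  qed
  finally show ?thesis using D unfolding n_def by blast
qed

text \<open>Convergence is stated as well because \<open>projective_plane_constant\<close> is
  defined by \<open>lim\<close>, which denotes the limit only for a convergent sequence.\<close>

theorem theorem1:
  "convergent (\<lambda>n. real (cr_P_complete n) / real n ^ 4) \<and>
   projective_plane_constant < 1 / (8 * pi ^ 2)"
proof -
  have "strict_mono (\<lambda>j :: nat. 18 * 2 ^ j :: nat)" by (rule strict_monoI) simp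
  then have "filterlim (\<lambda>j :: nat. 18 * 2 ^ j :: nat) at_top sequentially" by (rule filterlim_subseq)
  from limit_from_drawings[OF this good_drawings]
  have lim: "convergent (\<lambda>n. real (cr_P_complete n) / real n ^ 4)" "projective_plane_constant \<le> 1323 / 18 ^ 4" by auto
  \<comment> \<open>This precision is enough: \<open>8 * 1323 * 3.1416 ^ 2\<close> is about 104460,
    while \<open>18 ^ 4 = 104976\<close>.\<close>
  have "pi < 3.1416" using pi_approx(2) by simp
  then have "pi ^ 2 < 3.1416 ^ 2" by (intro power_strict_mono) auto
  then have "1323 / 18 ^ 4 < 1 / (8 * pi ^ 2)" by (simp add: field_simps power2_eq_square)
  then show ?thesis using lim by auto
qed

end
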